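(* Let $T>0$, let $\phi_0,\psi_0$ be real-valued initial data and let $z$ be the solution of the periodic "good" Boussinesq equation $$z_{tt}+z_{xxxx}-z_{xx}-(z^2)_{xx}=0,\quad x\in\mathbb{T},\ t>0,\qquad z(0,x)=\phi_0(x),\quad z_t(0,x)=\psi_0(x).$$ Let $r\ge 1$ and suppose $z\in C(0,T;H^{r+p(r)})$ and $z_t\in C(0,T;H^{r+p(r)-2})$. Let $z^n,z^n_t$ be the numerical approximations produced by the scheme described in the context with step size $\tau$ and $t_n=n\tau$. Then there exists $\tau_0>0$ such that for all $0<\tau\le\tau_0$ and all $n$ with $t_n\le T$, $$\|z(t_n)-z^n\|_r+\|z_t(t_n)-z^n_t\|_{r-2}\le C\tau,$$ where $C>0$ depends on $T$, $\|z\|_{L^\infty(0,T;H^{r+p(r)})}$ and $\|z_t\|_{L^\infty(0,T;H^{r+p(r)-2})}$.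
   Context: $\mathbb{T}=[-\pi,\pi]$ with periodic boundary conditions. For $f\in L^2(\mathbb{T})$, $\widehat f_k=\frac{1}{2\pi}\int_{\mathbb T}f(x)e^{-ikx}dx$, so $f=\sum_{k\in\mathbb Z}\widehat f_ke^{ikx}$. For $s\in\mathbb R$, $H^s$ is the space with norm $\|f\|_s^2=\sum_k(1+k^2)^s|\widehat f_k|^2$, and $\|f\|=\|f\|_0$. $\bar f$ denotes complex conjugation. Fourier multipliers: $\partial_x^{-m}$ ($m\ge1$) has symbol $(ik)^{-m}$ for $k\ne0$ and $0$ for $k=0$; $\partial_x^m$ has symbol $(ik)^m$; $e^{it\partial_x^2}$ has symbol $e^{-itk^2}$; $\langle\partial_x^2\rangle$ has symbol $\sqrt{k^2+k^4}$; $\langle\partial_x^2\rangle^{-1}$ has symbol $(k^2+k^4)^{-1/2}$ for $k\neq0$ and $0$ for $k=0$; $e^{i\tau\langle\partial_x^2\rangle}$ has symbol $e^{i\tau\sqrt{k^2+k^4}}$. Let $B=\langle\partial_x^2\rangle^{-1}\partial_x^2$ and $B^\tau f=Be^{i\tau\langle\partial_x^2\rangle}f$. Let $\psi_1(y)=\int_0^1e^{ys}ds$ and $\psi_1(2i\tau\partial_x^2)$ the multiplier with symbol $\psi_1(-2i\tau k^2)$. Define, for a function $f$: $L_1^\tau(f)=-\frac i2\partial_x^{-2}[(e^{2i\tau\partial_x^2}\partial_x^{-2}\bar f)(\partial_x^2\bar f)]+\frac i2\partial_x^{-2}[(\partial_x^2\bar f)(\partial_x^{-2}\bar f)]$; $L_2^\tau(f)=-\frac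 i2e^{i\tau\partial_x^2}\partial_x^{-3}[(e^{i\tau\partial_x^2}\partial_x\bar f)(e^{-i\tau\partial_x^2}\bar f)]+\frac i2\partial_x^{-3}[(\partial_x\bar f)\bar f]-\tau\partial_x^{-2}[(\partial_x^2\bar f)\bar f]$; $L_3^\tau(f)=-i\partial_x^{-4}(e^{2i\tau\partial_x^2}-1)(\partial_x\bar f)^2$; $L_4^\tau(f)=i\partial_x^{-2}e^{-i\tau\partial_x^2}(e^{i\tau\partial_x^2}\bar f)^2-i\partial_x^{-2}(\bar f)^2-2\tau\partial_x^{-2}(\partial_x\bar f)^2$; $I_1^\tau(f)=\frac i2[(\partial_x^{-1}f)^2-e^{i\tau\partial_x^2}(e^{-i\tau\partial_x^2}\partial_x^{-1}f)^2]$; $I_2^\tau(f)=-\frac i2e^{i\tau\partial_x^2}\partial_x^{-1}[(e^{-i\tau\partial_x^2}f)(e^{i\tau\partial_x^2}\partial_x^{-1}\bar f)]+\frac i2\partial_x^{-1}[f\,\partial_x^{-1}\bar f]+\tau\|f\|^2$. Let $a=\frac1{2\pi}\int_{\mathbb T}\psi_0dx$, $b=\frac1{2\pi}\int_{\mathbb T}\phi_0dx$, and for $t_n=n\tau$ $$\Psi_1^\tau(f)=e^{i\tau\langle\partial_x^2\rangle}f-\frac i4B^\tau\big[2L_1^\tau(f)+2L_2^\tau(f)+L_3^\tau(f)+L_4^\tau(f)+I_1^\tau(f)+2I_2^\tau(f)\big]-i\tau(at_n+b)B^\tau\big(f+\psi_1(2i\tau\partial_x^2)\bar f\big).$$ The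 scheme: $u^0=\phi_0-b-i\langle\partial_x^2\rangle^{-1}(\psi_0-a)$, $u^{n+1}=\Psi_1^\tau(u^n)$ (with $t_n$ in $\Psi_1^\tau$), and $z^n=\frac12(u^n+\overline{u^n})+at_n+b$, $z^n_t=\frac i2\langle\partial_x^2\rangle(u^n-\overline{u^n})+a$. The function $p$ on $[1,\infty)$: $p(1)=1$; $p(r)=(3-2r)+$ for $1<r\le7/6$; $p(r)=2/3$ for $7/6<r\le17/12$; $p(r)=(7/2-2r)+$ for $17/12<r\le3/2$; $p(r)=5/4-r/2$ for $3/2<r<5/2$; $p(5/2)=0+$; $p(r)=0$ for $r>5/2$. Here $c+$ means: the statement holds with $c+\varepsilon$ in place of $p(r)$ for every sufficiently small $\varepsilon>0$ (constants may then depend on $\varepsilon$). *)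

theory Defs
  imports "HOL-Analysis.Analysis"
begin

text \<open>Functions on the torus are represented by their Fourier coefficient sequences
  f = (k \<mapsto> hat f k), k \<in> int (so f = sum of hat f k e^{ikx}).\<close>

type_synonym fs = "int \<Rightarrow> complex"

definition sob_sum :: "real \<Rightarrow> fs \<Rightarrow> real" where
  "sob_sum s f = (\<Sum>\<^sub>\<infinity>k\<in>UNIV. (1 + (real_of_int k)^2) powr s * (cmod (f k))^2)"

definition in_H :: "real \<Rightarrow> fs \<Rightarrow> bool" where
  "in_H s f \<longleftrightarrow> (\<lambda>k. (1 + (real_of_int k)^2) powr s * (cmod (f k))^2) summable_on UNIV"

definition hnorm :: "real \<Rightarrow> fs \<Rightarrow> real" where
  "hnorm s f = sqrt (sob_sum s f)"

definition fadd :: "fs \<Rightarrow> fs \<Rightarrow> fs" where "fadd f g = (\<lambda>k. f k + g k)"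
definition fsub :: "fs \<Rightarrow> fs \<Rightarrow> fs" where "fsub f g = (\<lambda>k. f k - g k)"
definition smul :: "complex \<Rightarrow> fs \<Rightarrow> fs" where "smul c f = (\<lambda>k. c * f k)"
definition fconst :: "complex \<Rightarrow> fs" where "fconst c = (\<lambda>k. if k = 0 then c else 0)"
text \<open>complex conjugation of the function: coefficients cnj (hat f (-k))\<close>
definition fconj :: "fs \<Rightarrow> fs" where "fconj f = (\<lambda>k. cnj (f (- k)))"
text \<open>pointwise product of functions = convolution of coefficients\<close>
definition fprod :: "fs \<Rightarrow> fs \<Rightarrow> fs" where
  "fprod f g = (\<lambda>k. \<Sum>\<^sub>\<infinity>j\<in>UNIV. f j * g (k - j))"

definition fmult :: "(int \<Rightarrow> complex) \<Rightarrow> fs \<Rightarrow> fs" where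
  "fmult m f = (\<lambda>k. m k * f k)"

definition dx :: "nat \<Rightarrow> fs \<Rightarrow> fs" where
  "dx m = fmult (\<lambda>k. (\<i> * of_int k) ^ m)"
definition dxinv :: "nat \<Rightarrow> fs \<Rightarrow> fs" where
  "dxinv m = fmult (\<lambda>k. if k = 0 then 0 else 1 / (\<i> * of_int k) ^ m)"
definition Sch :: "real \<Rightarrow> fs \<Rightarrow> fs" where
  "Sch t = fmult (\<lambda>k. exp (- \<i> * of_real t * (of_int k)^2))"
definition angsym :: "int \<Rightarrow> real" where
  "angsym k = sqrt ((real_of_int k)^2 + (real_of_int k)^4)"
definition ang :: "fs \<Rightarrow> fs" where
  "ang = fmult (\<lambda>k. of_real (angsym k))"
definition anginv :: "fs \<Rightarrow> fs" where
  "anginv = fmult (\<lambda>k. if k = 0 then 0 else of_real (1 / angsym k))"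
definition Eang :: "real \<Rightarrow> fs \<Rightarrow> fs" where
  "Eang t = fmult (\<lambda>k. exp (\<i> * of_real t * of_real (angsym k)))"
definition Bop :: "fs \<Rightarrow> fs" where
  "Bop f = anginv (dx 2 f)"
definition Btau :: "real \<Rightarrow> fs \<Rightarrow> fs" where
  "Btau t f = Bop (Eang t f)"

definition psi1 :: "complex \<Rightarrow> complex" where
  "psi1 y = integral {0..1} (\<lambda>s::real. exp (y * of_real s))"
definition psi1op :: "real \<Rightarrow> fs \<Rightarrow> fs" where
  "psi1op t = fmult (\<lambda>k. psi1 (- 2 * \<i> * of_real t * (of_int k)^2))"

definition l2sq :: "fs \<Rightarrow> real" where
  "l2sq f = (\<Sum>\<^sub>\<infinity>k\<in>UNIV. (cmod (f k))^2)"

definition L1 :: "real \<Rightarrow> fs \<Rightarrow> fs" where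
  "L1 t f = (let g = fconj f in
     fadd (smul (- \<i>/2) (dxinv 2 (fprod (Sch (2*t) (dxinv 2 g)) (dx 2 g))))
          (smul (\<i>/2) (dxinv 2 (fprod (dx 2 g) (dxinv 2 g)))))"

definition L2 :: "real \<Rightarrow> fs \<Rightarrow> fs" where
  "L2 t f = (let g = fconj f in
     fsub (fadd (smul (- \<i>/2) (Sch t (dxinv 3 (fprod (Sch t (dx 1 g)) (Sch (-t) g)))))
                (smul (\<i>/2) (dxinv 3 (fprod (dx 1 g) g))))
          (smul (of_real t) (dxinv 2 (fprod (dx 2 g) g))))"

definition L3 :: "real \<Rightarrow> fs \<Rightarrow> fs" where
  "L3 t f = (let h = fprod (dx 1 (fconj f)) (dx 1 (fconj f)) in
     smul (- \<i>) (dxinv 4 (fsub (Sch (2*t) h) h)))"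

definition L4 :: "real \<Rightarrow> fs \<Rightarrow> fs" where
  "L4 t f = (let g = fconj f in
     fsub (fsub (smul \<i> (dxinv 2 (Sch (-t) (fprod (Sch t g) (Sch t g)))))
                (smul \<i> (dxinv 2 (fprod g g))))
          (smul (2 * of_real t) (dxinv 2 (fprod (dx 1 g) (dx 1 g)))))"

definition I1 :: "real \<Rightarrow> fs \<Rightarrow> fs" where
  "I1 t f = smul (\<i>/2) (fsub (fprod (dxinv 1 f) (dxinv 1 f))
                  (Sch t (fprod (Sch (-t) (dxinv 1 f)) (Sch (-t) (dxinv 1 f)))))"

definition I2 :: "real \<Rightarrow> fs \<Rightarrow> fs" where
  "I2 t f = (let g = fconj f in
     fadd (fadd (smul (- \<i>/2) (Sch t (dxinv 1 (fprod (Sch (-t) f) (Sch t (dxinv 1 g))))))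
                (smul (\<i>/2) (dxinv 1 (fprod f (dxinv 1 g)))))
          (fconst (of_real (t * l2sq f))))"

text \<open>one step Psi_1^tau; a, b are the means of psi_0, phi_0; tn = t_n\<close>
definition Psi1 :: "complex \<Rightarrow> complex \<Rightarrow> real \<Rightarrow> real \<Rightarrow> fs \<Rightarrow> fs" where
  "Psi1 a b t tn f =
     fsub (fsub (Eang t f)
       (smul (\<i>/4) (Btau t
          (fadd (fadd (fadd (fadd (fadd (smul 2 (L1 t f)) (smul 2 (L2 t f))) (L3 t f)) (L4 t f))
                (I1 t f)) (smul 2 (I2 t f))))))
       (smul (\<i> * of_real t * (a * of_real tn + b)) (Btau t (fadd f (psi1op t (fconj f)))))"

definition mean :: "fs \<Rightarrow> complex" where "mean f = f 0"

definition u_init :: "fs \<Rightarrow> fs \<Rightarrow> fs" where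
  "u_init phi0 psi0 = fsub (fsub phi0 (fconst (mean phi0)))
       (smul \<i> (anginv (fsub psi0 (fconst (mean psi0)))))"

primrec useq :: "fs \<Rightarrow> fs \<Rightarrow> real \<Rightarrow> nat \<Rightarrow> fs" where
  "useq phi0 psi0 t 0 = u_init phi0 psi0"
| "useq phi0 psi0 t (Suc n) =
     Psi1 (mean psi0) (mean phi0) t (real n * t) (useq phi0 psi0 t n)"

definition zn :: "fs \<Rightarrow> fs \<Rightarrow> real \<Rightarrow> nat \<Rightarrow> fs" where
  "zn phi0 psi0 t n = (let u = useq phi0 psi0 t n in
     fadd (smul (1/2) (fadd u (fconj u)))
          (fconst (mean psi0 * of_real (real n * t) + mean phi0)))"

definition ztn :: "fs \<Rightarrow> fs \<Rightarrow> real \<Rightarrow> nat \<Rightarrow> fs" where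
  "ztn phi0 psi0 t n = (let u = useq phi0 psi0 t n in
     fadd (smul (\<i>/2) (ang (fsub u (fconj u)))) (fconst (mean psi0)))"

definition real_valued :: "fs \<Rightarrow> bool" where
  "real_valued f \<longleftrightarrow> fconj f = f"

text \<open>z is a solution on [0,T] (Fourier-coefficientwise) of
  z_tt + z_xxxx - z_xx - (z^2)_xx = 0 with z_t = zt\<close>
definition bouss_solution :: "real \<Rightarrow> (real \<Rightarrow> fs) \<Rightarrow> (real \<Rightarrow> fs) \<Rightarrow> bool" where
  "bouss_solution T z zt \<longleftrightarrow>
     (\<forall>k. \<forall>t\<in>{0..T}.
        ((\<lambda>s. z s k) has_vector_derivative zt t k) (at t within {0..T}) \<and>
        ((\<lambda>s. zt s k) has_vector_derivative
            (- ((of_int k)^4 + (of_int k)^2) * z t k - (of_int k)^2 * fprod (z t) (z t) k))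
          (at t within {0..T}))"

definition cont_H :: "real \<Rightarrow> real \<Rightarrow> (real \<Rightarrow> fs) \<Rightarrow> bool" where
  "cont_H s T z \<longleftrightarrow> (\<forall>t\<in>{0..T}. in_H s (z t)) \<and>
     (\<forall>t0\<in>{0..T}. ((\<lambda>t. hnorm s (fsub (z t) (z t0))) \<longlongrightarrow> 0) (at t0 within {0..T}))"

text \<open>the exponent function p: base value and whether it carries a "+"\<close>
definition pbase :: "real \<Rightarrow> real" where
  "pbase r = (if r = 1 then 1
     else if 1 < r \<and> r \<le> 7/6 then 3 - 2*r
     else if 7/6 < r \<and> r \<le> 17/12 then 2/3
     else if 17/12 < r \<and> r \<le> 3/2 then 7/2 - 2*r
     else if 3/2 < r \<and> r < 5/2 then 5/4 - r/2
     else 0)"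

definition pplus :: "real \<Rightarrow> bool" where
  "pplus r \<longleftrightarrow> (1 < r \<and> r \<le> 7/6) \<or> (17/12 < r \<and> r \<le> 3/2) \<or> r = 5/2"

definition pexp :: "real \<Rightarrow> real \<Rightarrow> real" where
  "pexp r \<epsilon> = pbase r + (if pplus r then \<epsilon> else 0)"

end

(* Let w be z minus its mean.  Passing to u = w - i <dx^2>^{-1} w_t turns the equation into
   u_t = i <dx^2> u - i B z^2, and since <dx^2> + dx^2 and B are bounded, the only loss of regularity
   in one step of the scheme comes from the product of two conjugate modes j and l.  The phase
   (j+l)^2 + j^2 + l^2 of that product is split into two summands P and Q, in two ways, and
   e^{-isP} e^{-isQ} is replaced by e^{-isP} + e^{-isQ} - 1.  The error of the resulting symbol is at
   most C s min(|j|,|l|)^2 max(|j|,|l|) / |j+l|, and this kernel maps H^s x H^s to H^r as soon as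
   s >= r/2 + 5/4 (r < 5/2), respectively s > 5/2; the exponent p(r) always satisfies this.
   Each step thus has a local error O(tau^2) in H^r, and the scheme is Lipschitz stable in H^r
   because all its symbols are bounded by tau max(|j|,|l|)^2 / (j+l)^2.

   The solution z is not assumed to be real-valued at positive times.  The conjugate of u is therefore
   replaced by v = w + i <dx^2>^{-1} w_t, and the error estimate is carried out simultaneously for z
   and for its conjugate, which solves the same initial value problem. *)

theory Submission
  imports Defs
begin

text \<open>Write \<open>k = j + l\<close>. Once the free flow is factored out, the products
  \<open>u u\<close> and \<open>u v\<close> oscillate with the phases \<open>2 j l\<close> and
  \<open>2 k l\<close>. Integration in time divides by the phase, which here leaves products of
  one-variable symbols, so these terms are computed exactly. The phase
  \<open>k^2 + j^2 + l^2\<close> of \<open>v v\<close> does not factor, but \<open>2 j^2\<close>,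
  \<open>2 k l\<close>, \<open>2 k^2\<close> and \<open>-2 j l\<close> do, and
  \<open>2 j^2 + 2 k l = 2 k^2 - 2 j l\<close> equals it. Splitting alone is too crude: for small
  \<open>|l|\<close> and \<open>|j|\<close> near \<open>|k|\<close> the error of the first splitting
  is only bounded by a multiple of \<open>s |k l|\<close>, a loss on the high frequency. Hence the
  weight \<open>1 = (j^2 + 2 j l + l^2) / k^2\<close> is inserted and symmetrised to
  \<open>(2 l^2 + 2 j l) / k^2\<close>, and each summand gets the splitting that suits it; the
  triangle inequality between \<open>|j|\<close>, \<open>|l|\<close>, \<open>|k|\<close> then bounds
  both. No bound on the numerical solution is available beforehand. It is obtained inductively, the
  step size being so small that the error stays below 1.\<close>

definition J :: "int \<Rightarrow> real" where
  "J k = sqrt (1 + (real_of_int k)^2)"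

lemma J_sq: "(J k)^2 = 1 + (real_of_int k)^2"
  by (simp add: J_def)

lemma J_ge_1: "1 \<le> J k"
  by (simp add: J_def)

lemma J_pos [simp]: "0 < J k"
  using J_ge_1[of k] by linarith

lemma J_nonneg [simp]: "0 \<le> J k"
  using J_pos[of k] by linarith

lemma J_nz [simp]: "J k \<noteq> 0"
  using J_pos[of k] by linarith

lemma abs_le_J: "\<bar>real_of_int k\<bar> \<le> J k"
  unfolding J_def by (rule real_le_rsqrt) simp

lemma J_minus [simp]: "J (- k) = J k"
  by (simp add: J_def)

lemma J_le_1_abs: "J k \<le> 1 + \<bar>real_of_int k\<bar>"
  unfolding J_def by (rule real_le_lsqrt) (auto simp: power2_sum)

lemma J_mono: "\<bar>j\<bar> \<le> \<bar>l\<bar> \<Longrightarrow> J j \<le> J l"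
  unfolding J_def by (simp add: abs_le_square_iff[symmetric])

lemma J_le_2_abs: "k \<noteq> 0 \<Longrightarrow> J k \<le> 2 * \<bar>real_of_int k\<bar>"
  using J_le_1_abs[of k] by linarith

lemma J_sq_le: "k \<noteq> 0 \<Longrightarrow> (J k)^2 \<le> 2 * (real_of_int k)^2"
proof -
  assume "k \<noteq> 0"
  then have "1 \<le> \<bar>real_of_int k\<bar>" by linarith
  then have "1 \<le> (real_of_int k)^2" by (metis one_power2 power2_abs power_mono zero_le_one)
  then show ?thesis by (simp add: J_sq)
qed

lemma J_add: "J (j + l) \<le> J j + J l"
proof -
  have "real_of_int j * real_of_int l \<le> J j * J l"
    using mult_mono[OF abs_le_J[of j] abs_le_J[of l]] abs_ge_self[of "real_of_int j * real_of_int l"]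
    by (simp add: abs_mult)
  then have "(J (j + l))^2 \<le> (J j + J l)^2"
    by (simp add: power2_sum J_sq)
  then show ?thesis
    by (rule power2_le_imp_le) simp
qed

lemma J_powr_2: "(1 + (real_of_int k)^2) powr s = (J k powr s)^2"
  unfolding J_sq[symmetric] by (simp add: power2_eq_square powr_mult)

section \<open>Bounds in Sobolev norms\<close>

text \<open>A bound on the \<open>H^s\<close> norm tested on finite sets of frequencies only. It
  includes membership in \<open>H^s\<close>, carries no summability side condition, and can be
  proved termwise from bounds on the coefficients.\<close>

definition Hb :: "real \<Rightarrow> fs \<Rightarrow> real \<Rightarrow> bool" where
  "Hb s f A \<longleftrightarrow> (\<forall>F. finite F \<longrightarrow> L2_set (\<lambda>k. J k powr s * cmod (f k)) F \<le> A)"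

lemma HbD: "Hb s f A \<Longrightarrow> finite F \<Longrightarrow> L2_set (\<lambda>k. J k powr s * cmod (f k)) F \<le> A"
  by (simp add: Hb_def)

lemma Hb_nonneg: "Hb s f A \<Longrightarrow> 0 \<le> A"
  using HbD[of s f A "{}"] by simp

lemma Hb_coeff: "Hb s f A \<Longrightarrow> J k powr s * cmod (f k) \<le> A"
  using HbD[of s f A "{k}"] by simp

lemma sob_term: "(1 + (real_of_int k)^2) powr s * (cmod (f k))^2 = (J k powr s * cmod (f k))^2"
  by (simp add: J_powr_2 power_mult_distrib)

lemma Hb_imp_hnorm:
  assumes "Hb s f A"
  shows "in_H s f" "hnorm s f \<le> A"
proof -
  have bd: "(\<Sum>k\<in>F. (J k powr s * cmod (f k))^2) \<le> A^2" if "finite F" for F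
  proof -
    have "(L2_set (\<lambda>k. J k powr s * cmod (f k)) F)^2 \<le> A^2"
      using HbD[OF assms that] by (intro power_mono) auto
    then show ?thesis by (simp add: L2_set_def sum_nonneg)
  qed
  have sm: "(\<lambda>k. (J k powr s * cmod (f k))^2) summable_on UNIV"
    by (rule nonneg_bdd_above_summable_on) (auto intro!: bdd_aboveI2[where M="A^2"] bd)
  then show "in_H s f"
    unfolding in_H_def sob_term .
  have "sob_sum s f \<le> A^2"
    unfolding sob_sum_def sob_term by (rule infsum_le_finite_sums[OF sm]) (use bd in auto)
  then show "hnorm s f \<le> A"
    unfolding hnorm_def using Hb_nonneg[OF assms] by (simp add: real_le_lsqrt)
qed

lemma hnorm_imp_Hb:
  assumes "in_H s f" "hnorm s f \<le> A"
  shows "Hb s f A"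
  unfolding Hb_def
proof (intro allI impI)
  fix F :: "int set" assume F: "finite F"
  have "(\<Sum>k\<in>F. (J k powr s * cmod (f k))^2) \<le> sob_sum s f"
    unfolding sob_sum_def sob_term
    by (rule finite_sum_le_infsum) (use assms F in \<open>auto simp: in_H_def sob_term\<close>)
  then have "L2_set (\<lambda>k. J k powr s * cmod (f k)) F \<le> hnorm s f"
    unfolding L2_set_def hnorm_def by simp
  with assms show "L2_set (\<lambda>k. J k powr s * cmod (f k)) F \<le> A" by linarith
qed

lemma Hb_mult:
  assumes "Hb s g A" "0 \<le> c" "\<And>k. J k powr r * cmod (f k) \<le> c * (J k powr s * cmod (g k))"
  shows "Hb r f (c * A)"
  unfolding Hb_def
proof (intro allI impI)
  fix F :: "int set" assume F: "finite F"
  have "L2_set (\<lambda>k. J k powr r * cmod (f k)) F \<le> L2_set (\<lambda>k. c * (J k powr s * cmod (g k))) F"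
    by (rule L2_set_mono) (use assms in auto)
  also have "\<dots> = c * L2_set (\<lambda>k. J k powr s * cmod (g k)) F"
    by (rule L2_set_right_distrib[OF assms(2), symmetric])
  also have "\<dots> \<le> c * A"
    by (rule mult_left_mono[OF HbD[OF assms(1) F] assms(2)])
  finally show "L2_set (\<lambda>k. J k powr r * cmod (f k)) F \<le> c * A" .
qed

lemma Hb_cmult:
  assumes "Hb s g A" "0 \<le> c" "\<And>k. cmod (f k) \<le> c * cmod (g k)"
  shows "Hb s f (c * A)"
  by (rule Hb_mult[OF assms(1,2)])
     (use mult_left_mono[OF assms(3), of "J _ powr s"] in \<open>simp add: mult_ac\<close>)

lemma Hb_le: "Hb s g A \<Longrightarrow> (\<And>k. cmod (f k) \<le> cmod (g k)) \<Longrightarrow> A \<le> B \<Longrightarrow> Hb s f B"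
  using Hb_cmult[of s g A 1 f] by (auto simp: Hb_def intro: order_trans)

lemma Hb_mono: "Hb s f A \<Longrightarrow> A \<le> B \<Longrightarrow> Hb s f B"
  by (auto simp: Hb_def intro: order_trans)

lemma Hb_lower: "Hb s f A \<Longrightarrow> r \<le> s \<Longrightarrow> Hb r f A"
  using Hb_mult[of s f A 1 r f] by (simp add: J_ge_1 mult_right_mono powr_mono)

lemma Hb_add:
  assumes "Hb s f A" "Hb s g B"
  shows "Hb s (\<lambda>k. f k + g k) (A + B)"
  unfolding Hb_def
proof (intro allI impI)
  fix F :: "int set" assume F: "finite F"
  have "L2_set (\<lambda>k. J k powr s * cmod (f k + g k)) F
      \<le> L2_set (\<lambda>k. J k powr s * cmod (f k) + J k powr s * cmod (g k)) F"
    by (rule L2_set_mono) (auto simp: norm_triangle_ineq mult_left_mono simp flip: distrib_left)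
  also have "\<dots> \<le> A + B"
    by (rule order_trans[OF L2_set_triangle_ineq add_mono[OF HbD[OF assms(1) F] HbD[OF assms(2) F]]])
  finally show "L2_set (\<lambda>k. J k powr s * cmod (f k + g k)) F \<le> A + B" .
qed

lemma Hb_diff:
  assumes "Hb s f A" "Hb s g B"
  shows "Hb s (\<lambda>k. f k - g k) (A + B)"
  using Hb_add[OF assms(1) Hb_le[OF assms(2), of "\<lambda>k. - g k" B]] by simp

lemma Hb_scale:
  assumes "Hb s f A" "\<And>k. cmod (c k) \<le> C" "0 \<le> C"
  shows "Hb s (\<lambda>k. c k * f k) (C * A)"
  by (rule Hb_cmult[OF assms(1,3)]) (simp add: assms(2) norm_mult mult_right_mono)

lemma Hb_fconj: "Hb s f A \<Longrightarrow> Hb s (fconj f) A"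
  unfolding Hb_def
proof (intro allI impI)
  fix F :: "int set"
  assume H: "\<forall>F. finite F \<longrightarrow> L2_set (\<lambda>k. J k powr s * cmod (f k)) F \<le> A" and F: "finite F"
  have "L2_set (\<lambda>k. J k powr s * cmod (fconj f k)) F
      = L2_set (\<lambda>k. J k powr s * cmod (f k)) (uminus ` F)"
    unfolding L2_set_def by (subst sum.reindex) (auto simp: fconj_def)
  with H F show "L2_set (\<lambda>k. J k powr s * cmod (fconj f k)) F \<le> A" by simp
qed

section \<open>Bilinear operators given by a symbol\<close>

text \<open>Bilinear Fourier multiplier: the modes \<open>j\<close> and \<open>l = k - j\<close>
  feed the mode \<open>k\<close> with weight \<open>q j l\<close>. The symbol 1 gives the pointwise
  product; multipliers acting before and after a product give symbols
  \<open>m (j + l) * a j * b l\<close>.\<close>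

definition bil :: "(int \<Rightarrow> int \<Rightarrow> complex) \<Rightarrow> fs \<Rightarrow> fs \<Rightarrow> fs" where
  "bil q f g = (\<lambda>k. \<Sum>\<^sub>\<infinity>j\<in>UNIV. q j (k - j) * (f j * g (k - j)))"

text \<open>Cauchy--Schwarz is applied with the variable of larger modulus held fixed; this is the choice
  that reaches the endpoint of the smoothing condition.\<close>

lemma trilinear_half:
  fixes M :: "int \<Rightarrow> int \<Rightarrow> real"
  assumes X: "finite X"
    and K: "0 \<le> K" "\<And>l G. finite G \<Longrightarrow> (\<Sum>j\<in>G. (M j l)^2) \<le> K^2"
    and a: "\<And>F. finite F \<Longrightarrow> L2_set a F \<le> A"
    and b: "\<And>F. finite F \<Longrightarrow> L2_set b F \<le> B"
    and c: "\<And>F. finite F \<Longrightarrow> L2_set c F \<le> C"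
  shows "(\<Sum>(j,l)\<in>X. \<bar>M j l * b l\<bar> * \<bar>a j * c (j + l)\<bar>) \<le> K * A * B * C"
proof -
  have n: "0 \<le> A" "0 \<le> B" "0 \<le> C"
    using a[of "{}"] b[of "{}"] c[of "{}"] by auto
  define F1 F2 F3 where F: "F1 = fst ` X" "F2 = snd ` X" "F3 = (\<lambda>(j,l). j + l) ` X"
  have fin: "finite F1" "finite F2" "finite F3" using X by (auto simp: F)
  have sq: "(\<Sum>i\<in>G. (h i)^2) \<le> D^2" if "L2_set h G \<le> D" for h :: "int \<Rightarrow> real" and G D
    using power_mono[OF that, of 2] by (simp add: L2_set_def sum_nonneg)
  have "(\<Sum>(j,l)\<in>X. (M j l * b l)^2) \<le> (\<Sum>(j,l)\<in>F1 \<times> F2. (M j l * b l)^2)"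
    by (rule sum_mono2) (use fin in \<open>force simp: F\<close>)+
  also have "\<dots> = (\<Sum>l\<in>F2. (b l)^2 * (\<Sum>j\<in>F1. (M j l)^2))"
    by (subst sum.cartesian_product[symmetric], subst sum.swap)
       (simp add: power_mult_distrib sum_distrib_left mult_ac)
  also have "\<dots> \<le> (\<Sum>l\<in>F2. (b l)^2 * K^2)"
    by (intro sum_mono mult_left_mono K fin) auto
  also have "\<dots> = (\<Sum>l\<in>F2. (b l)^2) * K^2" by (simp add: sum_distrib_right)
  also have "\<dots> \<le> B^2 * K^2" by (intro mult_right_mono sq b fin) auto
  finally have "L2_set (\<lambda>(j,l). M j l * b l) X \<le> K * B"
    unfolding L2_set_def using n K by (intro real_le_lsqrt) (auto simp: power_mult_distrib case_prod_beta mult_ac)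
  moreover have "L2_set (\<lambda>(j,l). a j * c (j + l)) X \<le> A * C"
  proof -
    have inj: "inj_on (\<lambda>(j,l). (j, j + l)) X" by (auto simp: inj_on_def)
    have "(\<Sum>(j,l)\<in>X. (a j * c (j + l))^2) = (\<Sum>(j,k)\<in>(\<lambda>(j,l). (j, j + l)) ` X. (a j * c k)^2)"
      by (subst sum.reindex[OF inj]) (auto simp: case_prod_beta)
    also have "\<dots> \<le> (\<Sum>(j,k)\<in>F1 \<times> F3. (a j * c k)^2)"
      by (rule sum_mono2) (use fin in \<open>force simp: F\<close>)+
    also have "\<dots> = (\<Sum>j\<in>F1. (a j)^2) * (\<Sum>k\<in>F3. (c k)^2)"
      by (simp add: sum_product sum.cartesian_product power_mult_distrib)
    also have "\<dots> \<le> A^2 * C^2"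
      by (intro mult_mono sq a c fin) (auto intro: sum_nonneg)
    finally show ?thesis
      unfolding L2_set_def using n by (intro real_le_lsqrt) (auto simp: power_mult_distrib case_prod_beta mult_ac)
  qed
  ultimately have "L2_set (\<lambda>(j,l). M j l * b l) X * L2_set (\<lambda>(j,l). a j * c (j + l)) X \<le> (K * B) * (A * C)"
    using n K by (intro mult_mono) auto
  moreover have "(\<Sum>(j,l)\<in>X. \<bar>M j l * b l\<bar> * \<bar>a j * c (j + l)\<bar>)
      \<le> L2_set (\<lambda>(j,l). M j l * b l) X * L2_set (\<lambda>(j,l). a j * c (j + l)) X"
    using L2_set_mult_ineq[of "\<lambda>(j,l). M j l * b l" "\<lambda>(j,l). a j * c (j + l)" X] by (simp add: case_prod_beta)
  ultimately show ?thesis by (simp add: mult_ac)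
qed

text \<open>The pairs are divided by which index is larger. Where \<open>|j| <= |l|\<close>,
  \<open>trilinear_half\<close> applies to the kernel cut off to that region; the other region
  becomes the same one after swapping \<open>j\<close> and \<open>l\<close>, by symmetry of
  \<open>M\<close>. Pairs with \<open>|j| = |l|\<close> are counted twice, which only enlarges the
  upper bound.\<close>

lemma trilinear:
  fixes M :: "int \<Rightarrow> int \<Rightarrow> real"
  assumes X: "finite X"
    and K: "0 \<le> K" "\<And>l G. finite G \<Longrightarrow> (\<Sum>j\<in>{j\<in>G. \<bar>j\<bar> \<le> \<bar>l\<bar>}. (M j l)^2) \<le> K^2"
    and sym: "\<And>j l. M j l = M l j"
    and a: "\<And>F. finite F \<Longrightarrow> L2_set a F \<le> A"
    and b: "\<And>F. finite F \<Longrightarrow> L2_set b F \<le> B"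
    and c: "\<And>F. finite F \<Longrightarrow> L2_set c F \<le> C"
  shows "(\<Sum>(j,l)\<in>X. \<bar>M j l\<bar> * \<bar>a j\<bar> * \<bar>b l\<bar> * \<bar>c (j + l)\<bar>) \<le> 2 * K * A * B * C"
proof -
  define N where "N = (\<lambda>j l. if \<bar>j\<bar> \<le> \<bar>l\<bar> then M j l else 0)"
  have N: "(\<Sum>j\<in>G. (N j l)^2) \<le> K^2" if "finite G" for G l
  proof -
    have "(\<Sum>j\<in>G. (N j l)^2) = (\<Sum>j\<in>{j\<in>G. \<bar>j\<bar> \<le> \<bar>l\<bar>}. (M j l)^2)"
      using that by (auto simp: N_def sum.inter_filter intro!: sum.cong)
    with K(2)[OF that] show ?thesis by simp
  qed
  have swap: "(\<Sum>(j,l)\<in>prod.swap ` X. h j l) = (\<Sum>(j,l)\<in>X. h l j)" for h :: "int \<Rightarrow> int \<Rightarrow> real"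
    by (subst sum.reindex) (auto simp: case_prod_beta inj_on_def)
  have "(\<Sum>(j,l)\<in>X. \<bar>M j l\<bar> * \<bar>a j\<bar> * \<bar>b l\<bar> * \<bar>c (j + l)\<bar>)
     \<le> (\<Sum>(j,l)\<in>X. \<bar>N j l * b l\<bar> * \<bar>a j * c (j + l)\<bar> + \<bar>N l j * a j\<bar> * \<bar>b l * c (l + j)\<bar>)"
    by (rule sum_mono) (auto simp: N_def sym abs_mult mult_ac add_ac)
  also have "\<dots> = (\<Sum>(j,l)\<in>X. \<bar>N j l * b l\<bar> * \<bar>a j * c (j + l)\<bar>)
      + (\<Sum>(j,l)\<in>prod.swap ` X. \<bar>N j l * a l\<bar> * \<bar>b j * c (j + l)\<bar>)"
    using swap[of "\<lambda>j l. \<bar>N j l * a l\<bar> * \<bar>b j * c (j + l)\<bar>"]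
    by (simp add: sum.distrib case_prod_beta add.commute)
  also have "\<dots> \<le> K * A * B * C + K * B * A * C"
    by (intro add_mono trilinear_half N K a b c) (use X in auto)
  finally show ?thesis by (simp add: mult_ac)
qed

text \<open>Duality on finite sums: the truncated weighted output is paired with itself,
  \<open>trilinear\<close> bounds the pairing, and one factor is cancelled. The bound does not
  depend on the truncation, so it yields absolute convergence at each mode and survives the
  limit.\<close>

lemma bil_bounded:
  fixes M :: "int \<Rightarrow> int \<Rightarrow> real"
  assumes K: "0 \<le> K" "\<And>l G. finite G \<Longrightarrow> (\<Sum>j\<in>{j\<in>G. \<bar>j\<bar> \<le> \<bar>l\<bar>}. (M j l)^2) \<le> K^2"
    and sym: "\<And>j l. M j l = M l j"
    and q: "\<And>j l. J (j + l) powr r * cmod (q j l) \<le> M j l * J j powr s * J l powr s"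
    and f: "Hb s f A" and g: "Hb s g B"
  shows "Hb r (bil q f g) (2 * K * A * B)" (is ?bd)
    and "(\<lambda>j. cmod (q j (k - j) * (f j * g (k - j)))) summable_on UNIV" (is ?sm)
proof -
  define a where "a = (\<lambda>j. J j powr s * cmod (f j))"
  define b where "b = (\<lambda>j. J j powr s * cmod (g j))"
  define D where "D = 2 * K * A * B"
  have nonneg: "0 \<le> a j" "0 \<le> b j" for j by (auto simp: a_def b_def)
  have n: "0 \<le> A" "0 \<le> B" using f g Hb_nonneg by auto
  have Dn: "0 \<le> D" using n K by (simp add: D_def)
  have a: "L2_set a F \<le> A" and b: "L2_set b F \<le> B" if "finite F" for F
    using HbD[OF f that] HbD[OF g that] by (auto simp: a_def b_def)
  define t where "t = (\<lambda>k j. J k powr r * cmod (q j (k - j) * (f j * g (k - j))))"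
  have tn: "0 \<le> t k j" for k j by (simp add: t_def)
  have t: "t k j \<le> \<bar>M j (k - j)\<bar> * \<bar>a j\<bar> * \<bar>b (k - j)\<bar>" for k j
  proof -
    have "t k j = J (j + (k - j)) powr r * cmod (q j (k - j)) * (cmod (f j) * cmod (g (k - j)))"
      by (simp add: t_def norm_mult mult_ac)
    also have "\<dots> \<le> (M j (k - j) * J j powr s * J (k - j) powr s) * (cmod (f j) * cmod (g (k - j)))"
      by (rule mult_right_mono[OF q]) auto
    also have "\<dots> = M j (k - j) * a j * b (k - j)"
      by (simp add: a_def b_def mult_ac)
    also have "\<dots> \<le> \<bar>M j (k - j) * a j * b (k - j)\<bar>" by simp
    finally show ?thesis by (simp add: abs_mult)
  qed
  have main: "L2_set (\<lambda>k. \<Sum>j\<in>G. t k j) F \<le> D" if F: "finite F" and G: "finite G" for F G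
  proof -
    define c where "c = (\<lambda>k. if k \<in> F then \<Sum>j\<in>G. t k j else 0)"
    define L where "L = L2_set c F"
    have cn: "0 \<le> c k" for k by (auto simp: c_def intro: sum_nonneg tn)
    have c: "L2_set c H \<le> L" if "finite H" for H
    proof -
      have "L2_set c H = L2_set c (H \<inter> F)"
        unfolding L2_set_def by (rule arg_cong[where f=sqrt], rule sum.mono_neutral_right)
          (use that in \<open>auto simp: c_def\<close>)
      also have "\<dots> \<le> L" unfolding L2_set_def L_def
        by (intro real_sqrt_le_mono sum_mono2) (use F in auto)
      finally show ?thesis .
    qed
    define X where "X = (\<lambda>(k,j). (j, k - j)) ` (F \<times> G)"
    have inj: "inj_on (\<lambda>(k,j). (j, k - j)) (F \<times> G)" by (auto simp: inj_on_def)
    have "L^2 = (\<Sum>k\<in>F. c k * c k)"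
      by (simp add: L_def L2_set_def sum_nonneg power2_eq_square)
    also have "\<dots> = (\<Sum>k\<in>F. \<Sum>j\<in>G. t k j * c k)"
      by (intro sum.cong) (auto simp: c_def sum_distrib_right)
    also have "\<dots> = (\<Sum>(k,j)\<in>F \<times> G. t k j * c k)" by (simp add: sum.cartesian_product)
    also have "\<dots> \<le> (\<Sum>(k,j)\<in>F \<times> G. \<bar>M j (k - j)\<bar> * \<bar>a j\<bar> * \<bar>b (k - j)\<bar> * \<bar>c (j + (k - j))\<bar>)"
      by (rule sum_mono) (use t cn in \<open>auto intro!: mult_mono\<close>)
    also have "\<dots> = (\<Sum>(j,l)\<in>X. \<bar>M j l\<bar> * \<bar>a j\<bar> * \<bar>b l\<bar> * \<bar>c (j + l)\<bar>)"
      unfolding X_def by (subst sum.reindex[OF inj]) (auto simp: case_prod_beta)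
    also have "\<dots> \<le> 2 * K * A * B * L"
      by (rule trilinear) (use F G K sym a b c in \<open>auto simp: X_def\<close>)
    finally have "L * L \<le> D * L" by (simp add: D_def power2_eq_square)
    then have "L \<le> D" using Dn
      by (cases "L = 0") (auto simp: L_def L2_set_nonneg less_le)
    moreover have "L = L2_set (\<lambda>k. \<Sum>j\<in>G. t k j) F"
      unfolding L_def by (rule L2_set_cong) (auto simp: c_def)
    ultimately show ?thesis by simp
  qed
  have ts: "t k summable_on UNIV" for k
  proof (rule nonneg_bdd_above_summable_on)
    show "bdd_above (sum (t k) ` {F. F \<subseteq> UNIV \<and> finite F})"
      using main[of "{k}"] by (intro bdd_aboveI2[where M=D]) (auto simp: sum_nonneg tn)
  qed (use tn in auto)
  have sm: "(\<lambda>j. cmod (q j (k - j) * (f j * g (k - j)))) summable_on UNIV" for k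
  proof -
    have "(\<lambda>j. (1 / J k powr r) * t k j) summable_on UNIV"
      by (rule summable_on_cmult_right[OF ts])
    then show ?thesis by (simp add: t_def)
  qed
  show ?sm by (rule sm)
  show ?bd unfolding D_def[symmetric] Hb_def
  proof (intro allI impI)
    fix F :: "int set" assume F: "finite F"
    have le: "J k powr r * cmod (bil q f g k) \<le> infsum (t k) UNIV" for k
    proof -
      have "cmod (bil q f g k) \<le> (\<Sum>\<^sub>\<infinity>j. cmod (q j (k - j) * (f j * g (k - j))))"
        unfolding bil_def by (rule norm_infsum_bound[OF sm])
      then have "J k powr r * cmod (bil q f g k)
          \<le> J k powr r * (\<Sum>\<^sub>\<infinity>j. cmod (q j (k - j) * (f j * g (k - j))))"
        by (intro mult_left_mono) auto
      also have "\<dots> = infsum (t k) UNIV"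
        unfolding t_def by (rule infsum_cmult_right'[symmetric])
      finally show ?thesis .
    qed
    \<comment> \<open>Only the inner sum over \<open>j\<close> has to become infinite;
      \<open>F\<close> stays finite because \<open>Hb\<close> tests finite sets.\<close>
    have "((\<lambda>G. L2_set (\<lambda>k. \<Sum>j\<in>G. t k j) F) \<longlongrightarrow> L2_set (\<lambda>k. infsum (t k) UNIV) F)
        (finite_subsets_at_top UNIV)"
      unfolding L2_set_def by (intro tendsto_intros infsum_tendsto ts)
    then have "L2_set (\<lambda>k. infsum (t k) UNIV) F \<le> D"
    proof (rule tendsto_upperbound)
      show "\<forall>\<^sub>F G in finite_subsets_at_top UNIV. L2_set (\<lambda>k. \<Sum>j\<in>G. t k j) F \<le> D"
        by (intro eventually_finite_subsets_at_top_weakI main F)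
    qed simp
    moreover have "L2_set (\<lambda>k. J k powr r * cmod (bil q f g k)) F \<le> L2_set (\<lambda>k. infsum (t k) UNIV) F"
      by (rule L2_set_mono) (use le in auto)
    ultimately show "L2_set (\<lambda>k. J k powr r * cmod (bil q f g k)) F \<le> D" by linarith
  qed
qed

section \<open>The two convolution kernels\<close>

text \<open>\<open>ks\<close> dominates every symbol of the scheme and governs stability; \<open>ke\<close> dominates the symbol
  of the local error.\<close>

definition ks :: "int \<Rightarrow> int \<Rightarrow> real" where
  "ks j l = (max (J j) (J l) / J (j + l))^2"

definition ke :: "int \<Rightarrow> int \<Rightarrow> real" where
  "ke j l = (min (J j) (J l))^2 * max (J j) (J l) / J (j + l)"

text \<open>The Sobolev weights are absorbed into the kernel, so a mapping property reduces to a
  bound, uniform in \<open>l\<close>, on a square sum over the smaller variable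
  \<open>j\<close>.\<close>

lemma kernel_bounded:
  fixes \<kappa> :: "int \<Rightarrow> int \<Rightarrow> real"
  assumes K: "0 \<le> K" "\<And>l G. finite G \<Longrightarrow>
      (\<Sum>j\<in>{j\<in>G. \<bar>j\<bar> \<le> \<bar>l\<bar>}. (\<kappa> j l * J (j + l) powr r / (J j powr s * J l powr s))^2) \<le> K^2"
    and sym: "\<And>j l. \<kappa> j l = \<kappa> l j"
    and q: "\<And>j l. cmod (q j l) \<le> A * \<kappa> j l" and A: "0 \<le> A"
    and f: "Hb s f a" and g: "Hb s g b"
  shows "Hb r (bil q f g) (2 * K * A * a * b)"
    and "(\<lambda>j. cmod (q j (k - j) * (f j * g (k - j)))) summable_on UNIV"
proof -
  define M where "M = (\<lambda>j l. A * (\<kappa> j l * J (j + l) powr r / (J j powr s * J l powr s)))"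
  have 1: "(\<Sum>j\<in>{j\<in>G. \<bar>j\<bar> \<le> \<bar>l\<bar>}. (M j l)^2) \<le> (A * K)^2" if "finite G" for G l
    using mult_left_mono[OF K(2)[OF that, of l], of "A^2"]
    by (simp add: M_def power_mult_distrib sum_distrib_left power_divide)
  have 2: "M j l = M l j" for j l
    unfolding M_def sym[of j l] by (simp add: add.commute mult.commute)
  have 3: "J (j + l) powr r * cmod (q j l) \<le> M j l * J j powr s * J l powr s" for j l
    using mult_left_mono[OF q[of j l], of "J (j + l) powr r"] by (simp add: M_def mult_ac)
  note B = bil_bounded[OF _ 1 2 3 f g]
  show "Hb r (bil q f g) (2 * K * A * a * b)"
    using B(1) A K(1) by (simp add: mult_ac)
  show "(\<lambda>j. cmod (q j (k - j) * (f j * g (k - j)))) summable_on UNIV"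
    using B(2) A K(1) by simp
qed

lemma sum_J_powr_le:
  assumes e: "e \<le> 0" and G: "finite G" "\<And>j. j \<in> G \<Longrightarrow> \<bar>j\<bar> \<le> int N"
  shows "(\<Sum>j\<in>G. J j powr e) \<le> 1 + 2 * (\<Sum>n=1..N. real n powr e)"
proof -
  have "G \<subseteq> {0} \<union> (int ` {1..N} \<union> (\<lambda>n. - int n) ` {1..N})"
  proof
    fix j assume "j \<in> G"
    then have "\<bar>j\<bar> \<le> int N" by (rule G)
    then show "j \<in> {0} \<union> (int ` {1..N} \<union> (\<lambda>n. - int n) ` {1..N})"
      by (cases j rule: int_cases2) auto
  qed
  then have "(\<Sum>j\<in>G. J j powr e) \<le> (\<Sum>j\<in>{0} \<union> (int ` {1..N} \<union> (\<lambda>n. - int n) ` {1..N}). J j powr e)"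
    by (intro sum_mono2) auto
  also have "\<dots> = (\<Sum>j\<in>{0}. J j powr e)
      + ((\<Sum>j\<in>int ` {1..N}. J j powr e) + (\<Sum>j\<in>(\<lambda>n. - int n) ` {1..N}. J j powr e))"
  proof -
    have "0 \<notin> int ` {1..N}" "0 \<notin> (\<lambda>n. - int n) ` {1..N}" by auto
    moreover have "int ` {1..N} \<inter> (\<lambda>n. - int n) ` {1..N} = {}" by auto
    ultimately show ?thesis by (simp add: sum.union_disjoint)
  qed
  also have "\<dots> = 1 + 2 * (\<Sum>n=1..N. J (int n) powr e)"
    by (subst (1 2) sum.reindex) (auto simp: inj_on_def J_def)
  also have "\<dots> \<le> 1 + 2 * (\<Sum>n=1..N. real n powr e)"
    using e abs_le_J[of "int _"] by (intro add_left_mono mult_left_mono sum_mono powr_mono2') auto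
  finally show ?thesis .
qed

lemma finite_int_bounded:
  assumes "finite (G :: int set)" obtains N where "\<And>j. j \<in> G \<Longrightarrow> \<bar>j\<bar> \<le> int N"
proof
  fix j assume "j \<in> G"
  then have "nat \<bar>j\<bar> \<le> (\<Sum>i\<in>G. nat \<bar>i\<bar>)" using assms by (intro member_le_sum) auto
  then show "\<bar>j\<bar> \<le> int (\<Sum>i\<in>G. nat \<bar>i\<bar>)" by linarith
qed

lemma sum_J_powr_bounded:
  assumes "e < -1"
  shows "\<exists>Z\<ge>0. \<forall>G. finite G \<longrightarrow> (\<Sum>j\<in>G. J j powr e) \<le> Z"
proof (intro exI conjI allI impI)
  have sm: "summable (\<lambda>n. real n powr e)" using assms by (simp add: summable_real_powr_iff)
  show "0 \<le> 1 + 2 * (\<Sum>n. real n powr e)" by (simp add: suminf_nonneg sm)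
  fix G :: "int set" assume G: "finite G"
  obtain N where "\<And>j. j \<in> G \<Longrightarrow> \<bar>j\<bar> \<le> int N" using finite_int_bounded[OF G] by blast
  then have "(\<Sum>j\<in>G. J j powr e) \<le> 1 + 2 * (\<Sum>n=1..N. real n powr e)"
    using assms by (intro sum_J_powr_le G) auto
  also have "\<dots> \<le> 1 + 2 * (\<Sum>n. real n powr e)"
    by (intro add_left_mono mult_left_mono sum_le_suminf sm) auto
  finally show "(\<Sum>j\<in>G. J j powr e) \<le> 1 + 2 * (\<Sum>n. real n powr e)" .
qed

text \<open>Comparison with the integral of \<open>x powr e\<close> over \<open>[0, N]\<close>: each
  summand is at most an increment of the primitive, by the mean value theorem and
  monotonicity.\<close>

lemma sum_powr_le:
  assumes "-1 < e" "e < 0"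
  shows "(\<Sum>n=1..N. real n powr e) \<le> real N powr (e + 1) / (e + 1)"
proof (induction N)
  case (Suc N)
  have "(e + 1) * real (Suc N) powr e \<le> real (Suc N) powr (e + 1) - real N powr (e + 1)"
  proof (cases "N = 0")
    case True
    then show ?thesis using assms by simp
  next
    case False
    have "\<exists>z. real N < z \<and> z < real (Suc N) \<and>
        real (Suc N) powr (e + 1) - real N powr (e + 1) = (real (Suc N) - real N) * ((e + 1) * z powr e)"
      by (rule MVT2) (use False in \<open>auto intro!: derivative_eq_intros simp: powr_diff\<close>)
    then obtain z where z: "real N < z" "z < real (Suc N)"
      "real (Suc N) powr (e + 1) - real N powr (e + 1) = (e + 1) * z powr e" by auto
    then have "real (Suc N) powr e \<le> z powr e" using assms by (intro powr_mono2') auto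
    with z assms show ?thesis by (simp add: mult_left_mono)
  qed
  then have "real (Suc N) powr e \<le> (real (Suc N) powr (e + 1) - real N powr (e + 1)) / (e + 1)"
    using assms by (simp add: field_simps)
  with Suc show ?case by (simp add: diff_divide_distrib)
qed simp

text \<open>Pure power growth, without a logarithm, makes the endpoint \<open>s = 5/4 + r/2\<close>
  of \<open>ke_bounded\<close> admissible. There \<open>e = 4 - 2 * s\<close>, and
  \<open>-1 < e\<close> amounts to \<open>r < 5/2\<close>.\<close>

lemma sum_J_powr_ball:
  assumes "-1 < e"
  shows "\<exists>Z\<ge>0. \<forall>l G. finite G \<longrightarrow> (\<Sum>j\<in>{j\<in>G. \<bar>j\<bar> \<le> \<bar>l\<bar>}. J j powr e) \<le> Z * J l powr (e + 1)"
proof (cases "0 \<le> e")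
  case True
  show ?thesis
  proof (intro exI[of _ 3] conjI allI impI)
    fix l :: int and G :: "int set" assume G: "finite G"
    let ?G = "{j\<in>G. \<bar>j\<bar> \<le> \<bar>l\<bar>}"
    have "(\<Sum>j\<in>?G. J j powr e) \<le> (\<Sum>j\<in>?G. J l powr e)"
      using True by (intro sum_mono powr_mono2) (auto intro: J_mono)
    also have "\<dots> = real (card ?G) * J l powr e" by simp
    also have "\<dots> \<le> (3 * J l) * J l powr e"
    proof (intro mult_right_mono)
      have "card ?G \<le> card {-\<bar>l\<bar>..\<bar>l\<bar>}" by (rule card_mono) auto
      then have "real (card ?G) \<le> 1 + 2 * \<bar>real_of_int l\<bar>" by simp
      then show "real (card ?G) \<le> 3 * J l" using abs_le_J[of l] J_ge_1[of l] by linarith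
    qed simp
    finally show "(\<Sum>j\<in>?G. J j powr e) \<le> 3 * J l powr (e + 1)" by (simp add: powr_add mult_ac)
  qed simp
next
  case False
  show ?thesis
  proof (intro exI[of _ "1 + 2 / (e + 1)"] conjI allI impI)
    show "0 \<le> 1 + 2 / (e + 1)" using assms by simp
    fix l :: int and G :: "int set" assume G: "finite G"
    let ?N = "nat \<bar>l\<bar>"
    have "(\<Sum>j\<in>{j\<in>G. \<bar>j\<bar> \<le> \<bar>l\<bar>}. J j powr e) \<le> 1 + 2 * (\<Sum>n=1..?N. real n powr e)"
      using False G by (intro sum_J_powr_le) auto
    also have "\<dots> \<le> 1 + 2 * (real ?N powr (e + 1) / (e + 1))"
      using False assms by (intro add_left_mono mult_left_mono sum_powr_le) auto
    also have "\<dots> \<le> J l powr (e + 1) + 2 * (J l powr (e + 1) / (e + 1))"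
      using assms abs_le_J[of l] J_ge_1[of l]
      by (intro add_mono mult_left_mono divide_right_mono powr_mono2 ge_one_powr_ge_zero) auto
    finally show "(\<Sum>j\<in>{j\<in>G. \<bar>j\<bar> \<le> \<bar>l\<bar>}. J j powr e) \<le> (1 + 2 / (e + 1)) * J l powr (e + 1)"
      by (simp add: algebra_simps)
  qed
qed

text \<open>One power of \<open>J (j + l)\<close> is left aside to cancel against a denominator of
  the kernels; the other \<open>r - 1\<close> powers fall on the larger frequency, since
  \<open>J (j + l) <= 2 * J l\<close>.\<close>

lemma J_ratio:
  assumes "\<bar>j\<bar> \<le> \<bar>l\<bar>" "1 \<le> r"
  shows "J (j + l) powr r \<le> 2 powr (r - 1) * J (j + l) * J l powr (r - 1)"
proof -
  have "J (j + l) \<le> 2 * J l" using J_add[of j l] J_mono[OF assms(1)] by linarith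
  then have "J (j + l) powr (r - 1) \<le> (2 * J l) powr (r - 1)"
    using assms by (intro powr_mono2) auto
  then have "J (j + l) * J (j + l) powr (r - 1) \<le> J (j + l) * (2 powr (r - 1) * J l powr (r - 1))"
    by (intro mult_left_mono) (auto simp: powr_mult)
  moreover have "J (j + l) * J (j + l) powr (r - 1) = J (j + l) powr r"
    by (simp add: powr_mult_base)
  ultimately show ?thesis by (simp add: mult_ac)
qed

text \<open>For \<open>|j| <= |l|\<close> the weighted kernel is at most a multiple of
  \<open>J l / (J (j + l) * J j)\<close>, and \<open>J l <= J (j + l) + J j\<close> turns this into
  \<open>1 / J j + 1 / J (j + l)\<close>. Both terms are square summable in \<open>j\<close>,
  uniformly in \<open>l\<close>, so no regularity is lost.\<close>

lemma ks_bounded: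
  assumes r: "1 \<le> r"
  shows "\<exists>K\<ge>0. \<forall>q A f g a b. (\<forall>j l. cmod (q j l) \<le> A * ks j l) \<longrightarrow> 0 \<le> A \<longrightarrow> Hb r f a \<longrightarrow> Hb r g b \<longrightarrow>
     Hb r (bil q f g) (K * A * a * b) \<and> (\<forall>k. (\<lambda>j. cmod (q j (k - j) * (f j * g (k - j)))) summable_on UNIV)"
proof -
  obtain Z where Z: "0 \<le> Z" "\<And>G. finite G \<Longrightarrow> (\<Sum>j\<in>G. J j powr (-2)) \<le> Z"
    using sum_J_powr_bounded[of "-2"] by auto
  define c where "c = 2 powr (r - 1)"
  have sym: "ks j l = ks l j" for j l by (simp add: ks_def max.commute add.commute)
  have pt: "(ks j l * J (j + l) powr r / (J j powr r * J l powr r))^2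
      \<le> 2 * c^2 * (J j powr (-2) + J (j + l) powr (-2))" if jl: "\<bar>j\<bar> \<le> \<bar>l\<bar>" for j l
  proof -
    have max: "max (J j) (J l) = J l" using J_mono[OF jl] by simp
    have "J l \<le> J (j + l) + J j" using J_add[of "j + l" "- j"] by simp
    have "J j \<le> J j powr r" using powr_mono[of 1 r "J j"] r J_ge_1[of j] by simp
    have lr: "J l * J l powr (r - 1) = J l powr r" by (simp add: powr_mult_base)
    have "ks j l * J (j + l) powr r / (J j powr r * J l powr r)
        \<le> ks j l * (c * J (j + l) * J l powr (r - 1)) / (J j * J l powr r)"
      using J_ratio[OF jl r] \<open>J j \<le> J j powr r\<close>
      by (intro frac_le mult_left_mono mult_right_mono) (auto simp: c_def ks_def)
    also have "\<dots> = c * (J l / (J (j + l) * J j))"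
      unfolding lr[symmetric] by (simp add: ks_def max power2_eq_square field_simps)
    also have "\<dots> \<le> c * ((J (j + l) + J j) / (J (j + l) * J j))"
      using \<open>J l \<le> J (j + l) + J j\<close> by (intro mult_left_mono divide_right_mono) (auto simp: c_def)
    also have "\<dots> = c * (1 / J j + 1 / J (j + l))" by (simp add: add_divide_distrib)
    finally have "(ks j l * J (j + l) powr r / (J j powr r * J l powr r))^2
        \<le> (c * (1 / J j + 1 / J (j + l)))^2"
      by (rule power_mono) (auto simp: ks_def)
    also have "\<dots> \<le> 2 * c^2 * ((1 / J j)^2 + (1 / J (j + l))^2)"
    proof -
      have "(x + y)^2 \<le> 2 * (x^2 + y^2)" for x y :: real
        using sum_squares_bound[of x y] by (simp add: power2_sum)
      from mult_left_mono[OF this[of "1 / J j" "1 / J (j + l)"], of "c^2"]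
      show ?thesis unfolding power_mult_distrib by (simp only: mult_ac zero_le_power2)
    qed
    also have "\<dots> = 2 * c^2 * (J j powr (-2) + J (j + l) powr (-2))"
      by (simp add: powr_minus power_inverse divide_inverse)
    finally show ?thesis .
  qed
  define K where "K = sqrt (4 * c^2 * Z)"
  have K: "0 \<le> K" "K^2 = 4 * c^2 * Z" using Z by (auto simp: K_def)
  have S: "(\<Sum>j\<in>{j\<in>G. \<bar>j\<bar> \<le> \<bar>l\<bar>}. (ks j l * J (j + l) powr r / (J j powr r * J l powr r))^2) \<le> K^2"
    if G: "finite G" for l G
  proof -
    let ?G = "{j\<in>G. \<bar>j\<bar> \<le> \<bar>l\<bar>}"
    have fin: "finite ?G" using G by simp
    have "(\<Sum>j\<in>?G. (ks j l * J (j + l) powr r / (J j powr r * J l powr r))^2)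
       \<le> (\<Sum>j\<in>?G. 2 * c^2 * (J j powr (-2) + J (j + l) powr (-2)))"
      by (rule sum_mono) (use pt in auto)
    also have "\<dots> = 2 * c^2 * ((\<Sum>j\<in>?G. J j powr (-2)) + (\<Sum>j\<in>(\<lambda>j. j + l) ` ?G. J j powr (-2)))"
      by (subst sum.reindex) (auto simp: sum_distrib_left sum.distrib inj_on_def distrib_left)
    also have "\<dots> \<le> 2 * c^2 * (Z + Z)"
      by (intro mult_left_mono add_mono Z) (use fin in auto)
    finally show ?thesis by (simp add: K)
  qed
  show ?thesis
  proof (intro exI[of _ "2 * K"] conjI allI impI)
    show "0 \<le> 2 * K" using K by simp
  next
    fix q A f g a b
    assume q: "\<forall>j l. cmod (q j l) \<le> A * ks j l" and A: "0 \<le> (A :: real)" and f: "Hb r f a" and g: "Hb r g b"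
    note B = kernel_bounded[OF K(1) S sym q[rule_format] A f g]
    show "Hb r (bil q f g) (2 * K * A * a * b)" by (rule B(1))
    show "(\<lambda>j. cmod (q j (k - j) * (f j * g (k - j)))) summable_on UNIV" for k by (rule B(2))
  qed
qed

text \<open>For \<open>|j| <= |l|\<close> the factor \<open>J (j + l)\<close> cancels entirely and
  the squared weighted kernel separates into
  \<open>J l powr (2 * (r - s)) * J j powr (4 - 2 * s)\<close>, up to a constant. For
  \<open>s > 5/2\<close> the sum over \<open>j\<close> converges; in the other case it grows like
  \<open>J l powr (5 - 2 * s)\<close>, which the first factor has to compensate.\<close>

lemma ke_bounded:
  assumes r: "1 \<le> r" and s: "(5/2 < s \<and> r \<le> s) \<or> (r < 5/2 \<and> s = 5/4 + r/2)"
  shows "\<exists>K\<ge>0. \<forall>q A f g a b. (\<forall>j l. cmod (q j l) \<le> A * ke j l) \<longrightarrow> 0 \<le> A \<longrightarrow> Hb s f a \<longrightarrow> Hb s g b \<longrightarrow>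
     Hb r (bil q f g) (K * A * a * b)"
proof -
  define c where "c = 2 powr (r - 1)"
  have sym: "ke j l = ke l j" for j l by (simp add: ke_def max.commute min.commute add.commute)
  have pt: "(ke j l * J (j + l) powr r / (J j powr s * J l powr s))^2
      \<le> c^2 * J l powr (2 * (r - s)) * J j powr (4 - 2 * s)" if jl: "\<bar>j\<bar> \<le> \<bar>l\<bar>" for j l
  proof -
    have mm: "max (J j) (J l) = J l" "min (J j) (J l) = J j" using J_mono[OF jl] by simp_all
    have "ke j l * J (j + l) powr r / (J j powr s * J l powr s)
        \<le> ke j l * (c * J (j + l) * J l powr (r - 1)) / (J j powr s * J l powr s)"
      using J_ratio[OF jl r]
      by (intro divide_right_mono mult_left_mono) (auto simp: c_def ke_def mm)
    also have "\<dots> = c * (J l * J l powr (r - 1)) / J l powr s * ((J j)^2 / J j powr s)"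
      by (simp add: ke_def mm field_simps)
    also have "J l * J l powr (r - 1) = J l powr r" by (simp add: powr_mult_base)
    also have "c * J l powr r / J l powr s * ((J j)^2 / J j powr s)
        = c * J l powr (r - s) * J j powr (2 - s)"
      by (simp add: powr_diff)
    finally have "(ke j l * J (j + l) powr r / (J j powr s * J l powr s))^2
        \<le> (c * J l powr (r - s) * J j powr (2 - s))^2"
      by (rule power_mono) (auto simp: ke_def mm)
    also have "\<dots> = c^2 * J l powr (2 * (r - s)) * J j powr (4 - 2 * s)"
    proof -
      have "(J i powr x)^2 = J i powr (2 * x)" for i x
        by (simp add: power2_eq_square flip: powr_add)
      then show ?thesis by (simp add: power_mult_distrib right_diff_distrib)
    qed
    finally show ?thesis .
  qed
  have "\<exists>Z\<ge>0. \<forall>l G. finite G \<longrightarrow>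
      (\<Sum>j\<in>{j\<in>G. \<bar>j\<bar> \<le> \<bar>l\<bar>}. J l powr (2 * (r - s)) * J j powr (4 - 2 * s)) \<le> Z"
    using s
  proof
    assume s: "5/2 < s \<and> r \<le> s"
    obtain Z where Z: "0 \<le> Z" "\<And>G. finite G \<Longrightarrow> (\<Sum>j\<in>G. J j powr (4 - 2 * s)) \<le> Z"
      using sum_J_powr_bounded[of "4 - 2 * s"] s by auto
    show ?thesis
    proof (intro exI[of _ Z] conjI allI impI Z(1))
      fix l :: int and G :: "int set" assume G: "finite G"
      have "J l powr (2 * (r - s)) \<le> J l powr 0" using s J_ge_1[of l] by (intro powr_mono) auto
      then have "J l powr (2 * (r - s)) \<le> 1" by simp
      then have "J l powr (2 * (r - s)) * (\<Sum>j\<in>{j\<in>G. \<bar>j\<bar> \<le> \<bar>l\<bar>}. J j powr (4 - 2 * s)) \<le> 1 * Z"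
        by (intro mult_mono Z) (use G in \<open>auto intro: sum_nonneg\<close>)
      then show "(\<Sum>j\<in>{j\<in>G. \<bar>j\<bar> \<le> \<bar>l\<bar>}. J l powr (2 * (r - s)) * J j powr (4 - 2 * s)) \<le> Z"
        by (simp add: sum_distrib_left)
    qed
  next
    assume s: "r < 5/2 \<and> s = 5/4 + r/2"
    obtain Z where Z: "0 \<le> Z" "\<And>l G. finite G \<Longrightarrow>
        (\<Sum>j\<in>{j\<in>G. \<bar>j\<bar> \<le> \<bar>l\<bar>}. J j powr (4 - 2 * s)) \<le> Z * J l powr (4 - 2 * s + 1)"
      using sum_J_powr_ball[of "4 - 2 * s"] s by auto
    show ?thesis
    proof (intro exI[of _ Z] conjI allI impI Z(1))
      fix l :: int and G :: "int set" assume G: "finite G"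
      have "J l powr (2 * (r - s)) * (\<Sum>j\<in>{j\<in>G. \<bar>j\<bar> \<le> \<bar>l\<bar>}. J j powr (4 - 2 * s))
          \<le> J l powr (2 * (r - s)) * (Z * J l powr (4 - 2 * s + 1))"
        by (intro mult_left_mono Z G) auto
      also have "\<dots> = Z * J l powr (2 * (r - s) + (4 - 2 * s + 1))"
        by (simp only: powr_add mult_ac)
      \<comment> \<open>This equation for \<open>s\<close> is the origin of the exponent
        \<open>5/4 + r/2\<close>.\<close>
      also have "2 * (r - s) + (4 - 2 * s + 1) = 0" using s by simp
      finally show "(\<Sum>j\<in>{j\<in>G. \<bar>j\<bar> \<le> \<bar>l\<bar>}. J l powr (2 * (r - s)) * J j powr (4 - 2 * s)) \<le> Z"
        by (simp add: sum_distrib_left)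
    qed
  qed
  then obtain Z where Z: "0 \<le> Z" "\<And>l G. finite G \<Longrightarrow>
      (\<Sum>j\<in>{j\<in>G. \<bar>j\<bar> \<le> \<bar>l\<bar>}. J l powr (2 * (r - s)) * J j powr (4 - 2 * s)) \<le> Z"
    by blast
  define K where "K = sqrt (c^2 * Z)"
  have K: "0 \<le> K" "K^2 = c^2 * Z" using Z by (auto simp: K_def)
  have S: "(\<Sum>j\<in>{j\<in>G. \<bar>j\<bar> \<le> \<bar>l\<bar>}. (ke j l * J (j + l) powr r / (J j powr s * J l powr s))^2) \<le> K^2"
    if G: "finite G" for l G
  proof -
    have "(\<Sum>j\<in>{j\<in>G. \<bar>j\<bar> \<le> \<bar>l\<bar>}. (ke j l * J (j + l) powr r / (J j powr s * J l powr s))^2)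
      \<le> (\<Sum>j\<in>{j\<in>G. \<bar>j\<bar> \<le> \<bar>l\<bar>}. c^2 * (J l powr (2 * (r - s)) * J j powr (4 - 2 * s)))"
      by (rule sum_mono) (use pt in \<open>auto simp: mult.assoc\<close>)
    also have "\<dots> = c^2 * (\<Sum>j\<in>{j\<in>G. \<bar>j\<bar> \<le> \<bar>l\<bar>}. J l powr (2 * (r - s)) * J j powr (4 - 2 * s))"
      by (simp add: sum_distrib_left)
    also have "\<dots> \<le> c^2 * Z" by (intro mult_left_mono Z G) auto
    finally show ?thesis by (simp add: K)
  qed
  show ?thesis
  proof (intro exI[of _ "2 * K"] conjI allI impI)
    show "0 \<le> 2 * K" using K by simp
  next
    fix q A f g a b
    assume q: "\<forall>j l. cmod (q j l) \<le> A * ke j l" and A: "0 \<le> (A :: real)" and f: "Hb s f a" and g: "Hb s g b"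
    show "Hb r (bil q f g) (2 * K * A * a * b)"
      by (rule kernel_bounded(1)[OF K(1) S sym q[rule_format] A f g])
  qed
qed

section \<open>The scheme in terms of bilinear symbols\<close>

text \<open>Symbols need to agree only where both coefficients are nonzero. For functions of mean
  zero this removes the frequencies \<open>j = 0\<close> and \<open>l = 0\<close>, at which the
  inverse derivatives take their default value 0.\<close>

lemma bil_cong:
  assumes "\<And>j. f j \<noteq> 0 \<Longrightarrow> g (k - j) \<noteq> 0 \<Longrightarrow> q j (k - j) = q' j (k - j)"
  shows "bil q f g k = bil q' f g k"
  unfolding bil_def by (rule infsum_cong) (use assms in force)

lemma bil_commute: "bil q f g k = bil (\<lambda>j l. q l j) g f k"
  unfolding bil_def
  by (rule infsum_reindex_bij_witness[of _ "\<lambda>j. k - j" "\<lambda>j. k - j"]) (auto simp: mult.commute)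

lemma bil_mult_outer: "c * bil q f g k = bil (\<lambda>j l. c * q j l) f g k"
  unfolding bil_def by (subst infsum_cmult_right'[symmetric]) (simp add: mult.assoc)

lemma fprod_eq_bil: "fprod f g = bil (\<lambda>_ _. 1) f g"
  by (simp add: fprod_def bil_def)

lemma fprod_fmult: "fprod (fmult a f) (fmult b g) = bil (\<lambda>j l. a j * b l) f g"
  by (simp add: fprod_def bil_def fmult_def mult_ac)

lemma fprod_fmult1: "fprod (fmult a f) g = bil (\<lambda>j l. a j) f g"
  by (simp add: fprod_def bil_def fmult_def mult_ac)

lemma fprod_fmult2: "fprod f (fmult b g) = bil (\<lambda>j l. b l) f g"
  by (simp add: fprod_def bil_def fmult_def mult_ac)

lemma fmult_fmult: "fmult a (fmult b f) = fmult (\<lambda>k. a k * b k) f"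
  by (simp add: fmult_def mult_ac)

lemma bil_mult_inner: "bil q (\<lambda>j. a j * f j) (\<lambda>j. b j * g j) = bil (\<lambda>j l. q j l * (a j * b l)) f g"
  by (simp add: bil_def mult_ac)

section \<open>Absolute convergence and linearity of bilinear multipliers\<close>

definition summ :: "(int \<Rightarrow> int \<Rightarrow> complex) \<Rightarrow> fs \<Rightarrow> fs \<Rightarrow> int \<Rightarrow> bool" where
  "summ q f g k \<longleftrightarrow> (\<lambda>j. cmod (q j (k - j) * (f j * g (k - j)))) summable_on UNIV"

lemma summ_summable: "summ q f g k \<Longrightarrow> (\<lambda>j. q j (k - j) * (f j * g (k - j))) summable_on UNIV"
  unfolding summ_def by (rule abs_summable_summable)

lemma infsum_diff:
  fixes f g :: "'a \<Rightarrow> complex"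
  assumes "f summable_on A" "g summable_on A"
  shows "infsum (\<lambda>x. f x - g x) A = infsum f A - infsum g A"
  using infsum_add[OF assms(1) summable_on_uminus[THEN iffD2, OF assms(2)]] by (simp add: infsum_uminus)

lemma summable_on_diff:
  fixes f g :: "'a \<Rightarrow> complex"
  assumes "f summable_on A" "g summable_on A"
  shows "(\<lambda>x. f x - g x) summable_on A"
  using summable_on_add[OF assms(1) summable_on_uminus[THEN iffD2, OF assms(2)]] by simp

text \<open>The infinite sum of a non-summable family is 0 by convention, so even additivity in the
  symbol needs convergence at the mode considered; this is the purpose of
  \<open>summ\<close>.\<close>

lemma bil_add:
  assumes "summ p f g k" "summ q f g k"
  shows "bil p f g k + bil q f g k = bil (\<lambda>j l. p j l + q j l) f g k"
  unfolding bil_def using infsum_add[OF summ_summable[OF assms(1)] summ_summable[OF assms(2)]]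
  by (simp add: distrib_right)

lemma bil_diff:
  assumes "summ p f g k" "summ q f g k"
  shows "bil p f g k - bil q f g k = bil (\<lambda>j l. p j l - q j l) f g k"
  unfolding bil_def using infsum_diff[OF summ_summable[OF assms(1)] summ_summable[OF assms(2)]]
  by (simp add: left_diff_distrib)

lemma bil_add_left:
  assumes "summ q f h k" "summ q g h k"
  shows "bil q (\<lambda>j. f j + g j) h k = bil q f h k + bil q g h k"
  unfolding bil_def using infsum_add[OF summ_summable[OF assms(1)] summ_summable[OF assms(2)]]
  by (simp add: algebra_simps)

lemma bil_diff_left:
  assumes "summ q f h k" "summ q g h k"
  shows "bil q (\<lambda>j. f j - g j) h k = bil q f h k - bil q g h k"
  unfolding bil_def using infsum_diff[OF summ_summable[OF assms(1)] summ_summable[OF assms(2)]]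
  by (simp add: algebra_simps)

lemma bil_add_right:
  assumes "summ q h f k" "summ q h g k"
  shows "bil q h (\<lambda>j. f j + g j) k = bil q h f k + bil q h g k"
  unfolding bil_def using infsum_add[OF summ_summable[OF assms(1)] summ_summable[OF assms(2)]]
  by (simp add: algebra_simps)

lemma bil_diff_right:
  assumes "summ q h f k" "summ q h g k"
  shows "bil q h (\<lambda>j. f j - g j) k = bil q h f k - bil q h g k"
  unfolding bil_def using infsum_diff[OF summ_summable[OF assms(1)] summ_summable[OF assms(2)]]
  by (simp add: algebra_simps)

lemma summ_cmult:
  assumes "summ q f g k" shows "summ (\<lambda>j l. c * q j l) f g k"
proof -
  have "(\<lambda>j. cmod c * cmod (q j (k - j) * (f j * g (k - j)))) summable_on UNIV"
    using assms unfolding summ_def by (rule summable_on_cmult_right)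
  then show ?thesis by (simp add: summ_def norm_mult mult_ac)
qed

lemma summ_cong:
  assumes "summ q f g k" "\<And>j. f j \<noteq> 0 \<Longrightarrow> g (k - j) \<noteq> 0 \<Longrightarrow> q' j (k - j) = q j (k - j)"
  shows "summ q' f g k"
proof -
  have "(\<lambda>j. cmod (q' j (k - j) * (f j * g (k - j)))) = (\<lambda>j. cmod (q j (k - j) * (f j * g (k - j))))"
  proof
    fix j
    show "cmod (q' j (k - j) * (f j * g (k - j))) = cmod (q j (k - j) * (f j * g (k - j)))"
      using assms(2)[of j] by (cases "f j = 0 \<or> g (k - j) = 0") auto
  qed
  with assms(1) show ?thesis by (simp add: summ_def)
qed

lemma summ_add:
  assumes "summ p f g k" "summ q f g k"
  shows "summ (\<lambda>j l. p j l + q j l) f g k"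
  unfolding summ_def
proof (rule summable_on_comparison_test)
  show "(\<lambda>j. cmod (p j (k - j) * (f j * g (k - j))) + cmod (q j (k - j) * (f j * g (k - j)))) summable_on UNIV"
    using assms unfolding summ_def by (rule summable_on_add)
qed (auto simp: distrib_right norm_triangle_ineq)

lemma ks_lower: "(J j)^2 + (J l)^2 \<le> 2 * (J (j + l))^2 * ks j l"
proof -
  have "(J j)^2 \<le> (max (J j) (J l))^2" "(J l)^2 \<le> (max (J j) (J l))^2"
    by (auto intro!: power_mono)
  moreover have "(J (j + l))^2 * ks j l = (max (J j) (J l))^2"
    by (simp add: ks_def power_divide)
  ultimately show ?thesis by linarith
qed

text \<open>Makes every bounded symbol, in particular the symbol 1 of the pointwise product, a
  \<open>ks\<close> symbol.\<close>

lemma ks_ge: "1 \<le> 4 * ks j l"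
proof -
  have "J (j + l) \<le> 2 * max (J j) (J l)" using J_add[of j l] by linarith
  then have "1 \<le> 2 * max (J j) (J l) / J (j + l)" by simp
  then have "1^2 \<le> (2 * max (J j) (J l) / J (j + l))^2" by (intro power_mono) auto
  also have "\<dots> = 4 * ks j l" by (simp add: ks_def power_divide)
  finally show ?thesis by simp
qed

lemma ks_nonneg: "0 \<le> ks j l"
  by (simp add: ks_def)

text \<open>At one fixed output mode \<open>k\<close> the denominator \<open>(J k)^2\<close> of
  \<open>ks\<close> is a constant, so \<open>ks\<close> dominates quadratic growth. This serves the
  single terms of the scheme, whose products contain up to two derivatives.\<close>

lemma summ_quadratic:
  assumes r: "1 \<le> r" and f: "Hb r f a" and g: "Hb r g b"
    and q: "\<And>j. cmod (q j (k - j)) \<le> C * ((J j)^2 + (J (k - j))^2)"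
  shows "summ q f g k"
proof -
  \<comment> \<open>The cut-off extends the bound, known on the line \<open>j + l = k\<close> only,
    to all pairs, as \<open>ks_bounded\<close> demands.\<close>
  define q' where "q' = (\<lambda>j l. if j + l = k then q j l else 0)"
  have C: "0 \<le> C"
  proof (rule ccontr)
    assume "\<not> 0 \<le> C"
    moreover have "0 < (J 0)^2 + (J k)^2" by (simp add: add_pos_pos)
    ultimately have "C * ((J 0)^2 + (J k)^2) < 0" by (simp add: mult_neg_pos)
    with order_trans[OF norm_ge_zero q[of 0]] show False by simp
  qed
  have "cmod (q' j l) \<le> (2 * C * (J k)^2) * ks j l" for j l
  proof (cases "j + l = k")
    case True
    then have "cmod (q' j l) \<le> C * ((J j)^2 + (J l)^2)" using q[of j] by (auto simp: q'_def)
    also have "\<dots> \<le> C * (2 * (J k)^2 * ks j l)"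
      using ks_lower[of j l] True C by (intro mult_left_mono) auto
    finally show ?thesis by (simp add: mult_ac)
  qed (use C in \<open>auto simp: q'_def ks_nonneg\<close>)
  moreover obtain K where "\<forall>q A f g a b. (\<forall>j l. cmod (q j l) \<le> A * ks j l) \<longrightarrow> 0 \<le> A \<longrightarrow> Hb r f a \<longrightarrow> Hb r g b \<longrightarrow>
     Hb r (bil q f g) (K * A * a * b) \<and> (\<forall>k. (\<lambda>j. cmod (q j (k - j) * (f j * g (k - j)))) summable_on UNIV)"
    using ks_bounded[OF r] by blast
  ultimately have "summ q' f g k"
    unfolding summ_def using C f g by (metis (no_types, lifting) mult_nonneg_nonneg zero_le_numeral zero_le_power2)
  then show ?thesis by (rule summ_cong) (simp add: q'_def)
qed

lemma one_le_J2: "1 \<le> (J j)^2"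
  by (simp add: J_sq)

lemma summ_bounded:
  assumes r: "1 \<le> r" and f: "Hb r f a" and g: "Hb r g b"
    and q: "\<And>j. cmod (q j (k - j)) \<le> C"
  shows "summ q f g k"
proof (rule summ_quadratic[OF r f g])
  fix j
  have "0 \<le> C" using q[of 0] norm_ge_zero order_trans by blast
  moreover have "1 \<le> (J j)^2 + (J (k - j))^2" using one_le_J2[of j] one_le_J2[of "k - j"] by linarith
  ultimately have "C * 1 \<le> C * ((J j)^2 + (J (k - j))^2)" by (intro mult_left_mono) auto
  with q[of j] show "cmod (q j (k - j)) \<le> C * ((J j)^2 + (J (k - j))^2)" by simp
qed

text \<open>The integral of \<open>exp (- i s \<theta>)\<close> over \<open>s\<close> in
  \<open>[0, t]\<close>, in closed form; the resonant case \<open>\<theta> = 0\<close> has to be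
  given separately.\<close>

definition Eint :: "real \<Rightarrow> real \<Rightarrow> complex" where
  "Eint t \<theta> = (if \<theta> = 0 then of_real t else \<i> / of_real \<theta> * (cis (- (t * \<theta>)) - 1))"

lemma Eint_0 [simp]: "Eint 0 \<theta> = 0" "Eint t 0 = of_real t"
  by (simp_all add: Eint_def)

lemma cis_deriv:
  "((\<lambda>t. cis (- (t * \<theta>))) has_vector_derivative (- \<i> * of_real \<theta> * cis (- (t * \<theta>)))) (at t within S)"
  unfolding has_vector_derivative_def
  by (auto intro!: derivative_eq_intros simp: scaleR_conv_of_real)

lemma Eint_deriv: "((\<lambda>t. Eint t \<theta>) has_vector_derivative cis (- (t * \<theta>))) (at t within S)"
proof (cases "\<theta> = 0")
  case True
  then show ?thesis
    by (auto simp: has_vector_derivative_def scaleR_conv_of_real intro!: derivative_eq_intros)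
next
  case False
  have "((\<lambda>t. \<i> / of_real \<theta> * (cis (- (t * \<theta>)) - 1)) has_vector_derivative
      (\<i> / of_real \<theta> * (- \<i> * of_real \<theta> * cis (- (t * \<theta>)) - 0))) (at t within S)"
    by (intro has_vector_derivative_mult_right has_vector_derivative_diff cis_deriv has_vector_derivative_const)
  with False show ?thesis by (simp add: Eint_def)
qed

lemma norm_cis_minus_1: "cmod (cis x - 1) \<le> \<bar>x\<bar>"
  using abs_sin_x_le_abs_x[of "x/2"] by (simp add: cis_conv_exp dist_exp_i_1)

lemma norm_cis_diff: "cmod (cis x - cis y) \<le> \<bar>x - y\<bar>"
proof -
  have "cis x - cis y = cis y * (cis (x - y) - 1)"
    by (simp add: right_diff_distrib cis_mult)
  then show ?thesis using norm_cis_minus_1[of "x - y"] by (simp add: norm_mult)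
qed

lemma norm_Eint: "0 \<le> t \<Longrightarrow> cmod (Eint t \<theta>) \<le> t"
  using norm_cis_minus_1[of "- (t * \<theta>)"]
  by (auto simp: Eint_def norm_mult norm_divide abs_mult pos_divide_le_eq)

lemma Sch_cis: "Sch t = fmult (\<lambda>k. cis (- (t * (real_of_int k)^2)))"
  unfolding Sch_def by (simp add: cis_conv_exp mult.assoc)

lemma Eang_cis: "Eang t = fmult (\<lambda>k. cis (t * angsym k))"
  unfolding Eang_def by (simp add: cis_conv_exp mult.assoc)

text \<open>Rescaling the integral that defines \<open>psi1\<close> by \<open>t\<close> gives the
  integral of \<open>exp (- 2 i s k^2)\<close> over \<open>[0, t]\<close>.\<close>

lemma psi1_Eint: "of_real t * psi1 (- 2 * \<i> * of_real t * (of_int k)^2) = Eint t (2 * (real_of_int k)^2)"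
proof (cases "t = 0 \<or> k = 0")
  case True
  then show ?thesis by (auto simp: psi1_def)
next
  case False
  define y where "y = - 2 * \<i> * of_real t * (of_int k)^2"
  have y: "y \<noteq> 0" using False by (simp add: y_def)
  have "((\<lambda>s. exp (y * of_real s)) has_integral (exp (y * of_real 1) / y - exp (y * of_real 0) / y)) {0..1}"
    by (rule fundamental_theorem_of_calculus)
       (use y in \<open>auto intro!: derivative_eq_intros has_vector_derivative_real_field simp: field_simps\<close>)
  then have "psi1 y = (exp y - 1) / y"
    unfolding psi1_def by (simp add: integral_unique diff_divide_distrib)
  moreover have "exp y = cis (- (t * (2 * (real_of_int k)^2)))"
    by (simp add: y_def cis_conv_exp mult_ac)
  moreover have "of_real t / y = \<i> / of_real (2 * (real_of_int k)^2)"
    using False by (simp add: y_def field_simps)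
  ultimately show ?thesis using False unfolding y_def[symmetric] Eint_def
    by (simp add: mult_ac) (metis (no_types, lifting) times_divide_eq_left mult.commute)
qed

lemma bil_lin2:
  assumes "summ p f g k" "summ q f g k"
  shows "c * bil p f g k + d * bil q f g k = bil (\<lambda>j l. c * p j l + d * q j l) f g k"
  using bil_add[OF summ_cmult[OF assms(1), of c] summ_cmult[OF assms(2), of d]]
  by (simp add: bil_mult_outer)

lemma bil_lin3:
  assumes "summ p f g k" "summ q f g k" "summ w f g k"
  shows "c * bil p f g k + d * bil q f g k + e * bil w f g k
    = bil (\<lambda>j l. c * p j l + d * q j l + e * w j l) f g k"
proof -
  have "summ (\<lambda>j l. c * p j l + d * q j l) f g k"
    by (intro summ_add summ_cmult assms)
  from bil_add[OF this summ_cmult[OF assms(3), of e]] bil_lin2[OF assms(1,2)]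
  show ?thesis by (simp add: bil_mult_outer)
qed

definition dinv :: "nat \<Rightarrow> int \<Rightarrow> complex" where
  "dinv m k = (if k = 0 then 0 else 1 / (\<i> * of_int k) ^ m)"

lemma dxinv_dinv: "dxinv m = fmult (dinv m)"
  by (simp add: dxinv_def dinv_def[abs_def])

lemma dxinv_nz: "k \<noteq> 0 \<Longrightarrow> dxinv m f k = 1 / (\<i> * of_int k) ^ m * f k"
  by (simp add: dxinv_def fmult_def)

lemma fmult_at: "fmult a f k = a k * f k"
  by (simp add: fmult_def)

lemma norm_dinv: "cmod (dinv m k) \<le> 1"
proof (cases "k = 0")
  case False
  then have "1 \<le> \<bar>real_of_int k\<bar>" by linarith
  then have "1 \<le> \<bar>real_of_int k\<bar> ^ m" by (rule one_le_power)
  with False show ?thesis by (simp add: dinv_def norm_divide norm_power norm_mult field_simps)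
qed (simp add: dinv_def)

lemma abs_le_J2: "\<bar>real_of_int k\<bar> \<le> (J k)^2" "\<bar>real_of_int k\<bar>^2 \<le> (J k)^2"
proof -
  show "\<bar>real_of_int k\<bar>^2 \<le> (J k)^2" by (simp add: J_sq)
  have "\<bar>real_of_int k\<bar> * 1 \<le> J k * J k"
    using abs_le_J[of k] J_ge_1[of k] by (intro mult_mono) auto
  then show "\<bar>real_of_int k\<bar> \<le> (J k)^2" by (simp add: power2_eq_square)
qed

lemma abs_mult_le_J2: "\<bar>real_of_int j\<bar> * \<bar>real_of_int l\<bar> \<le> (J j)^2 + (J l)^2"
proof -
  have "\<bar>real_of_int j\<bar> * \<bar>real_of_int l\<bar> \<le> J j * J l"
    using abs_le_J by (intro mult_mono) auto
  moreover have "0 \<le> J j * J l" by simp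
  moreover note sum_squares_bound[of "J j" "J l"]
  ultimately show ?thesis by linarith
qed

section \<open>The symbols of the six nonlinear terms of the scheme\<close>

context
  fixes r a :: real and f g :: fs and k :: int
  assumes r: "1 \<le> r" and f: "Hb r f a" and f0: "f 0 = 0" and k: "k \<noteq> 0" and g_def: "g = fconj f"
begin

private lemma g: "Hb r g a" and g0: "g 0 = 0"
  using f f0 by (auto simp: g_def Hb_fconj) (simp add: fconj_def)

private lemma nz: "f j \<noteq> 0 \<Longrightarrow> j \<noteq> 0" "g j \<noteq> 0 \<Longrightarrow> j \<noteq> 0"
  using f0 g0 by auto

text \<open>The operators \<open>L1\<close> to \<open>L4\<close> carry the four phases
  \<open>2 j^2\<close>, \<open>2 k l\<close>, \<open>2 k^2\<close> and \<open>-2 j l\<close>, the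
  first two with weight \<open>l^2 / k^2\<close>, the others with weight \<open>2 j l / k^2\<close>.
  The \<open>t\<close> subtracted in \<open>L2\<close> and \<open>L4\<close> is the time integral of
  the 1 subtracted in the splitting.\<close>

lemma L1_bil: "L1 t f k = bil (\<lambda>j l. of_real ((real_of_int l)^2 / (real_of_int k)^2) * Eint t (2 * (real_of_int j)^2)) g g k"
proof -
  have dl: "cmod (dinv 2 j * (\<i> * of_int l)^2) \<le> 1 * ((J j)^2 + (J l)^2)" for j l
  proof -
    have "cmod (dinv 2 j) * (cmod (\<i> * of_int l))^2 \<le> 1 * (J l)^2"
      using norm_dinv[of 2 j] abs_le_J2(2)[of l] by (intro mult_mono) (auto simp: norm_mult)
    moreover have "0 \<le> (J j)^2" by simp
    ultimately show ?thesis unfolding norm_mult norm_power by argo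
  qed
  have s1: "summ (\<lambda>j l. cis (- (2 * t * (real_of_int j)^2)) * dinv 2 j * (\<i> * of_int l)^2) g g k"
    by (rule summ_quadratic[OF r g g, of _ _ 1]) (use dl in \<open>simp add: norm_mult del: of_int_diff\<close>)
  have s2: "summ (\<lambda>j l. dinv 2 j * (\<i> * of_int l)^2) g g k"
    by (rule summ_quadratic[OF r g g, of _ _ 1]) (rule dl)
  have "L1 t f k = (- \<i>/2 * (1 / (\<i> * of_int k)^2)) * bil (\<lambda>j l. cis (- (2 * t * (real_of_int j)^2)) * dinv 2 j * (\<i> * of_int l)^2) g g k
    + (\<i>/2 * (1 / (\<i> * of_int k)^2)) * bil (\<lambda>j l. dinv 2 j * (\<i> * of_int l)^2) g g k"
    unfolding L1_def Let_def fadd_def smul_def g_def[symmetric]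
      bil_commute[of "\<lambda>j l. dinv 2 j * (\<i> * of_int l)^2"]
    unfolding dxinv_nz[OF k] unfolding Sch_cis dxinv_dinv dx_def fmult_fmult fprod_fmult
    by (simp only: mult_ac)
  also have "\<dots> = bil (\<lambda>j l. (- \<i>/2 * (1 / (\<i> * of_int k)^2)) * (cis (- (2 * t * (real_of_int j)^2)) * dinv 2 j * (\<i> * of_int l)^2)
     + (\<i>/2 * (1 / (\<i> * of_int k)^2)) * (dinv 2 j * (\<i> * of_int l)^2)) g g k"
    by (rule bil_lin2[OF s1 s2])
  also have "\<dots> = bil (\<lambda>j l. of_real ((real_of_int l)^2 / (real_of_int k)^2) * Eint t (2 * (real_of_int j)^2)) g g k"
  proof (rule bil_cong)
    fix j assume "g j \<noteq> 0"
    then have j: "j \<noteq> 0" by (rule nz)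
    have "t * (2 * (real_of_int j)^2) = 2 * t * (real_of_int j)^2" by simp
    with j k show "(- \<i>/2 * (1 / (\<i> * of_int k)^2)) * (cis (- (2 * t * (real_of_int j)^2)) * dinv 2 j * (\<i> * of_int (k - j))^2)
     + (\<i>/2 * (1 / (\<i> * of_int k)^2)) * (dinv 2 j * (\<i> * of_int (k - j))^2)
     = of_real ((real_of_int (k - j))^2 / (real_of_int k)^2) * Eint t (2 * (real_of_int j)^2)"
      by (simp add: Eint_def dinv_def power_mult_distrib) (simp add: field_simps)
  qed
  finally show ?thesis .
qed

lemma L2_bil: "L2 t f k = bil (\<lambda>j l. of_real ((real_of_int l)^2 / (real_of_int k)^2)
    * (Eint t (2 * real_of_int k * real_of_int l) - of_real t)) g g k"
proof -
  let ?q = "\<lambda>j l. cis (t * (real_of_int j)^2) * (cis (- (t * (real_of_int l)^2)) * (\<i> * of_int l))"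
  have s1: "summ ?q g g k"
    by (rule summ_quadratic[OF r g g, of _ _ 1])
       (use abs_le_J2(1) in \<open>auto simp: norm_mult intro: add_increasing simp del: of_int_diff\<close>)
  have s2: "summ (\<lambda>j l. (\<i> * of_int l)) g g k"
    by (rule summ_quadratic[OF r g g, of _ _ 1])
       (use abs_le_J2(1) in \<open>auto simp: norm_mult intro: add_increasing simp del: of_int_diff\<close>)
  have s3: "summ (\<lambda>j l. (\<i> * of_int l)^2) g g k"
    by (rule summ_quadratic[OF r g g, of _ _ 1])
       (use abs_le_J2(2) in \<open>auto simp: norm_mult norm_power intro: add_increasing simp del: of_int_diff power2_abs\<close>)
  \<comment> \<open>All three products are commuted so that \<open>l\<close> belongs to the
    differentiated factor.\<close>
  have "L2 t f k = (- \<i>/2 * (cis (- (t * (real_of_int k)^2)) * (1 / (\<i> * of_int k)^3))) * bil ?q g g k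
    + (\<i>/2 * (1 / (\<i> * of_int k)^3)) * bil (\<lambda>j l. (\<i> * of_int l)) g g k
    + (- of_real t * (1 / (\<i> * of_int k)^2)) * bil (\<lambda>j l. (\<i> * of_int l)^2) g g k"
    unfolding L2_def Let_def fadd_def fsub_def smul_def g_def[symmetric] bil_commute[of ?q]
      bil_commute[of "\<lambda>j l. (\<i> * of_int l)"] bil_commute[of "\<lambda>j l. (\<i> * of_int l)^2"]
      Sch_cis fmult_at[of _ _ k]
    unfolding dxinv_nz[OF k] unfolding dx_def fmult_fmult fprod_fmult unfolding fprod_fmult1
    by (simp add: mult_ac)
  also have "\<dots> = bil (\<lambda>j l. (- \<i>/2 * (cis (- (t * (real_of_int k)^2)) * (1 / (\<i> * of_int k)^3))) * ?q j l
    + (\<i>/2 * (1 / (\<i> * of_int k)^3)) * (\<i> * of_int l)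
    + (- of_real t * (1 / (\<i> * of_int k)^2)) * (\<i> * of_int l)^2) g g k"
    by (rule bil_lin3[OF s1 s2 s3])
  also have "\<dots> = bil (\<lambda>j l. of_real ((real_of_int l)^2 / (real_of_int k)^2)
    * (Eint t (2 * real_of_int k * real_of_int l) - of_real t)) g g k"
  proof (rule bil_cong)
    fix j assume "g (k - j) \<noteq> 0"
    define l where "l = k - j"
    have l: "l \<noteq> 0" using nz(2)[OF \<open>g (k - j) \<noteq> 0\<close>] by (simp add: l_def)
    have j: "real_of_int j = real_of_int k - real_of_int l" by (simp add: l_def)
    \<comment> \<open>Phase identity \<open>k^2 - j^2 + l^2 = 2 k l\<close> for
      \<open>j = k - l\<close>.\<close>
    have c: "cis (- (t * (real_of_int k)^2)) * (cis (t * (real_of_int j)^2) * cis (- (t * (real_of_int l)^2)))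
       = cis (- (t * (2 * real_of_int k * real_of_int l)))"
      unfolding cis_mult j by (rule arg_cong[where f=cis]) (simp add: power2_eq_square algebra_simps)
    show "(- \<i>/2 * (cis (- (t * (real_of_int k)^2)) * (1 / (\<i> * of_int k)^3))) * ?q j (k - j)
    + (\<i>/2 * (1 / (\<i> * of_int k)^3)) * (\<i> * of_int (k - j))
    + (- of_real t * (1 / (\<i> * of_int k)^2)) * (\<i> * of_int (k - j))^2
    = of_real ((real_of_int (k - j))^2 / (real_of_int k)^2)
    * (Eint t (2 * real_of_int k * real_of_int (k - j)) - of_real t)"
      unfolding l_def[symmetric] Eint_def c[symmetric] using l k
      by (simp add: power_mult_distrib) (simp add: field_simps power2_eq_square power3_eq_cube)
  qed
  finally show ?thesis .
qed

lemma L3_bil: "L3 t f k = bil (\<lambda>j l. of_real (2 * real_of_int j * real_of_int l / (real_of_int k)^2)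
    * Eint t (2 * (real_of_int k)^2)) g g k"
proof -
  have "L3 t f k = (- \<i> * (1 / (\<i> * of_int k)^4) * (cis (- (2 * t * (real_of_int k)^2)) - 1))
      * bil (\<lambda>j l. (\<i> * of_int j) * (\<i> * of_int l)) g g k"
    unfolding L3_def Let_def fsub_def smul_def g_def[symmetric] Sch_cis
    by (simp only: dxinv_nz[OF k] fmult_at[of _ _ k])
       (simp add: dx_def fprod_fmult algebra_simps)
  also have "\<dots> = bil (\<lambda>j l. (- \<i> * (1 / (\<i> * of_int k)^4) * (cis (- (2 * t * (real_of_int k)^2)) - 1))
      * ((\<i> * of_int j) * (\<i> * of_int l))) g g k"
    by (rule bil_mult_outer)
  also have "\<dots> = bil (\<lambda>j l. of_real (2 * real_of_int j * real_of_int l / (real_of_int k)^2)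
    * Eint t (2 * (real_of_int k)^2)) g g k"
  proof -
    have c: "t * (2 * (real_of_int k)^2) = 2 * t * (real_of_int k)^2" by simp
    show ?thesis unfolding Eint_def c using k
      by (intro bil_cong) (simp add: power_mult_distrib, simp add: field_simps power2_eq_square power4_eq_xxxx)
  qed
  finally show ?thesis .
qed

lemma L4_bil: "L4 t f k = bil (\<lambda>j l. of_real (2 * real_of_int j * real_of_int l / (real_of_int k)^2)
    * (Eint t (- (2 * real_of_int j * real_of_int l)) - of_real t)) g g k"
proof -
  let ?q = "\<lambda>j l. cis (- (t * (real_of_int j)^2)) * cis (- (t * (real_of_int l)^2))"
  have s1: "summ ?q g g k" by (rule summ_bounded[OF r g g, of _ _ 1]) (simp add: norm_mult)
  have s2: "summ (\<lambda>j l. 1) g g k" by (rule summ_bounded[OF r g g, of _ _ 1]) simp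
  have s3: "summ (\<lambda>j l. (\<i> * of_int j) * (\<i> * of_int l)) g g k"
    by (rule summ_quadratic[OF r g g, of _ _ 1]) (use abs_mult_le_J2 in \<open>simp add: norm_mult del: of_int_diff\<close>)
  have "L4 t f k = (\<i> * (1 / (\<i> * of_int k)^2 * cis (t * (real_of_int k)^2))) * bil ?q g g k
    + (- \<i> * (1 / (\<i> * of_int k)^2)) * bil (\<lambda>j l. 1) g g k
    + (- 2 * of_real t * (1 / (\<i> * of_int k)^2)) * bil (\<lambda>j l. (\<i> * of_int j) * (\<i> * of_int l)) g g k"
    unfolding L4_def Let_def fadd_def fsub_def smul_def g_def[symmetric] Sch_cis
    unfolding dxinv_nz[OF k] fmult_at[of _ _ k] unfolding dx_def fprod_fmult fprod_eq_bil[of g g]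
    by (simp add: mult_ac)
  also have "\<dots> = bil (\<lambda>j l. (\<i> * (1 / (\<i> * of_int k)^2 * cis (t * (real_of_int k)^2))) * ?q j l
    + (- \<i> * (1 / (\<i> * of_int k)^2)) * 1
    + (- 2 * of_real t * (1 / (\<i> * of_int k)^2)) * ((\<i> * of_int j) * (\<i> * of_int l))) g g k"
    by (rule bil_lin3[OF s1 s2 s3])
  also have "\<dots> = bil (\<lambda>j l. of_real (2 * real_of_int j * real_of_int l / (real_of_int k)^2)
    * (Eint t (- (2 * real_of_int j * real_of_int l)) - of_real t)) g g k"
  proof (rule bil_cong)
    fix j assume gj: "g j \<noteq> 0" and gl: "g (k - j) \<noteq> 0"
    define l where "l = k - j"
    have l: "l \<noteq> 0" "j \<noteq> 0" using nz(2)[OF gl] nz(2)[OF gj] by (auto simp: l_def)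
    have kk: "real_of_int k = real_of_int j + real_of_int l" by (simp add: l_def)
    \<comment> \<open>The outer flow runs backwards here, so \<open>k^2 - j^2 - l^2 = 2 j l\<close>
      enters as the phase \<open>-2 j l\<close>.\<close>
    have c: "cis (t * (real_of_int k)^2) * (cis (- (t * (real_of_int j)^2)) * cis (- (t * (real_of_int l)^2)))
       = cis (- (t * - (2 * real_of_int j * real_of_int l)))"
      unfolding cis_mult kk by (rule arg_cong[where f=cis]) (simp add: power2_eq_square algebra_simps)
    show "(\<i> * (1 / (\<i> * of_int k)^2 * cis (t * (real_of_int k)^2))) * ?q j (k - j)
    + (- \<i> * (1 / (\<i> * of_int k)^2)) * 1
    + (- 2 * of_real t * (1 / (\<i> * of_int k)^2)) * ((\<i> * of_int j) * (\<i> * of_int (k - j)))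
    = of_real (2 * real_of_int j * real_of_int (k - j) / (real_of_int k)^2)
    * (Eint t (- (2 * real_of_int j * real_of_int (k - j))) - of_real t)"
      unfolding l_def[symmetric] Eint_def c[symmetric] using l k
      by (simp add: power_mult_distrib) (simp add: field_simps power2_eq_square)
  qed
  finally show ?thesis .
qed

lemma I1_bil: "I1 t f k = bil (\<lambda>j l. Eint t (2 * real_of_int j * real_of_int l)) f f k"
proof -
  let ?q = "\<lambda>j l. (cis (t * (real_of_int j)^2) * dinv 1 j) * (cis (t * (real_of_int l)^2) * dinv 1 l)"
  have d: "cmod (dinv 1 j) * cmod (dinv 1 l) \<le> 1" for j l
    using mult_mono[OF norm_dinv[of 1 j] norm_dinv[of 1 l]] by simp
  have s1: "summ (\<lambda>j l. dinv 1 j * dinv 1 l) f f k"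
    by (rule summ_bounded[OF r f f, of _ _ 1]) (use d in \<open>simp only: norm_mult\<close>)
  have s2: "summ ?q f f k"
    by (rule summ_bounded[OF r f f, of _ _ 1]) (use d in \<open>simp only: norm_mult norm_cis mult_1_left\<close>)
  have "I1 t f k = (\<i>/2) * bil (\<lambda>j l. dinv 1 j * dinv 1 l) f f k
     + (- \<i>/2 * cis (- (t * (real_of_int k)^2))) * bil ?q f f k"
    unfolding I1_def fsub_def smul_def Sch_cis dxinv_dinv fmult_fmult fprod_fmult fmult_at[of _ _ k]
    by (simp add: algebra_simps)
  also have "\<dots> = bil (\<lambda>j l. (\<i>/2) * (dinv 1 j * dinv 1 l) + (- \<i>/2 * cis (- (t * (real_of_int k)^2))) * ?q j l) f f k"
    by (rule bil_lin2[OF s1 s2])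
  also have "\<dots> = bil (\<lambda>j l. Eint t (2 * real_of_int j * real_of_int l)) f f k"
  proof (rule bil_cong)
    fix j assume gj: "f j \<noteq> 0" and gl: "f (k - j) \<noteq> 0"
    define l where "l = k - j"
    have l: "l \<noteq> 0" "j \<noteq> 0" using nz(1)[OF gl] nz(1)[OF gj] by (auto simp: l_def)
    have kk: "real_of_int k = real_of_int j + real_of_int l" by (simp add: l_def)
    have c: "cis (- (t * (real_of_int k)^2)) * (cis (t * (real_of_int j)^2) * cis (t * (real_of_int l)^2))
       = cis (- (t * (2 * real_of_int j * real_of_int l)))"
      unfolding cis_mult kk by (rule arg_cong[where f=cis]) (simp add: power2_eq_square algebra_simps)
    show "(\<i>/2) * (dinv 1 j * dinv 1 (k - j)) + (- \<i>/2 * cis (- (t * (real_of_int k)^2))) * ?q j (k - j)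
      = Eint t (2 * real_of_int j * real_of_int (k - j))"
      unfolding l_def[symmetric] Eint_def c[symmetric] using l
      by (simp add: dinv_def) (simp add: field_simps)
  qed
  finally show ?thesis .
qed

lemma I2_bil: "I2 t f k = bil (\<lambda>j l. Eint t (2 * real_of_int k * real_of_int l)) f g k"
proof -
  let ?q = "\<lambda>j l. cis (t * (real_of_int j)^2) * (cis (- (t * (real_of_int l)^2)) * dinv 1 l)"
  have s1: "summ ?q f g k"
    by (rule summ_bounded[OF r f g, of _ _ 1])
       (use norm_dinv[of 1] in \<open>simp only: norm_mult norm_cis mult_1_left\<close>)
  have s2: "summ (\<lambda>j l. dinv 1 l) f g k"
    by (rule summ_bounded[OF r f g, of _ _ 1]) (rule norm_dinv)
  have "I2 t f k = (- \<i>/2 * (cis (- (t * (real_of_int k)^2)) * (1 / (\<i> * of_int k)))) * bil ?q f g k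
     + (\<i>/2 * (1 / (\<i> * of_int k))) * bil (\<lambda>j l. dinv 1 l) f g k"
    unfolding I2_def Let_def fadd_def smul_def Sch_cis g_def[symmetric] fmult_at[of _ _ k] dxinv_nz[OF k]
    unfolding dxinv_dinv fmult_fmult fprod_fmult unfolding fprod_fmult2
    using k by (simp add: fconst_def mult_ac)
  also have "\<dots> = bil (\<lambda>j l. (- \<i>/2 * (cis (- (t * (real_of_int k)^2)) * (1 / (\<i> * of_int k)))) * ?q j l
     + (\<i>/2 * (1 / (\<i> * of_int k))) * dinv 1 l) f g k"
    by (rule bil_lin2[OF s1 s2])
  also have "\<dots> = bil (\<lambda>j l. Eint t (2 * real_of_int k * real_of_int l)) f g k"
  proof (rule bil_cong)
    fix j assume gl: "g (k - j) \<noteq> 0"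
    define l where "l = k - j"
    have l: "l \<noteq> 0" using nz(2)[OF gl] by (auto simp: l_def)
    have j: "real_of_int j = real_of_int k - real_of_int l" by (simp add: l_def)
    have c: "cis (- (t * (real_of_int k)^2)) * (cis (t * (real_of_int j)^2) * cis (- (t * (real_of_int l)^2)))
       = cis (- (t * (2 * real_of_int k * real_of_int l)))"
      unfolding cis_mult j by (rule arg_cong[where f=cis]) (simp add: power2_eq_square algebra_simps)
    show "(- \<i>/2 * (cis (- (t * (real_of_int k)^2)) * (1 / (\<i> * of_int k)))) * ?q j (k - j)
     + (\<i>/2 * (1 / (\<i> * of_int k))) * dinv 1 (k - j)
      = Eint t (2 * real_of_int k * real_of_int (k - j))"
      unfolding l_def[symmetric] Eint_def c[symmetric] using l k
      by (simp add: dinv_def) (simp add: field_simps)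
  qed
  finally show ?thesis .
qed

end

section \<open>The one-step map in terms of the assembled symbols\<close>

definition Bs :: "int \<Rightarrow> real" where
  "Bs k = - ((real_of_int k)^2 / angsym k)"

definition QA :: "real \<Rightarrow> int \<Rightarrow> int \<Rightarrow> complex" where
  "QA t j l = Eint t (2 * real_of_int j * real_of_int l)"

definition QB :: "real \<Rightarrow> int \<Rightarrow> int \<Rightarrow> complex" where
  "QB t j l = Eint t (2 * real_of_int (j + l) * real_of_int l)"

text \<open>Symbol of \<open>2 L1 + 2 L2 + L3 + L4\<close>: two weighted splittings of the phase
  \<open>(j + l)^2 + j^2 + l^2\<close>, integrated in time. On \<open>j + l = 0\<close> both weights
  are 0 by division by zero.\<close>

definition QC :: "real \<Rightarrow> int \<Rightarrow> int \<Rightarrow> complex" where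
  "QC t j l =
     of_real (2 * (real_of_int l)^2 / (real_of_int (j + l))^2)
       * (Eint t (2 * (real_of_int j)^2) + Eint t (2 * real_of_int (j + l) * real_of_int l) - of_real t)
   + of_real (2 * real_of_int j * real_of_int l / (real_of_int (j + l))^2)
       * (Eint t (2 * (real_of_int (j + l))^2) + Eint t (- (2 * real_of_int j * real_of_int l)) - of_real t)"

definition NL :: "real \<Rightarrow> fs \<Rightarrow> fs \<Rightarrow> fs" where
  "NL t f g k = bil (QA t) f f k + 2 * bil (QB t) f g k + bil (QC t) g g k"

text \<open>The scheme with the conjugate of its argument replaced by an independent variable, so that it can
  be compared with a solution that is not yet known to be real-valued.\<close>

definition Psi2 :: "complex \<Rightarrow> real \<Rightarrow> fs \<Rightarrow> fs \<Rightarrow> fs" where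
  "Psi2 c t f g k = cis (t * angsym k) * (f k - \<i>/4 * of_real (Bs k) * NL t f g k
     - \<i> * c * of_real (Bs k) * (of_real t * f k + Eint t (2 * (real_of_int k)^2) * g k))"

lemma angsym_eq: "angsym k = \<bar>real_of_int k\<bar> * J k"
proof -
  have "(real_of_int k)^2 + (real_of_int k)^4 = (real_of_int k)^2 * (1 + (real_of_int k)^2)"
    by (simp add: algebra_simps power2_eq_square power4_eq_xxxx)
  then show ?thesis by (simp add: angsym_def J_def real_sqrt_mult)
qed

lemma norm_Bs: "\<bar>Bs k\<bar> \<le> 1"
proof (cases "k = 0")
  case False
  have "\<bar>Bs k\<bar> = \<bar>real_of_int k\<bar> / J k"
    using False by (simp add: Bs_def angsym_eq abs_mult power2_eq_square field_simps)
  also have "\<dots> \<le> 1" using abs_le_J[of k] by simp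
  finally show ?thesis .
qed (simp add: Bs_def)

text \<open>From \<open>k^2 <= |k| * J k <= (J k)^2 = k^2 + 1\<close>. Over a time
  \<open>\<sigma>\<close> the flow of \<open>angsym\<close> therefore differs from a Schroedinger
  flow by at most \<open>\<sigma>\<close> at every mode.\<close>

lemma angsym_diff: "0 \<le> angsym k - (real_of_int k)^2" "angsym k - (real_of_int k)^2 \<le> 1"
proof -
  have "\<bar>real_of_int k\<bar> * \<bar>real_of_int k\<bar> \<le> \<bar>real_of_int k\<bar> * J k"
    by (intro mult_left_mono abs_le_J) auto
  then show "0 \<le> angsym k - (real_of_int k)^2" by (simp add: angsym_eq power2_eq_square)
  have "angsym k \<le> J k * J k"
    unfolding angsym_eq by (intro mult_right_mono abs_le_J) auto
  then show "angsym k - (real_of_int k)^2 \<le> 1" using J_sq[of k] by (simp add: power2_eq_square)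
qed

text \<open>\<open>Bs 0 = 0\<close> by division by zero, in agreement with the value that
  \<open>anginv\<close> assigns to the zero mode.\<close>

lemma Btau_at: "Btau t F k = of_real (Bs k) * (cis (t * angsym k) * F k)"
  by (simp add: Btau_def Bop_def anginv_def dx_def Eang_cis fmult_def Bs_def power_mult_distrib)

text \<open>At \<open>k = 0\<close> both sides reduce to \<open>f 0\<close>, because
  \<open>Bs 0 = 0\<close>. At \<open>k \<noteq> 0\<close> the symbol identities are combined with
  the weights of the scheme; the four terms quadratic in \<open>g\<close> are shown to converge one
  by one, so that their symbols may be added to \<open>QC\<close>.\<close>

lemma Psi1_eq_Psi2:
  assumes r: "1 \<le> r" and f: "Hb r f a" and f0: "f 0 = 0" and t: "0 \<le> t"
  shows "Psi1 A b t tn f = Psi2 (A * of_real tn + b) t f (fconj f)"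
proof
  fix k
  define g where "g = fconj f"
  have g: "Hb r g a" using f by (simp add: g_def Hb_fconj)
  show "Psi1 A b t tn f k = Psi2 (A * of_real tn + b) t f (fconj f) k"
  proof (cases "k = 0")
    case True
    then show ?thesis
      by (simp add: Psi1_def Psi2_def fsub_def smul_def Btau_at Bs_def Eang_cis fmult_def)
  next
    case k: False
    note ops = L1_bil[OF r f f0 k g_def] L2_bil[OF r f f0 k g_def] L3_bil[OF r f f0 k g_def]
      L4_bil[OF r f f0 k g_def] I1_bil[OF r f f0 k g_def] I2_bil[OF r f f0 k g_def]
    define p1 where "p1 = (\<lambda>(j::int) (l::int). of_real ((real_of_int l)^2 / (real_of_int k)^2) * Eint t (2 * (real_of_int j)^2))"
    define p2 where "p2 = (\<lambda>(j::int) (l::int). of_real ((real_of_int l)^2 / (real_of_int k)^2)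
      * (Eint t (2 * real_of_int k * real_of_int l) - of_real t))"
    define p3 where "p3 = (\<lambda>(j::int) (l::int). of_real (2 * real_of_int j * real_of_int l / (real_of_int k)^2)
      * Eint t (2 * (real_of_int k)^2))"
    define p4 where "p4 = (\<lambda>(j::int) (l::int). of_real (2 * real_of_int j * real_of_int l / (real_of_int k)^2)
      * (Eint t (- (2 * real_of_int j * real_of_int l)) - of_real t))"
    have k1: "1 \<le> (real_of_int k)^2"
      using k by (metis abs_le_square_iff abs_one linorder_not_less of_int_1_le_iff of_int_abs one_power2 zero_less_abs_iff int_one_le_iff_zero_less)
    have w1: "\<bar>(real_of_int l)^2 / (real_of_int k)^2\<bar> \<le> (J j)^2 + (J l)^2" for j l
    proof -
      have "(real_of_int l)^2 / (real_of_int k)^2 \<le> (real_of_int l)^2 / 1"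
        using k1 by (intro divide_left_mono) auto
      also have "\<dots> \<le> (J j)^2 + (J l)^2" by (simp add: J_sq)
      finally show ?thesis by simp
    qed
    have w2: "\<bar>2 * real_of_int j * real_of_int l / (real_of_int k)^2\<bar> \<le> 2 * ((J j)^2 + (J l)^2)" for j l
    proof -
      have "\<bar>2 * real_of_int j * real_of_int l\<bar> / (real_of_int k)^2 \<le> \<bar>2 * real_of_int j * real_of_int l\<bar> / 1"
        using k1 by (intro divide_left_mono) auto
      also have "\<dots> \<le> 2 * ((J j)^2 + (J l)^2)" using abs_mult_le_J2[of j l] by (simp add: abs_mult)
      finally show ?thesis by (simp add: abs_mult)
    qed
    have e: "cmod (Eint t \<theta>) \<le> 2 * t" "cmod (Eint t \<theta> - of_real t) \<le> 2 * t" for \<theta>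
      using norm_Eint[OF t, of \<theta>] norm_triangle_ineq4[of "Eint t \<theta>" "of_real t"] t by auto
    have m: "cmod (of_real x * y) \<le> (2 * D * t) * Z" if "\<bar>x\<bar> \<le> D * Z" "cmod y \<le> 2 * t" for x y Z and D :: real
      using mult_mono[OF that] that abs_ge_zero[of x] by (simp add: norm_mult mult_ac)
    have s1: "summ p1 g g k" unfolding p1_def
      by (rule summ_quadratic[OF r g g, of _ _ "2 * 1 * t"], rule m, unfold mult_1_left, rule w1, rule e)
    have s2: "summ p2 g g k" unfolding p2_def
      by (rule summ_quadratic[OF r g g, of _ _ "2 * 1 * t"], rule m, unfold mult_1_left, rule w1, rule e)
    have s3: "summ p3 g g k" unfolding p3_def
      by (rule summ_quadratic[OF r g g, of _ _ "2 * 2 * t"], rule m, rule w2, rule e)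
    have s4: "summ p4 g g k" unfolding p4_def
      by (rule summ_quadratic[OF r g g, of _ _ "2 * 2 * t"], rule m, rule w2, rule e)
    have "2 * bil p1 g g k + 2 * bil p2 g g k + bil p3 g g k + bil p4 g g k
       = bil (\<lambda>j l. 2 * p1 j l + 2 * p2 j l + p3 j l + p4 j l) g g k"
      by (simp add: bil_mult_outer bil_add summ_add summ_cmult s1 s2 s3 s4)
    also have "\<dots> = bil (QC t) g g k"
    proof (rule bil_cong)
      fix j
      have jk: "j + (k - j) = k" by simp
      have "2 * x / y = 2 * (x / y)" for x y :: real by simp
      then have "of_real (2 * (real_of_int (k - j))^2 / (real_of_int k)^2)
          = 2 * (of_real ((real_of_int (k - j))^2 / (real_of_int k)^2) :: complex)" by (simp only: of_real_mult of_real_numeral)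
      then show "2 * p1 j (k - j) + 2 * p2 j (k - j) + p3 j (k - j) + p4 j (k - j) = QC t j (k - j)"
        unfolding QC_def p1_def p2_def p3_def p4_def jk
        by (simp only: distrib_left right_diff_distrib mult.assoc add_diff_eq add.assoc diff_add_eq)
    qed
    finally have C: "2 * bil p1 g g k + 2 * bil p2 g g k + bil p3 g g k + bil p4 g g k = bil (QC t) g g k" .
    have "2 * L1 t f k + 2 * L2 t f k + L3 t f k + L4 t f k + I1 t f k + 2 * I2 t f k = NL t f g k"
    proof -
      have "I2 t f k = bil (QB t) f g k" unfolding ops by (rule bil_cong) (simp add: QB_def)
      moreover have "I1 t f k = bil (QA t) f f k" unfolding ops by (rule bil_cong) (simp add: QA_def)
      moreover have "L1 t f k = bil p1 g g k" "L2 t f k = bil p2 g g k" "L3 t f k = bil p3 g g k" "L4 t f k = bil p4 g g k"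
        unfolding ops p1_def p2_def p3_def p4_def by simp_all
      ultimately show ?thesis unfolding NL_def C[symmetric] by simp
    qed
    then have N: "Btau t (fadd (fadd (fadd (fadd (fadd (smul 2 (L1 t f)) (smul 2 (L2 t f))) (L3 t f)) (L4 t f))
                (I1 t f)) (smul 2 (I2 t f))) k = of_real (Bs k) * (cis (t * angsym k) * NL t f g k)"
      by (simp add: Btau_at fadd_def smul_def)
    have P: "of_real t * Btau t (fadd f (psi1op t g)) k
       = of_real (Bs k) * (cis (t * angsym k) * (of_real t * f k + Eint t (2 * (real_of_int k)^2) * g k))"
      unfolding Btau_at psi1_Eint[symmetric] fadd_def psi1op_def fmult_def by (simp add: algebra_simps)
    show ?thesis
    proof -
      have at: "fsub F G k = F k - G k" "smul c F k = c * F k" for F G c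
        by (simp_all add: fsub_def smul_def)
      have "Psi1 A b t tn f k = cis (t * angsym k) * f k
          - \<i>/4 * (of_real (Bs k) * (cis (t * angsym k) * NL t f g k))
          - \<i> * (A * of_real tn + b) * (of_real t * Btau t (fadd f (psi1op t g)) k)"
        unfolding Psi1_def at N g_def[symmetric] by (simp only: Eang_cis fmult_at mult_ac)
      then show ?thesis unfolding P Psi2_def g_def[symmetric] by (simp only: right_diff_distrib mult_ac)
    qed
  qed
qed

section \<open>Differentiating in time\<close>

lemma onorm_scaleR_le: "norm v \<le> B \<Longrightarrow> onorm (\<lambda>h::real. h *\<^sub>R v) \<le> B"
  by (rule onorm_le) (simp add: mult.commute[of B] mult_left_mono)

text \<open>A mean value inequality in \<open>H^s\<close> from differentiability of the coefficients
  alone. Testing the curve against its own weighted increment gives a real function \<open>h\<close>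
  with \<open>h \<tau> - h 0 = L^2\<close> and \<open>|h'| <= A * L\<close>, hence
  \<open>L <= \<tau> * A\<close>.\<close>

lemma Hb_mvt:
  assumes \<tau>: "0 \<le> \<tau>"
    and D: "\<And>k t. t \<in> {0..\<tau>} \<Longrightarrow> ((\<lambda>t. D t k) has_vector_derivative R t k) (at t within {0..\<tau>})"
    and R: "\<And>t. t \<in> {0..\<tau>} \<Longrightarrow> Hb s (R t) A"
  shows "Hb s (\<lambda>k. D \<tau> k - D 0 k) (\<tau> * A)"
  unfolding Hb_def
proof (intro allI impI)
  fix F :: "int set" assume F: "finite F"
  define d where "d = (\<lambda>k. D \<tau> k - D 0 k)"
  define w where "w = (\<lambda>k. J k powr s)"
  define L where "L = L2_set (\<lambda>k. w k * cmod (d k)) F"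
  define h where "h = (\<lambda>t. \<Sum>k\<in>F. (w k)^2 * (D t k \<bullet> d k))"
  define h' where "h' = (\<lambda>t. \<Sum>k\<in>F. (w k)^2 * (R t k \<bullet> d k))"
  have A: "0 \<le> A" using R[of 0] \<tau> Hb_nonneg by auto
  have L: "0 \<le> L" by (simp add: L_def)
  have h': "\<bar>h' t\<bar> \<le> A * L" if "t \<in> {0..\<tau>}" for t
  proof -
    have "\<bar>h' t\<bar> \<le> (\<Sum>k\<in>F. \<bar>(w k)^2 * (R t k \<bullet> d k)\<bar>)" unfolding h'_def by (rule sum_abs)
    also have "\<dots> \<le> (\<Sum>k\<in>F. \<bar>w k * cmod (R t k)\<bar> * \<bar>w k * cmod (d k)\<bar>)"
    proof (rule sum_mono)
      fix k
      have "(w k)^2 * \<bar>R t k \<bullet> d k\<bar> \<le> (w k)^2 * (cmod (R t k) * cmod (d k))"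
        by (intro mult_left_mono Cauchy_Schwarz_ineq2) auto
      then show "\<bar>(w k)^2 * (R t k \<bullet> d k)\<bar> \<le> \<bar>w k * cmod (R t k)\<bar> * \<bar>w k * cmod (d k)\<bar>"
        by (simp add: abs_mult power2_eq_square mult_ac)
    qed
    also have "\<dots> \<le> L2_set (\<lambda>k. w k * cmod (R t k)) F * L"
      unfolding L_def by (rule L2_set_mult_ineq)
    also have "\<dots> \<le> A * L"
      using HbD[OF R[OF that] F] L by (intro mult_right_mono) (auto simp: w_def)
    finally show ?thesis .
  qed
  have der: "(h has_vector_derivative h' t) (at t within {0..\<tau>})" if "t \<in> {0..\<tau>}" for t
    unfolding h_def h'_def
    by (intro has_vector_derivative_sum has_vector_derivative_mult_right
        bounded_linear.has_vector_derivative[OF bounded_linear_inner_left] D that)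
  have "norm (h \<tau> - h 0) \<le> (A * L) * norm (\<tau> - 0)"
  proof (rule differentiable_bound[of "{0..\<tau>}" h "\<lambda>t x. x *\<^sub>R h' t"])
    fix t assume t: "t \<in> {0..\<tau>}"
    show "(h has_derivative (\<lambda>x. x *\<^sub>R h' t)) (at t within {0..\<tau>})"
      using der[OF t] by (simp add: has_vector_derivative_def)
    show "onorm (\<lambda>x. x *\<^sub>R h' t) \<le> A * L"
      by (rule onorm_scaleR_le) (use h'[OF t] in simp)
  qed (use \<tau> in auto)
  moreover have "h \<tau> - h 0 = (\<Sum>k\<in>F. (w k)^2 * (d k \<bullet> d k))"
    unfolding h_def sum_subtractf[symmetric]
    by (intro sum.cong) (simp_all add: d_def inner_diff_left right_diff_distrib)
  moreover have "\<dots> = L^2"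
    by (simp add: L_def L2_set_def sum_nonneg power_mult_distrib dot_square_norm)
  ultimately have "L * L \<le> (\<tau> * A) * L" using \<tau> by (simp add: power2_eq_square mult_ac)
  then have "L \<le> \<tau> * A" using L A \<tau> by (cases "L = 0") auto
  then show "L2_set (\<lambda>k. J k powr s * cmod (D \<tau> k - D 0 k)) F \<le> \<tau> * A"
    by (simp add: L_def w_def d_def)
qed

text \<open>A finite part of the sum is differentiable, and on the remaining indices each term is
  Lipschitz with constant \<open>A j\<close>, so that the tail of the summable majorant controls
  increments and derivatives alike.\<close>

lemma has_vector_derivative_infsum:
  fixes q :: "real \<Rightarrow> 'a \<Rightarrow> complex"
  assumes S: "convex S" and x: "x \<in> S"
    and der: "\<And>j t. t \<in> S \<Longrightarrow> ((\<lambda>t. q t j) has_vector_derivative q' t j) (at t within S)"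
    and A: "\<And>j t. t \<in> S \<Longrightarrow> cmod (q' t j) \<le> A j" "A summable_on UNIV"
    and sm: "\<And>t. t \<in> S \<Longrightarrow> q t summable_on UNIV"
  shows "((\<lambda>t. \<Sum>\<^sub>\<infinity>j. q t j) has_vector_derivative (\<Sum>\<^sub>\<infinity>j. q' x j)) (at x within S)"
  unfolding has_vector_derivative_def has_derivative_within_alt
proof (intro conjI allI impI)
  show "bounded_linear (\<lambda>h. h *\<^sub>R (\<Sum>\<^sub>\<infinity>j. q' x j))" by (rule bounded_linear_scaleR_left)
  fix e :: real assume e: "0 < e"
  have lip: "cmod (q y j - q x j) \<le> A j * \<bar>y - x\<bar>" if y: "y \<in> S" for y j
  proof -
    have "norm (q y j - q x j) \<le> A j * norm (y - x)"
    proof (rule differentiable_bound[OF S, of "\<lambda>t. q t j" "\<lambda>t h. h *\<^sub>R q' t j"])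
      fix t assume t: "t \<in> S"
      show "((\<lambda>t. q t j) has_derivative (\<lambda>h. h *\<^sub>R q' t j)) (at t within S)"
        using der[OF t] by (simp add: has_vector_derivative_def)
      show "onorm (\<lambda>h. h *\<^sub>R q' t j) \<le> A j"
        by (rule onorm_scaleR_le[OF A(1)[OF t]])
    qed (use x y in auto)
    then show ?thesis by simp
  qed
  have An: "0 \<le> A j" for j using A(1)[OF x, of j] norm_ge_zero order_trans by blast
  \<comment> \<open>The tail enters twice, through the increments and through the derivative, and so
    costs \<open>e/2\<close>; the finite part gets the other \<open>e/2\<close>.\<close>
  obtain G where G: "finite G" "dist (sum A G) (infsum A UNIV) \<le> e/4"
    using infsum_finite_approximation[OF A(2), of "e/4"] e by auto
  have split: "infsum f UNIV = sum f G + infsum f (- G)" if "f summable_on UNIV" for f :: "'a \<Rightarrow> complex"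
    using infsum_Un_disjoint[of f G "- G"] G that
    by (simp add: summable_on_subset_banach[OF that])
  have "infsum A UNIV = sum A G + infsum A (- G)"
    using infsum_Un_disjoint[of A G "- G"] G by (simp add: summable_on_subset_banach[OF A(2)])
  then have tailA: "infsum A (- G) \<le> e/4" using G by (simp add: dist_real_def)
  have "((\<lambda>t. \<Sum>j\<in>G. q t j) has_vector_derivative (\<Sum>j\<in>G. q' x j)) (at x within S)"
    by (intro has_vector_derivative_sum der x)
  then obtain d where d: "0 < d" "\<And>y. y \<in> S \<Longrightarrow> norm (y - x) < d \<Longrightarrow>
      norm ((\<Sum>j\<in>G. q y j) - (\<Sum>j\<in>G. q x j) - (y - x) *\<^sub>R (\<Sum>j\<in>G. q' x j)) \<le> e/2 * norm (y - x)"
    unfolding has_vector_derivative_def has_derivative_within_alt using e by (meson half_gt_zero)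
  have sq': "q' x summable_on UNIV"
    by (rule abs_summable_summable, rule summable_on_comparison_test[OF A(2)]) (use A(1)[OF x] in auto)
  show "\<exists>d>0. \<forall>y\<in>S. norm (y - x) < d \<longrightarrow>
      norm ((\<Sum>\<^sub>\<infinity>j. q y j) - (\<Sum>\<^sub>\<infinity>j. q x j) - (y - x) *\<^sub>R (\<Sum>\<^sub>\<infinity>j. q' x j)) \<le> e * norm (y - x)"
  proof (intro exI conjI ballI impI)
    show "0 < d" by (rule d)
    fix y assume y: "y \<in> S" "norm (y - x) < d"
    define u where "u = (\<lambda>j. q y j - q x j - of_real (y - x) * q' x j)"
    have su: "u summable_on UNIV" unfolding u_def
      by (intro summable_on_diff sm summable_on_cmult_right sq' x y)
    have "infsum u UNIV = (\<Sum>\<^sub>\<infinity>j. q y j) - (\<Sum>\<^sub>\<infinity>j. q x j) - (y - x) *\<^sub>R (\<Sum>\<^sub>\<infinity>j. q' x j)"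
      unfolding u_def using sm[OF y(1)] sm[OF x] summable_on_cmult_right[OF sq', of "of_real (y - x)"]
      by (simp add: infsum_diff summable_on_diff infsum_cmult_right' scaleR_conv_of_real)
    moreover have "sum u G = (\<Sum>j\<in>G. q y j) - (\<Sum>j\<in>G. q x j) - (y - x) *\<^sub>R (\<Sum>j\<in>G. q' x j)"
      by (simp add: u_def sum_subtractf sum_distrib_left scaleR_conv_of_real)
    moreover have "cmod (infsum u (- G)) \<le> e/2 * norm (y - x)"
    proof -
      have "cmod (u j) \<le> 2 * \<bar>y - x\<bar> * A j" for j
      proof -
        have "cmod (u j) \<le> cmod (q y j - q x j) + cmod (of_real (y - x) * q' x j)"
          unfolding u_def by (rule norm_triangle_ineq4)
        also have "\<dots> \<le> A j * \<bar>y - x\<bar> + \<bar>y - x\<bar> * A j"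
          unfolding norm_mult norm_of_real
          by (rule add_mono[OF lip[OF y(1)] mult_left_mono[OF A(1)[OF x]]]) simp
        finally show ?thesis by (simp add: mult_ac)
      qed
      moreover have "u summable_on - G" by (rule summable_on_subset_banach[OF su]) simp
      moreover have "(\<lambda>j. 2 * \<bar>y - x\<bar> * A j) summable_on - G"
        by (rule summable_on_cmult_right, rule summable_on_subset_banach[OF A(2)]) simp
      ultimately have "cmod (infsum u (- G)) \<le> infsum (\<lambda>j. 2 * \<bar>y - x\<bar> * A j) (- G)"
        by - (rule norm_infsum_le[OF has_sum_infsum has_sum_infsum], auto)
      also have "\<dots> = 2 * \<bar>y - x\<bar> * infsum A (- G)" by (rule infsum_cmult_right')
      also have "\<dots> \<le> 2 * \<bar>y - x\<bar> * (e/4)" by (intro mult_left_mono tailA) auto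
      finally show ?thesis by simp
    qed
    ultimately show "norm ((\<Sum>\<^sub>\<infinity>j. q y j) - (\<Sum>\<^sub>\<infinity>j. q x j) - (y - x) *\<^sub>R (\<Sum>\<^sub>\<infinity>j. q' x j)) \<le> e * norm (y - x)"
      using split[OF su] d(2)[OF y] norm_triangle_ineq[of "sum u G" "infsum u (- G)"] by simp
  qed
qed

section \<open>Symbol estimates\<close>

definition dA :: "real \<Rightarrow> int \<Rightarrow> int \<Rightarrow> complex" where
  "dA t j l = cis (- (t * (2 * real_of_int j * real_of_int l)))"

definition dB :: "real \<Rightarrow> int \<Rightarrow> int \<Rightarrow> complex" where
  "dB t j l = cis (- (t * (2 * real_of_int (j + l) * real_of_int l)))"

definition dC :: "real \<Rightarrow> int \<Rightarrow> int \<Rightarrow> complex" where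
  "dC t j l =
     of_real (2 * (real_of_int l)^2 / (real_of_int (j + l))^2)
       * (cis (- (t * (2 * (real_of_int j)^2))) + cis (- (t * (2 * real_of_int (j + l) * real_of_int l))) - 1)
   + of_real (2 * real_of_int j * real_of_int l / (real_of_int (j + l))^2)
       * (cis (- (t * (2 * (real_of_int (j + l))^2))) + cis (- (t * - (2 * real_of_int j * real_of_int l))) - 1)"

text \<open>The exact phase of the interaction of two conjugate modes, symmetrised with
  (j + l)^2 = j^2 + 2 j l + l^2.\<close>

definition dT :: "real \<Rightarrow> int \<Rightarrow> int \<Rightarrow> complex" where
  "dT t j l = of_real (2 * (real_of_int l)^2 / (real_of_int (j + l))^2)
       * cis (- (t * ((real_of_int (j + l))^2 + (real_of_int j)^2 + (real_of_int l)^2)))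
   + of_real (2 * real_of_int j * real_of_int l / (real_of_int (j + l))^2)
       * cis (- (t * ((real_of_int (j + l))^2 + (real_of_int j)^2 + (real_of_int l)^2)))"

lemma QA_deriv: "((\<lambda>t. QA t j l) has_vector_derivative dA t j l) (at t within S)"
  unfolding QA_def dA_def by (rule Eint_deriv)

lemma QB_deriv: "((\<lambda>t. QB t j l) has_vector_derivative dB t j l) (at t within S)"
  unfolding QB_def dB_def by (rule Eint_deriv)

lemma QC_deriv: "((\<lambda>t. QC t j l) has_vector_derivative dC t j l) (at t within S)"
proof -
  have i: "((\<lambda>t. of_real t) has_vector_derivative (1::complex)) (at t within S)"
    using Eint_deriv[of 0 t S] by simp
  show ?thesis unfolding QC_def dC_def
    by (intro has_vector_derivative_add has_vector_derivative_mult_right has_vector_derivative_diff Eint_deriv i)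
qed

text \<open>On \<open>j + l = 0\<close> the quotients are 0 by division by zero; elsewhere
  \<open>(J k)^2 <= 2 k^2\<close> for \<open>k = j + l\<close>, which doubles the numerator 2 to the
  factor 4.\<close>

lemma ratio_le_ks:
  "\<bar>2 * (real_of_int l)^2 / (real_of_int (j + l))^2\<bar> \<le> 4 * ks j l"
  "\<bar>2 * real_of_int j * real_of_int l / (real_of_int (j + l))^2\<bar> \<le> 4 * ks j l"
proof -
  define m where "m = max (J j) (J l)"
  have m: "0 \<le> m" "\<bar>real_of_int j\<bar> \<le> m" "\<bar>real_of_int l\<bar> \<le> m"
    using abs_le_J[of j] abs_le_J[of l] J_nonneg[of j] by (auto simp: m_def max_def)
  have *: "2 * x / (real_of_int (j + l))^2 \<le> 4 * ks j l" if "x \<le> m^2" "0 \<le> x" for x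
  proof (cases "j + l = 0")
    case False
    have "(J (j + l))^2 \<le> 2 * (real_of_int (j + l))^2" by (rule J_sq_le[OF False])
    moreover have "0 < (real_of_int (j + l))^2" using False by (simp only: zero_less_power2 of_int_eq_0_iff) simp
    ultimately have "2 * x / (real_of_int (j + l))^2 \<le> 2 * m^2 / ((J (j + l))^2 / 2)"
      using that by (intro frac_le) auto
    also have "\<dots> = 4 * ks j l" by (simp add: ks_def m_def power_divide)
    finally show ?thesis .
  qed (simp add: ks_nonneg)
  have "(real_of_int l)^2 \<le> m^2" using m by (simp add: abs_le_square_iff[symmetric])
  from *[OF this] show "\<bar>2 * (real_of_int l)^2 / (real_of_int (j + l))^2\<bar> \<le> 4 * ks j l" by simp
  have "\<bar>real_of_int j\<bar> * \<bar>real_of_int l\<bar> \<le> m * m" using m by (intro mult_mono) auto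
  then have "\<bar>real_of_int j\<bar> * \<bar>real_of_int l\<bar> \<le> m^2" by (simp add: power2_eq_square)
  from *[OF this] show "\<bar>2 * real_of_int j * real_of_int l / (real_of_int (j + l))^2\<bar> \<le> 4 * ks j l"
    by (simp add: abs_mult mult_ac)
qed

text \<open>Origin of the constant 24: two weights, each at most \<open>4 * ks j l\<close>, times
  brackets of at most three terms of size \<open>t\<close>. The same constant is kept for
  \<open>QA\<close> and \<open>QB\<close>, so that one bound serves all symbols.\<close>

lemma combination_le_ks:
  assumes "cmod x \<le> 3 * t" "cmod y \<le> 3 * t"
  shows "cmod (of_real (2 * (real_of_int l)^2 / (real_of_int (j + l))^2) * x
     + of_real (2 * real_of_int j * real_of_int l / (real_of_int (j + l))^2) * y) \<le> 24 * t * ks j l"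
proof -
  have "cmod (of_real (2 * (real_of_int l)^2 / (real_of_int (j + l))^2) * x
     + of_real (2 * real_of_int j * real_of_int l / (real_of_int (j + l))^2) * y)
    \<le> \<bar>2 * (real_of_int l)^2 / (real_of_int (j + l))^2\<bar> * cmod x
     + \<bar>2 * real_of_int j * real_of_int l / (real_of_int (j + l))^2\<bar> * cmod y"
    by (rule order_trans[OF norm_triangle_ineq]) (simp only: norm_mult norm_of_real order_refl)
  also have "\<dots> \<le> (4 * ks j l) * (3 * t) + (4 * ks j l) * (3 * t)"
    by (intro add_mono mult_mono ratio_le_ks assms) (auto simp: ks_nonneg)
  finally show ?thesis by simp
qed

lemma square_ratio_le_ks: "\<bar>(real_of_int l)^2 / (real_of_int (j + l))^2\<bar> \<le> 4 * ks j l"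
proof -
  have "2 * x / y = 2 * (x / y)" for x y :: real by simp
  then have "2 * ((real_of_int l)^2 / (real_of_int (j + l))^2) \<le> 4 * ks j l"
    using ratio_le_ks(1)[of l j] by (metis abs_le_D1)
  moreover have "0 \<le> (real_of_int l)^2 / (real_of_int (j + l))^2" by simp
  ultimately show ?thesis by linarith
qed

lemma le_24_ks: "x \<le> t \<Longrightarrow> 0 \<le> t \<Longrightarrow> x \<le> 24 * t * ks j l"
  using mult_left_mono[OF ks_ge[of j l], of t] mult_nonneg_nonneg[OF _ ks_nonneg[of j l], of t] by simp

lemma norm_QA: "0 \<le> t \<Longrightarrow> cmod (QA t j l) \<le> 24 * t * ks j l"
  unfolding QA_def by (intro le_24_ks norm_Eint)

lemma norm_QB: "0 \<le> t \<Longrightarrow> cmod (QB t j l) \<le> 24 * t * ks j l"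
  unfolding QB_def by (intro le_24_ks norm_Eint)

lemma norm_QC:
  assumes t: "0 \<le> t" shows "cmod (QC t j l) \<le> 24 * t * ks j l"
proof -
  have e: "cmod (Eint t a + Eint t b - of_real t) \<le> 3 * t" for a b
    using norm_triangle_ineq4[of "Eint t a + Eint t b" "of_real t"]
      norm_triangle_ineq[of "Eint t a" "Eint t b"] norm_Eint[OF t, of a] norm_Eint[OF t, of b] t by simp
  show ?thesis unfolding QC_def by (intro combination_le_ks e)
qed

lemma norm_dA: "cmod (dA t j l) \<le> 24 * ks j l"
  using ks_ge[of j l] ks_nonneg[of j l] by (simp add: dA_def)

lemma norm_dB: "cmod (dB t j l) \<le> 24 * ks j l"
  using ks_ge[of j l] ks_nonneg[of j l] by (simp add: dB_def)

lemma norm_dC: "cmod (dC t j l) \<le> 24 * ks j l"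
proof -
  have e: "cmod (cis a + cis b - 1) \<le> 3 * 1" for a b
    using norm_triangle_ineq4[of "cis a + cis b" 1] norm_triangle_ineq[of "cis a" "cis b"] by simp
  show ?thesis
    using combination_le_ks[OF e e] unfolding dC_def by (metis mult.right_neutral)
qed

lemma norm_dT: "cmod (dT t j l) \<le> 24 * ks j l"
proof -
  have e: "cmod (cis a) \<le> 3 * 1" for a by simp
  show ?thesis
    using combination_le_ks[OF e e] unfolding dT_def by (metis mult.right_neutral)
qed

text \<open>The product is, up to sign, the splitting error
  \<open>cis a + cis b - 1 - cis (a + b)\<close>. One factor is estimated by 2 and the other by its
  phase; the choice is free, hence the smaller phase.\<close>

lemma norm_cis_product: "cmod ((cis a - 1) * (cis b - 1)) \<le> 2 * min \<bar>a\<bar> \<bar>b\<bar>"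
proof -
  have 2: "cmod (cis x - 1) \<le> 2" for x using norm_triangle_ineq4[of "cis x" 1] by simp
  have "cmod (cis a - 1) * cmod (cis b - 1) \<le> \<bar>a\<bar> * 2"
    by (intro mult_mono 2 norm_cis_minus_1) auto
  moreover have "cmod (cis a - 1) * cmod (cis b - 1) \<le> 2 * \<bar>b\<bar>"
    by (intro mult_mono 2 norm_cis_minus_1) auto
  ultimately show ?thesis by (simp add: norm_mult min_def)
qed

text \<open>Weight times smaller phase for the two splittings, with \<open>x = |j|\<close>,
  \<open>y = |l|\<close>, \<open>K = |j + l|\<close>. The factor \<open>K\<close> gained on the
  right reduces the singularity \<open>1 / K^2\<close> of the weights to \<open>1 / K\<close>.
  Either a phase containing \<open>K\<close> can be used, or one frequency exceeds twice the other
  and \<open>K\<close> is comparable with the larger one.\<close>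

lemma triangle_estimates:
  fixes x y K :: real
  assumes "0 \<le> x" "0 \<le> y" "0 < K" "K \<le> x + y" "x \<le> K + y" "y \<le> K + x"
  shows "y^2 * min (x^2) (K * y) \<le> 4 * K * ((min x y)^2 * max x y)"
    and "x * y * min (K^2) (x * y) \<le> 4 * K * ((min x y)^2 * max x y)"
proof -
  show "y^2 * min (x^2) (K * y) \<le> 4 * K * ((min x y)^2 * max x y)"
  proof (cases "y \<le> x")
    case True
    have "y^2 * min (x^2) (K * y) \<le> y^2 * (K * y)" by (intro mult_left_mono) auto
    also have "\<dots> \<le> y^2 * (K * x)" using True assms by (intro mult_left_mono) auto
    also have "\<dots> \<le> 4 * K * (y^2 * x)" using assms by (simp add: mult_ac)
    finally show ?thesis using True by simp
  next
    case xy: False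
    show ?thesis
    proof (cases "y \<le> 2 * x")
      case True
      have "y^2 * min (x^2) (K * y) \<le> y^2 * (K * y)" by (intro mult_left_mono) auto
      also have "\<dots> \<le> (2 * x)^2 * (K * y)" using True assms by (intro mult_right_mono power_mono) auto
      finally show ?thesis using xy by (simp add: power_mult_distrib mult_ac)
    next
      case False
      \<comment> \<open>Now \<open>y > 2 * x\<close>, so \<open>y <= K + x\<close> gives
        \<open>y <= 2 * K\<close>, and \<open>x^2\<close> is the phase to use.\<close>
      have "y^2 * min (x^2) (K * y) \<le> y * y * x^2"
        unfolding power2_eq_square[of y] by (intro mult_left_mono) (use assms in auto)
      also have "\<dots> \<le> (4 * K) * y * x^2" using False assms by (intro mult_right_mono) auto
      finally show ?thesis using xy by (simp add: mult_ac)
    qed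
  qed
  \<comment> \<open>The second estimate is symmetric in \<open>x\<close> and \<open>y\<close>, so
    \<open>y <= x\<close> may be assumed; the minimum then has to yield a factor
    \<open>K * y\<close>.\<close>
  have *: "x * y * min (K^2) (x * y) \<le> 4 * K * (y^2 * x)"
    if "y \<le> x" "0 \<le> y" "K \<le> x + y" "x \<le> K + y" for x y
  proof -
    have "min (K^2) (x * y) \<le> 4 * K * y"
    proof (cases "x \<le> 2 * y")
      case True
      have "K * K \<le> K * (4 * y)" using True that assms by (intro mult_left_mono) auto
      then show ?thesis by (simp add: power2_eq_square min_le_iff_disj mult_ac)
    next
      case False
      have "x * y \<le> (4 * K) * y" using False that assms by (intro mult_right_mono) auto
      then show ?thesis by (simp add: min_le_iff_disj)
    qed
    then have "x * y * min (K^2) (x * y) \<le> x * y * (4 * K * y)"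
      using that by (intro mult_left_mono) auto
    then show ?thesis by (simp add: power2_eq_square mult_ac)
  qed
  show "x * y * min (K^2) (x * y) \<le> 4 * K * ((min x y)^2 * max x y)"
    using *[of y x] *[of x y] assms by (cases "y \<le> x") (auto simp: add.commute mult.commute)
qed

lemma ke_nonneg: "0 \<le> ke j l"
  by (simp add: ke_def le_max_iff_disj)

text \<open>Both pairs of phases in \<open>dC\<close> add up to the phase of \<open>dT\<close>, so
  the difference is a weighted sum of two splitting errors. \<open>triangle_estimates\<close> bounds
  each and recovers one of the two powers of \<open>j + l\<close> in the denominators.\<close>

lemma dC_minus_dT:
  assumes t: "0 \<le> t"
  shows "cmod (dC t j l - dT t j l) \<le> 128 * t * ke j l"
proof (cases "j + l = 0")
  case True
  then show ?thesis using t by (simp add: dC_def dT_def ke_nonneg)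
next
  case False
  define x y K where xyK: "x = \<bar>real_of_int j\<bar>" "y = \<bar>real_of_int l\<bar>" "K = \<bar>real_of_int (j + l)\<bar>"
  have K: "0 < K" using False by (simp only: xyK zero_less_abs_iff of_int_eq_0_iff) simp
  have tri: "0 \<le> x" "0 \<le> y" "K \<le> x + y" "x \<le> K + y" "y \<le> K + x" by (auto simp: xyK)
  define m where "m = (min x y)^2 * max x y"
  have m: "m \<le> (min (J j) (J l))^2 * max (J j) (J l)" unfolding m_def
    by (intro mult_mono power_mono min.mono max.mono) (auto simp: xyK abs_le_J le_max_iff_disj)
  have mn: "0 \<le> m" using tri by (auto simp: m_def le_max_iff_disj)
  define a1 b1 a2 b2 where ab: "a1 = - (t * (2 * (real_of_int j)^2))" "b1 = - (t * (2 * real_of_int (j + l) * real_of_int l))"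
    "a2 = - (t * (2 * (real_of_int (j + l))^2))" "b2 = - (t * - (2 * real_of_int j * real_of_int l))"
  define c1 c2 where c: "c1 = 2 * (real_of_int l)^2 / (real_of_int (j + l))^2"
    "c2 = 2 * real_of_int j * real_of_int l / (real_of_int (j + l))^2"
  let ?ph = "- (t * ((real_of_int (j + l))^2 + (real_of_int j)^2 + (real_of_int l)^2))"
  \<comment> \<open>\<open>k^2 + j^2 + l^2 = 2 j^2 + 2 k l = 2 k^2 - 2 j l\<close> for
    \<open>k = j + l\<close>.\<close>
  have ph: "?ph = a1 + b1" "?ph = a2 + b2"
    by (simp_all add: ab power2_eq_square algebra_simps)
  have "dC t j l - dT t j l = of_real c1 * (cis a1 + cis b1 - 1 - cis a1 * cis b1)
      + of_real c2 * (cis a2 + cis b2 - 1 - cis a2 * cis b2)"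
    unfolding dC_def dT_def ab[symmetric] c[symmetric] cis_mult ph(1)[symmetric] ph(2)[symmetric]
    by (simp add: algebra_simps)
  also have "\<dots> = - (of_real c1 * ((cis a1 - 1) * (cis b1 - 1))) - of_real c2 * ((cis a2 - 1) * (cis b2 - 1))"
    by (simp add: algebra_simps)
  finally have "cmod (dC t j l - dT t j l)
     \<le> cmod (of_real c1 * ((cis a1 - 1) * (cis b1 - 1))) + cmod (of_real c2 * ((cis a2 - 1) * (cis b2 - 1)))"
    by (metis norm_minus_cancel norm_triangle_ineq4)
  also have "\<dots> \<le> \<bar>c1\<bar> * (2 * min \<bar>a1\<bar> \<bar>b1\<bar>) + \<bar>c2\<bar> * (2 * min \<bar>a2\<bar> \<bar>b2\<bar>)"
    unfolding norm_mult[of "of_real _"] norm_of_real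
    by (intro add_mono mult_left_mono norm_cis_product) auto
  also have "\<dots> = 8 * t / K^2 * (y^2 * min (x^2) (K * y)) + 8 * t / K^2 * (x * y * min (K^2) (x * y))"
  proof -
    have "\<bar>c1\<bar> = 2 * y^2 / K^2" "\<bar>c2\<bar> = 2 * (x * y) / K^2"
      by (simp_all add: c xyK abs_mult del: of_int_add)
    moreover have "\<bar>a1\<bar> = (2 * t) * x^2" "\<bar>b1\<bar> = (2 * t) * (K * y)" "\<bar>a2\<bar> = (2 * t) * K^2" "\<bar>b2\<bar> = (2 * t) * (x * y)"
      using t by (simp_all add: ab xyK abs_mult del: of_int_add)
    moreover have "min ((2 * t) * u) ((2 * t) * v) = (2 * t) * min u v" for u v
      using t by (simp add: min_mult_distrib_left)
    ultimately show ?thesis by (simp only:) (simp add: field_simps)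
  qed
  also have "\<dots> \<le> 8 * t / K^2 * (4 * K * m) + 8 * t / K^2 * (4 * K * m)"
    unfolding m_def by (intro add_mono mult_left_mono triangle_estimates) (use tri K t in auto)
  also have "\<dots> = 64 * t * (m / K)" using K by (simp add: field_simps power2_eq_square)
  also have "\<dots> \<le> 64 * t * (2 * ke j l)"
  proof (intro mult_left_mono)
    have "J (j + l) \<le> 2 * K" unfolding xyK by (rule J_le_2_abs[OF False])
    then have "m / K \<le> ((min (J j) (J l))^2 * max (J j) (J l)) / (J (j + l) / 2)"
      using m mn K by (intro frac_le) auto
    also have "\<dots> = 2 * ke j l" by (simp add: ke_def)
    finally show "m / K \<le> 2 * ke j l" .
  qed (use t in auto)
  finally show ?thesis by simp
qed

text \<open>Both arguments are \<open>g\<close> and the phase is symmetric, so the weights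
  \<open>j^2 / k^2\<close> and \<open>l^2 / k^2\<close> contribute equally, and twice the second may
  replace their sum. The two symbols differ; only the resulting operators agree.\<close>

lemma bil_exact_phase:
  assumes r: "1 \<le> r" and g: "Hb r g a" and k: "k \<noteq> 0"
  shows "bil (\<lambda>j l. cis (- (t * ((real_of_int (j + l))^2 + (real_of_int j)^2 + (real_of_int l)^2)))) g g k
    = bil (dT t) g g k"
proof -
  define e where "e = (\<lambda>j l. cis (- (t * ((real_of_int (j + l))^2 + (real_of_int j)^2 + (real_of_int l)^2))))"
  define p where "p = (\<lambda>j l. of_real ((real_of_int l)^2 / (real_of_int (j + l))^2) * e j l)"
  define p' where "p' = (\<lambda>j l. of_real ((real_of_int j)^2 / (real_of_int (j + l))^2) * e j l)"
  define w where "w = (\<lambda>j l. of_real (2 * real_of_int j * real_of_int l / (real_of_int (j + l))^2) * e j l)"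
  have sy: "p' j l = p l j" for j l by (simp add: p_def p'_def e_def add_ac)
  have ne: "cmod (e j l) = 1" for j l by (simp add: e_def)
  have kk: "4 * ks j (k - j) \<le> 4 * ((J j)^2 + (J (k - j))^2)" for j
  proof -
    have "(max (J j) (J (k - j)))^2 \<le> (J j)^2 + (J (k - j))^2" by (simp add: max_def)
    moreover have "ks j (k - j) \<le> (max (J j) (J (k - j)))^2"
      using one_le_J2[of k] by (simp add: ks_def power_divide pos_divide_le_eq mult_left_le mult_left_mono
        mult_le_cancel_left1)
    ultimately show ?thesis by simp
  qed
  have sp: "summ p g g k"
  proof (rule summ_quadratic[OF r g g])
    fix j
    have "cmod (p j (k - j)) = \<bar>(real_of_int (k - j))^2 / (real_of_int (j + (k - j)))^2\<bar>"
      unfolding p_def norm_mult ne norm_of_real by (rule mult_1_right)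
    also have "\<dots> \<le> 4 * ks j (k - j)" by (rule square_ratio_le_ks)
    finally show "cmod (p j (k - j)) \<le> 4 * ((J j)^2 + (J (k - j))^2)" using kk[of j] by linarith
  qed
  have sp': "summ p' g g k"
  proof (rule summ_quadratic[OF r g g])
    fix j
    have "cmod (p' j (k - j)) = \<bar>(real_of_int j)^2 / (real_of_int ((k - j) + j))^2\<bar>"
      unfolding p'_def norm_mult ne norm_of_real by (simp add: add.commute)
    also have "\<dots> \<le> 4 * ks (k - j) j" by (rule square_ratio_le_ks)
    also have "\<dots> = 4 * ks j (k - j)" by (simp add: ks_def max.commute)
    finally show "cmod (p' j (k - j)) \<le> 4 * ((J j)^2 + (J (k - j))^2)" using kk[of j] by linarith
  qed
  have sw: "summ w g g k"
  proof (rule summ_quadratic[OF r g g])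
    fix j
    have "cmod (w j (k - j)) = \<bar>2 * real_of_int j * real_of_int (k - j) / (real_of_int (j + (k - j)))^2\<bar>"
      unfolding w_def norm_mult ne norm_of_real by (rule mult_1_right)
    also have "\<dots> \<le> 4 * ks j (k - j)" by (rule ratio_le_ks)
    finally show "cmod (w j (k - j)) \<le> 4 * ((J j)^2 + (J (k - j))^2)" using kk[of j] by linarith
  qed
  have pp: "bil p' g g k = bil p g g k"
    by (subst bil_commute) (simp add: sy)
  have "bil e g g k = bil (\<lambda>j l. p' j l + w j l + p j l) g g k"
  proof (rule bil_cong)
    fix j
    define l where "l = k - j"
    have kl: "real_of_int k = real_of_int j + real_of_int l" by (simp add: l_def)
    have "(real_of_int j)^2 / (real_of_int k)^2 + 2 * real_of_int j * real_of_int l / (real_of_int k)^2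
      + (real_of_int l)^2 / (real_of_int k)^2 = (real_of_int k)^2 / (real_of_int k)^2"
      unfolding add_divide_distrib[symmetric] by (simp add: kl power2_sum)
    also have "\<dots> = 1" using k by simp
    finally have one: "of_real ((real_of_int j)^2 / (real_of_int k)^2) + of_real (2 * real_of_int j * real_of_int l / (real_of_int k)^2)
      + of_real ((real_of_int l)^2 / (real_of_int k)^2) = (1 :: complex)"
      by (simp only: of_real_add[symmetric] of_real_1)
    have jl: "j + l = k" by (simp add: l_def)
    show "e j (k - j) = p' j (k - j) + w j (k - j) + p j (k - j)"
      unfolding l_def[symmetric] p_def p'_def w_def jl distrib_right[symmetric] one by simp
  qed
  also have "\<dots> = bil p' g g k + bil w g g k + bil p g g k"
    by (simp add: bil_add summ_add sp sp' sw)
  also have "\<dots> = 2 * bil p g g k + bil w g g k" by (simp add: pp)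
  also have "\<dots> = bil (\<lambda>j l. 2 * p j l + w j l) g g k"
    by (simp add: bil_add bil_mult_outer summ_cmult sp sw)
  also have "\<dots> = bil (dT t) g g k"
    by (rule bil_cong) (simp add: dT_def p_def w_def e_def)
  finally show ?thesis by (simp add: e_def)
qed

lemma Hb_cong: "Hb s f A \<Longrightarrow> (\<And>k. f k = g k) \<Longrightarrow> Hb s g A"
  by (metis ext)

lemma NL_0: "NL 0 f g k = 0"
  by (simp add: NL_def QA_def[abs_def] QB_def[abs_def] QC_def[abs_def] bil_def)

section \<open>Stability of one step and expansion of the square\<close>

locale kernels =
  fixes r s Ks Ke :: real
  assumes r1: "1 \<le> r" and rs: "r \<le> s" and Ks0: "0 \<le> Ks" and Ke0: "0 \<le> Ke"
    and ks_op: "\<And>q A f g a b. (\<And>j l. cmod (q j l) \<le> A * ks j l) \<Longrightarrow> 0 \<le> A \<Longrightarrow>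
      Hb r f a \<Longrightarrow> Hb r g b \<Longrightarrow> Hb r (bil q f g) (Ks * A * a * b)"
    and ke_op: "\<And>q A f g a b. (\<And>j l. cmod (q j l) \<le> A * ke j l) \<Longrightarrow> 0 \<le> A \<Longrightarrow>
      Hb s f a \<Longrightarrow> Hb s g b \<Longrightarrow> Hb r (bil q f g) (Ke * A * a * b)"
begin

lemma summ_ks:
  assumes "Hb r f a" "Hb r g b" "\<And>j l. cmod (q j l) \<le> A * ks j l"
  shows "summ q f g k"
proof -
  obtain K where K: "\<forall>q A f g a b. (\<forall>j l. cmod (q j l) \<le> A * ks j l) \<longrightarrow> 0 \<le> A \<longrightarrow> Hb r f a \<longrightarrow> Hb r g b \<longrightarrow>
     Hb r (bil q f g) (K * A * a * b) \<and> (\<forall>k. (\<lambda>j. cmod (q j (k - j) * (f j * g (k - j)))) summable_on UNIV)"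
    using ks_bounded[OF r1] by blast
  have "0 \<le> A * ks 0 0" using assms(3) norm_ge_zero order_trans by blast
  moreover have "0 < ks 0 0" by (simp add: ks_def)
  ultimately have "0 \<le> A" by (simp add: zero_le_mult_iff)
  with K assms show ?thesis unfolding summ_def by blast
qed

lemma bil_difference:
  assumes q: "\<And>j l. cmod (q j l) \<le> A * ks j l" "0 \<le> A"
    and f: "Hb r f M" and F: "Hb r F M" and g: "Hb r g M" and G: "Hb r G M"
    and d: "Hb r (\<lambda>k. f k - F k) d" and e: "Hb r (\<lambda>k. g k - G k) e"
  shows "Hb r (\<lambda>k. bil q f g k - bil q F G k) (Ks * A * M * (d + e))"
proof -
  note sm = summ_ks[OF _ _ q(1)]
  have eq: "bil q (\<lambda>k. f k - F k) g k + bil q F (\<lambda>k. g k - G k) k = bil q f g k - bil q F G k" for k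
    by (simp add: bil_diff_left[OF sm[OF f g] sm[OF F g]] bil_diff_right[OF sm[OF F g] sm[OF F G]])
  have "Hb r (\<lambda>k. bil q (\<lambda>k. f k - F k) g k + bil q F (\<lambda>k. g k - G k) k) (Ks * A * d * M + Ks * A * M * e)"
    by (intro Hb_add ks_op[OF q] f F g G d e)
  then show ?thesis unfolding eq by (simp add: algebra_simps)
qed

text \<open>Only the linear flow contributes at order 0 in \<open>t\<close>, and it is an isometry,
  so \<open>d\<close> enters with coefficient exactly 1 outside the term of order \<open>t\<close>.
  This is what allows the errors to be summed over \<open>T / t\<close> steps.\<close>

lemma Psi2_stable:
  assumes t: "0 \<le> t" and c: "cmod c \<le> Cc"
    and f: "Hb r f M" and F: "Hb r F M" and g: "Hb r g M" and G: "Hb r G M"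
    and d: "Hb r (\<lambda>k. f k - F k) d" and e: "Hb r (\<lambda>k. g k - G k) e"
  shows "Hb r (\<lambda>k. Psi2 c t f g k - Psi2 c t F G k) (d + t * ((24 * Ks * M + Cc) * (d + e)))"
proof -
  have n: "0 \<le> M" "0 \<le> d" "0 \<le> e" "0 \<le> Cc" using Hb_nonneg f d e c norm_ge_zero order_trans by blast+
  have A: "Hb r (\<lambda>k. bil (QA t) f f k - bil (QA t) F F k) (Ks * (24 * t) * M * (d + d))"
    by (rule bil_difference[OF norm_QA[OF t] _ f F f F d d]) (use t in simp)
  have B: "Hb r (\<lambda>k. bil (QB t) f g k - bil (QB t) F G k) (Ks * (24 * t) * M * (d + e))"
    by (rule bil_difference[OF norm_QB[OF t] _ f F g G d e]) (use t in simp)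
  have C: "Hb r (\<lambda>k. bil (QC t) g g k - bil (QC t) G G k) (Ks * (24 * t) * M * (e + e))"
    by (rule bil_difference[OF norm_QC[OF t] _ g G g G e e]) (use t in simp)
  have N: "Hb r (\<lambda>k. NL t f g k - NL t F G k) (4 * (Ks * (24 * t) * M * (d + e)))"
  proof -
    have "Hb r (\<lambda>k. (bil (QA t) f f k - bil (QA t) F F k) + 2 * (bil (QB t) f g k - bil (QB t) F G k)
       + (bil (QC t) g g k - bil (QC t) G G k))
       (Ks * (24 * t) * M * (d + d) + 2 * (Ks * (24 * t) * M * (d + e)) + Ks * (24 * t) * M * (e + e))"
      by (intro Hb_add Hb_scale A B C) auto
    then show ?thesis unfolding NL_def by (simp add: algebra_simps)
  qed
  define P1 where "P1 = (\<lambda>k. (- (\<i>/4) * of_real (Bs k)) * (NL t f g k - NL t F G k))"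
  have P1: "Hb r P1 (1/4 * (4 * (Ks * (24 * t) * M * (d + e))))" unfolding P1_def
    by (intro Hb_scale N) (use norm_Bs in \<open>auto simp: norm_mult norm_divide\<close>)
  define P2 where "P2 = (\<lambda>k. (- (\<i> * c) * of_real (Bs k)) * (of_real t * (f k - F k) + Eint t (2 * (real_of_int k)^2) * (g k - G k)))"
  have P2: "Hb r P2 (Cc * (t * d + t * e))" unfolding P2_def
  proof (intro Hb_scale Hb_add d e)
    show "cmod (- (\<i> * c) * of_real (Bs k)) \<le> Cc" for k
      using mult_mono[OF c norm_Bs[of k]] n by (simp add: norm_mult)
  qed (use t n norm_Eint in auto)
  have "Hb r (\<lambda>k. cis (t * angsym k) * ((f k - F k) + P1 k + P2 k))
      (1 * (d + 1/4 * (4 * (Ks * (24 * t) * M * (d + e))) + Cc * (t * d + t * e)))"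
    by (intro Hb_scale Hb_add d P1 P2) auto
  moreover have "cis (t * angsym k) * ((f k - F k) + P1 k + P2 k) = Psi2 c t f g k - Psi2 c t F G k" for k
    unfolding Psi2_def P1_def P2_def by (simp add: algebra_simps)
  ultimately have "Hb r (\<lambda>k. Psi2 c t f g k - Psi2 c t F G k)
      (1 * (d + 1/4 * (4 * (Ks * (24 * t) * M * (d + e))) + Cc * (t * d + t * e)))"
    by (rule Hb_cong)
  then show ?thesis by (rule Hb_mono) (simp add: algebra_simps)
qed

lemma bil_deriv:
  assumes f: "Hb r f a" and g: "Hb r g b" and t: "t \<in> {0..\<tau>}"
    and q: "\<And>t j l. 0 \<le> t \<Longrightarrow> cmod (q t j l) \<le> 24 * t * ks j l"
    and q': "\<And>t j l. cmod (q' t j l) \<le> 24 * ks j l"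
    and der: "\<And>t j l. ((\<lambda>t. q t j l) has_vector_derivative q' t j l) (at t within {0..\<tau>})"
  shows "((\<lambda>t. bil (q t) f g k) has_vector_derivative bil (q' t) f g k) (at t within {0..\<tau>})"
  unfolding bil_def
proof (rule has_vector_derivative_infsum)
  show "((\<lambda>t. q t j (k - j) * (f j * g (k - j))) has_vector_derivative q' t j (k - j) * (f j * g (k - j)))
     (at t within {0..\<tau>})" for t j
    by (intro has_vector_derivative_mult_left der)
  show "cmod (q' t j (k - j) * (f j * g (k - j))) \<le> cmod (of_real (24 * ks j (k - j)) * (f j * g (k - j)))" for t j
    using mult_right_mono[OF q'[of t j "k - j"], of "cmod (f j * g (k - j))"] ks_nonneg[of j "k - j"]
    by (simp add: norm_mult)
  show "(\<lambda>j. cmod (of_real (24 * ks j (k - j)) * (f j * g (k - j)))) summable_on UNIV"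
    using summ_ks[OF f g, of "\<lambda>j l. of_real (24 * ks j l)" 24 k] unfolding summ_def
    by (auto simp: ks_nonneg)
  show "(\<lambda>j. q t j (k - j) * (f j * g (k - j))) summable_on UNIV" if "t \<in> {0..\<tau>}" for t
    using that by (intro summ_summable summ_ks[OF f g q]) auto
qed (use t in auto)

lemma NL_deriv:
  assumes f: "Hb r f a" and g: "Hb r g b" and t: "t \<in> {0..\<tau>}"
  shows "((\<lambda>t. NL t f g k) has_vector_derivative
     (bil (dA t) f f k + 2 * bil (dB t) f g k + bil (dC t) g g k)) (at t within {0..\<tau>})"
  unfolding NL_def
  by (intro has_vector_derivative_add has_vector_derivative_mult_right
      bil_deriv[OF f f t norm_QA norm_dA QA_deriv] bil_deriv[OF f g t norm_QB norm_dB QB_deriv]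
      bil_deriv[OF g g t norm_QC norm_dC QC_deriv])

text \<open>\<open>f\<close> and \<open>g\<close> are frozen and carried by opposite Schroedinger
  flows. After untwisting, the three products have the phases
  \<open>k^2 - j^2 - l^2 = 2 j l\<close>, \<open>k^2 - j^2 + l^2 = 2 k l\<close> and
  \<open>k^2 + j^2 + l^2\<close>; the first two are those that the scheme integrates
  exactly.\<close>

lemma square_expand:
  assumes f: "Hb r f a" and g: "Hb r g b" and k: "k \<noteq> 0"
    and y: "\<And>k. y k = (cis (t * (real_of_int k)^2) * f k + cis (- (t * (real_of_int k)^2)) * g k) / 2"
  shows "cis (- (t * (real_of_int k)^2)) * bil (\<lambda>_ _. 1) y y k
    = (bil (dA t) f f k + 2 * bil (dB t) f g k + bil (dT t) g g k) / 4"
proof -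
  define u where "u = (\<lambda>k. cis (t * (real_of_int k)^2) * f k)"
  define v where "v = (\<lambda>k. cis (- (t * (real_of_int k)^2)) * g k)"
  have u: "Hb r u (1 * a)" and v: "Hb r v (1 * b)" unfolding u_def v_def by (intro Hb_scale f g; simp)+
  define I where "I = (\<lambda>(j::int) (l::int). 1 :: complex)"
  have sm: "summ q f g k" if "Hb r f a" "Hb r g b" "\<And>j l. cmod (q j l) = 1" for q f g a b
    by (rule summ_ks[OF that(1,2), of _ 4]) (use that(3) ks_ge in auto)
  have su: "summ I u u k" "summ I u v k" "summ I v u k" "summ I v v k"
    by (rule sm[OF u u], simp add: I_def) (rule sm[OF u v], simp add: I_def,
      rule sm[OF v u], simp add: I_def, rule sm[OF v v], simp add: I_def)
  have uv: "Hb r (\<lambda>k. u k + v k) (1 * a + 1 * b)" by (rule Hb_add[OF u v])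
  have sw: "summ I u (\<lambda>k. u k + v k) k" "summ I v (\<lambda>k. u k + v k) k"
    by (rule sm[OF u uv], simp add: I_def) (rule sm[OF v uv], simp add: I_def)
  have y': "y = (\<lambda>k. (1/2) * (u k + v k))" by (rule ext) (simp add: y u_def v_def)
  have "bil I y y k = bil I (\<lambda>k. (1/2) * (u k + v k)) (\<lambda>k. (1/2) * (u k + v k)) k"
    by (simp only: y')
  also have "\<dots> = bil (\<lambda>j l. 1/4 * I j l) (\<lambda>k. u k + v k) (\<lambda>k. u k + v k) k"
    by (subst bil_mult_inner) (rule bil_cong, simp)
  also have "\<dots> = 1/4 * bil I (\<lambda>k. u k + v k) (\<lambda>k. u k + v k) k" by (rule bil_mult_outer[symmetric])
  also have "bil I (\<lambda>k. u k + v k) (\<lambda>k. u k + v k) k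
      = bil I u u k + bil I u v k + (bil I v u k + bil I v v k)"
    by (simp only: bil_add_left[OF sw] bil_add_right[OF su(1,2)] bil_add_right[OF su(3,4)])
  also have "bil I v u k = bil I u v k" by (subst bil_commute) (simp add: I_def)
  finally have yy: "bil I y y k = (bil I u u k + 2 * bil I u v k + bil I v v k) / 4" by simp
  have main: "cis (- (t * (real_of_int k)^2)) * bil I y y k
     = (cis (- (t * (real_of_int k)^2)) * bil I u u k + 2 * (cis (- (t * (real_of_int k)^2)) * bil I u v k)
        + cis (- (t * (real_of_int k)^2)) * bil I v v k) / 4"
    unfolding yy by (simp add: algebra_simps)
  have A: "cis (- (t * (real_of_int k)^2)) * bil I u u k = bil (dA t) f f k"
    unfolding u_def bil_mult_inner bil_mult_outer
  proof (rule bil_cong)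
    fix j
    define l where "l = k - j"
    have kl: "real_of_int k = real_of_int j + real_of_int l" by (simp add: l_def)
    show "cis (- (t * (real_of_int k)^2)) * (I j (k - j) * (cis (t * (real_of_int j)^2) * cis (t * (real_of_int (k - j))^2))) = dA t j (k - j)"
      unfolding l_def[symmetric] kl I_def dA_def mult_1_left cis_mult
      by (rule arg_cong[where f=cis]) (simp add: power2_eq_square algebra_simps)
  qed
  have B: "cis (- (t * (real_of_int k)^2)) * bil I u v k = bil (dB t) f g k"
    unfolding u_def v_def bil_mult_inner bil_mult_outer
  proof (rule bil_cong)
    fix j
    define l where "l = k - j"
    have kl: "real_of_int k = real_of_int j + real_of_int l" by (simp add: l_def)
    show "cis (- (t * (real_of_int k)^2)) * (I j (k - j) * (cis (t * (real_of_int j)^2) * cis (- (t * (real_of_int (k - j))^2)))) = dB t j (k - j)"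
      unfolding l_def[symmetric] kl I_def dB_def mult_1_left cis_mult of_int_add
      by (rule arg_cong[where f=cis]) (simp add: power2_eq_square algebra_simps)
  qed
  have C: "cis (- (t * (real_of_int k)^2)) * bil I v v k = bil (dT t) g g k"
    unfolding v_def bil_mult_inner bil_mult_outer bil_exact_phase[OF r1 g k, symmetric]
  proof (rule bil_cong)
    fix j
    define l where "l = k - j"
    have kl: "real_of_int k = real_of_int j + real_of_int l" by (simp add: l_def)
    show "cis (- (t * (real_of_int k)^2)) * (I j (k - j) * (cis (- (t * (real_of_int j)^2)) * cis (- (t * (real_of_int (k - j))^2))))
      = cis (- (t * ((real_of_int (j + (k - j)))^2 + (real_of_int j)^2 + (real_of_int (k - j))^2)))"
      unfolding l_def[symmetric] kl I_def mult_1_left cis_mult of_int_add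
      by (rule arg_cong[where f=cis]) (simp add: power2_eq_square algebra_simps)
  qed
  show ?thesis using main unfolding A B C by (simp add: I_def)
qed

text \<open>At a nonzero mode the square of the constant drops out and the cross term is linear in
  \<open>x\<close>. This is the part of the nonlinearity that the scheme treats with
  \<open>psi1op\<close>.\<close>

lemma fprod_const_split:
  assumes x: "Hb r x a" and w: "Hb r w b" and wx: "\<And>k. w k = x k + fconst c k" and k: "k \<noteq> 0"
  shows "fprod w w k = fprod x x k + 2 * c * x k"
proof -
  define I where "I = (\<lambda>(j::int) (l::int). 1 :: complex)"
  define d where "d = fconst c"
  have w': "w = (\<lambda>k. x k + d k)" by (rule ext) (simp add: wx d_def)
  have d: "Hb r d (b + a)" by (rule Hb_cong[OF Hb_diff[OF w x]]) (simp add: wx d_def)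
  have sm: "summ I f g k" if "Hb r f a" "Hb r g b" for f g a b
    by (rule summ_ks[OF that, of _ 4]) (use ks_ge in \<open>auto simp: I_def\<close>)
  have xd: "Hb r (\<lambda>k. x k + d k) (a + (b + a))" by (rule Hb_add[OF x d])
  have "bil I d x k = infsum (\<lambda>j. c * x k) {0::int}"
    unfolding bil_def by (intro infsum_cong_neutral) (auto simp: d_def fconst_def I_def)
  then have dx: "bil I d x k = c * x k" by simp
  have xd': "bil I x d k = c * x k" by (subst bil_commute) (use dx in \<open>simp add: I_def\<close>)
  have "bil I d d k = infsum (\<lambda>j. 0) {0::int}"
    unfolding bil_def by (intro infsum_cong_neutral) (use k in \<open>auto simp: d_def fconst_def I_def\<close>)
  then have dd: "bil I d d k = 0" by simp
  have "fprod w w k = bil I w w k" by (simp add: fprod_eq_bil I_def)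
  also have "\<dots> = bil I x x k + bil I x d k + (bil I d x k + bil I d d k)"
    unfolding w' by (simp only: bil_add_left[OF sm[OF x xd] sm[OF d xd]]
       bil_add_right[OF sm[OF x x] sm[OF x d]] bil_add_right[OF sm[OF d x] sm[OF d d]])
  finally have "fprod w w k = bil I x x k + 2 * c * x k" unfolding dx xd' dd by simp
  then show ?thesis by (simp add: fprod_eq_bil I_def)
qed

end

section \<open>Local error\<close>

definition Uc :: "fs \<Rightarrow> fs \<Rightarrow> fs" where
  "Uc z zt k = (if k = 0 then 0 else z k - \<i> / of_real (angsym k) * zt k)"

definition Vc :: "fs \<Rightarrow> fs \<Rightarrow> fs" where
  "Vc z zt k = (if k = 0 then 0 else z k + \<i> / of_real (angsym k) * zt k)"

lemma angsym_pos: "k \<noteq> 0 \<Longrightarrow> 0 < angsym k"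
  by (simp add: angsym_eq)

lemma inverse_angsym: "k \<noteq> 0 \<Longrightarrow> 1 / angsym k \<le> 2 / (J k)^2"
proof -
  assume k: "k \<noteq> 0"
  have "J k / 2 * J k \<le> angsym k"
    unfolding angsym_eq using J_le_2_abs[OF k] by (intro mult_right_mono) auto
  then have "1 / angsym k \<le> 1 / (J k / 2 * J k)" by (intro divide_left_mono) (auto simp: angsym_pos k)
  then show ?thesis by (simp add: power2_eq_square)
qed

lemma Hb_anginv:
  assumes "Hb (s - 2) w M"
  shows "Hb s (\<lambda>k. if k = 0 then 0 else \<i> / of_real (angsym k) * w k) (2 * M)"
proof (rule Hb_mult[OF assms])
  fix k
  show "J k powr s * cmod (if k = 0 then 0 else \<i> / of_real (angsym k) * w k) \<le> 2 * (J k powr (s - 2) * cmod (w k))"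
  proof (cases "k = 0")
    case False
    have "J k powr s * cmod (\<i> / of_real (angsym k) * w k) = J k powr s * (1 / angsym k) * cmod (w k)"
      using angsym_pos[OF False] by (simp add: norm_mult norm_divide)
    also have "\<dots> \<le> J k powr s * (2 / (J k)^2) * cmod (w k)"
      by (intro mult_right_mono mult_left_mono inverse_angsym False) auto
    also have "J k powr s * (2 / (J k)^2) = 2 * J k powr (s - 2)" by (simp add: powr_diff)
    finally show ?thesis using False by (simp add: mult_ac)
  qed simp
qed simp

text \<open>The constant is \<open>1 + 2\<close>, where 2 comes from
  \<open>1 / angsym k <= 2 / (J k)^2\<close>; this inverse also restores the two derivatives that
  \<open>zt\<close> lacks.\<close>

lemma Hb_Uc_Vc:
  assumes "Hb s z M" "Hb (s - 2) zt M"
  shows "Hb s (Uc z zt) (3 * M)" "Hb s (Vc z zt) (3 * M)"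
proof -
  have z: "Hb s (\<lambda>k. if k = 0 then 0 else z k) M"
    by (rule Hb_le[OF assms(1)]) auto
  show "Hb s (Uc z zt) (3 * M)"
    by (rule Hb_mono[OF Hb_cong[OF Hb_diff[OF z Hb_anginv[OF assms(2)]]]]) (auto simp: Uc_def)
  show "Hb s (Vc z zt) (3 * M)"
    by (rule Hb_mono[OF Hb_cong[OF Hb_add[OF z Hb_anginv[OF assms(2)]]]]) (auto simp: Vc_def)
qed

lemma has_vector_derivative_shift:
  fixes f :: "real \<Rightarrow> 'a::real_normed_vector"
  assumes "(f has_vector_derivative f') (at (t + \<sigma>) within {0..T})" "0 \<le> t" "t + \<tau> \<le> T"
  shows "((\<lambda>\<sigma>. f (t + \<sigma>)) has_vector_derivative f') (at \<sigma> within {0..\<tau>})"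
proof -
  have "(\<lambda>\<sigma>. t + \<sigma>) ` {0..\<tau>} \<subseteq> {0..T}" using assms by auto
  from has_vector_derivative_within_subset[OF assms(1) this]
  have "(f \<circ> (\<lambda>\<sigma>. t + \<sigma>) has_vector_derivative 1 *\<^sub>R f') (at \<sigma> within {0..\<tau>})"
    by (intro vector_diff_chain_within) (auto intro!: derivative_eq_intros simp: has_vector_derivative_def)
  then show ?thesis by (simp add: o_def)
qed

text \<open>Integrating factor: the frequency \<open>\<theta>\<close>, unbounded over the modes,
  disappears and only the nonlinear term \<open>p\<close> is left.\<close>

lemma twisted_deriv:
  assumes W: "((\<lambda>t. W t) has_vector_derivative (\<i> * of_real \<theta> * W (t + \<sigma>) + p)) (at (t + \<sigma>) within {0..T})"
    and t: "0 \<le> t" "t + \<tau> \<le> T"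
  shows "((\<lambda>\<sigma>. cis (- (\<sigma> * \<theta>)) * W (t + \<sigma>)) has_vector_derivative cis (- (\<sigma> * \<theta>)) * p) (at \<sigma> within {0..\<tau>})"
proof -
  have "((\<lambda>\<sigma>. cis (- (\<sigma> * \<theta>)) * W (t + \<sigma>)) has_vector_derivative
     (cis (- (\<sigma> * \<theta>)) * (\<i> * of_real \<theta> * W (t + \<sigma>) + p) + (- \<i> * of_real \<theta> * cis (- (\<sigma> * \<theta>))) * W (t + \<sigma>)))
     (at \<sigma> within {0..\<tau>})"
    by (intro has_vector_derivative_mult cis_deriv has_vector_derivative_shift[OF W t])
  then show ?thesis by (simp add: algebra_simps)
qed

text \<open>The nonlinear term contributes \<open>K\<close> through \<open>Hb_mvt\<close> on the
  twisted coefficients; exchanging the phase \<open>\<theta>\<close> for \<open>\<kappa>\<close>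
  contributes \<open>A\<close>, since they differ by at most 1. No regularity beyond
  \<open>H^r\<close> is used.\<close>

lemma drift:
  assumes W: "\<And>t k. t \<in> {0..T} \<Longrightarrow> ((\<lambda>t. W t k) has_vector_derivative
      (\<i> * of_real (\<theta> k) * W t k + \<beta> k * P t k)) (at t within {0..T})"
    and \<beta>: "\<And>k. cmod (\<beta> k) \<le> 1" and P: "\<And>t. t \<in> {0..T} \<Longrightarrow> Hb r (P t) K"
    and A: "Hb r (W t) A" and \<theta>: "\<And>k. \<bar>\<theta> k - \<kappa> k\<bar> \<le> 1"
    and t: "0 \<le> t" "0 \<le> \<tau>" "t + \<tau> \<le> T"
  shows "Hb r (\<lambda>k. W (t + \<tau>) k - cis (\<tau> * \<kappa> k) * W t k) (\<tau> * (K + A))"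
proof -
  have "Hb r (\<lambda>k. cis (- (\<tau> * \<theta> k)) * W (t + \<tau>) k - cis (- (0 * \<theta> k)) * W (t + 0) k) (\<tau> * K)"
  proof (rule Hb_mvt[OF t(2)])
    fix \<sigma> k assume "\<sigma> \<in> {0..\<tau>}"
    then have "t + \<sigma> \<in> {0..T}" using t by auto
    from twisted_deriv[OF W[OF this] t(1,3)]
    show "((\<lambda>\<sigma>. cis (- (\<sigma> * \<theta> k)) * W (t + \<sigma>) k) has_vector_derivative
       cis (- (\<sigma> * \<theta> k)) * (\<beta> k * P (t + \<sigma>) k)) (at \<sigma> within {0..\<tau>})" .
  next
    fix \<sigma> assume "\<sigma> \<in> {0..\<tau>}"
    then have "t + \<sigma> \<in> {0..T}" using t by auto
    from P[OF this] show "Hb r (\<lambda>k. cis (- (\<sigma> * \<theta> k)) * (\<beta> k * P (t + \<sigma>) k)) K"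
      by (rule Hb_le) (use mult_right_mono[OF \<beta>] in \<open>auto simp: norm_mult\<close>)
  qed
  then have 1: "Hb r (\<lambda>k. cis (\<tau> * \<theta> k) * (cis (- (\<tau> * \<theta> k)) * W (t + \<tau>) k - cis (- (0 * \<theta> k)) * W (t + 0) k)) (1 * (\<tau> * K))"
    by (rule Hb_scale) auto
  have 2: "Hb r (\<lambda>k. (cis (\<tau> * \<theta> k) - cis (\<tau> * \<kappa> k)) * W t k) (\<tau> * A)"
  proof (rule Hb_scale[OF A _ t(2)])
    fix k
    have "cmod (cis (\<tau> * \<theta> k) - cis (\<tau> * \<kappa> k)) \<le> \<tau> * \<bar>\<theta> k - \<kappa> k\<bar>"
      using norm_cis_diff[of "\<tau> * \<theta> k" "\<tau> * \<kappa> k"] t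
      by (simp add: right_diff_distrib[symmetric] abs_mult)
    also have "\<dots> \<le> \<tau> * 1" using \<theta> t by (intro mult_left_mono) auto
    finally show "cmod (cis (\<tau> * \<theta> k) - cis (\<tau> * \<kappa> k)) \<le> \<tau>" by simp
  qed
  have "Hb r (\<lambda>k. W (t + \<tau>) k - cis (\<tau> * \<kappa> k) * W t k) (1 * (\<tau> * K) + \<tau> * A)"
  proof (rule Hb_cong[OF Hb_add[OF 1 2]])
    fix k
    have "cis (\<tau> * \<theta> k) * cis (- (\<tau> * \<theta> k)) = 1" by (simp add: cis_mult)
    then have "cis (\<tau> * \<theta> k) * (cis (- (\<tau> * \<theta> k)) * X) = X" for X by (simp add: mult.assoc[symmetric])
    then show "cis (\<tau> * \<theta> k) * (cis (- (\<tau> * \<theta> k)) * W (t + \<tau>) k - cis (- (0 * \<theta> k)) * W (t + 0) k)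
       + (cis (\<tau> * \<theta> k) - cis (\<tau> * \<kappa> k)) * W t k = W (t + \<tau>) k - cis (\<tau> * \<kappa> k) * W t k"
      by (simp add: right_diff_distrib left_diff_distrib)
  qed
  then show ?thesis by (simp add: distrib_left)
qed

section \<open>Constants of the estimates and the equations for U and V\<close>

locale bounds = kernels +
  fixes T M :: real
  assumes T0: "0 < T" and M0: "0 \<le> M"
begin

definition "KP = 4 * Ks * M * M"

definition "Cc = M * (T + 1)"

text \<open>The summands are the bounds of \<open>T1\<close> to \<open>T5\<close> in
  \<open>local_error\<close>, in that order and divided by \<open>\<sigma>\<close>. The recurring
  \<open>KP + 3 * M\<close> is the drift constant of \<open>UV_drift\<close>.\<close>

definition "CL = KP + 24 * Ks * M * (KP + 3 * M) + 288 * Ke * M * M + 6 * M * M + 2 * Cc * (KP + 3 * M)"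

text \<open>The Lipschitz constant of \<open>Psi2_stable\<close> on the ball of radius
  \<open>3 * M + 1\<close>, which leaves room for an error of size 1 around the exact
  solution.\<close>

definition "K1 = 24 * Ks * (3 * M + 1) + Cc"

definition "CE = CL * T * exp (2 * K1 * T)"

lemma KP0: "0 \<le> KP" using Ks0 M0 by (simp add: KP_def)

lemma Cc0: "0 \<le> Cc" using M0 T0 by (simp add: Cc_def)

lemma CL0: "0 \<le> CL"
  using KP0 Ks0 Ke0 M0 Cc0 by (simp add: CL_def)

lemma K10: "0 \<le> K1"
  using Ks0 M0 Cc0 by (simp add: K1_def)

lemma CE0: "0 \<le> CE"
  using CL0 T0 by (simp add: CE_def)

end

locale solution = bounds +
  fixes a b :: complex and z zt :: "real \<Rightarrow> fs"
  assumes bs: "bouss_solution T z zt"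
    and zH: "\<And>t. t \<in> {0..T} \<Longrightarrow> Hb s (z t) M"
    and ztH: "\<And>t. t \<in> {0..T} \<Longrightarrow> Hb (s - 2) (zt t) M"
    and mean0: "\<And>t. t \<in> {0..T} \<Longrightarrow> z t 0 = a * of_real t + b"
    and aM: "cmod a \<le> M" and bM: "cmod b \<le> M"
begin

abbreviation "U t \<equiv> Uc (z t) (zt t)"
abbreviation "V t \<equiv> Vc (z t) (zt t)"

lemma UV_s: "t \<in> {0..T} \<Longrightarrow> Hb s (U t) (3 * M)" "t \<in> {0..T} \<Longrightarrow> Hb s (V t) (3 * M)"
  by (intro Hb_Uc_Vc zH ztH; assumption)+

lemma UV_r: "t \<in> {0..T} \<Longrightarrow> Hb r (U t) (3 * M)" "t \<in> {0..T} \<Longrightarrow> Hb r (V t) (3 * M)"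
  using Hb_lower[OF UV_s(1) rs] Hb_lower[OF UV_s(2) rs] by auto

text \<open>\<open>k^4 + k^2\<close> is the square of \<open>angsym k\<close>, so the second order
  equation factors into two first order ones with opposite frequencies.\<close>

lemma UV_deriv:
  assumes t: "t \<in> {0..T}"
  shows "((\<lambda>t. U t k) has_vector_derivative
     (\<i> * of_real (angsym k) * U t k + (- \<i> * of_real (Bs k)) * fprod (z t) (z t) k)) (at t within {0..T})"
    and "((\<lambda>t. V t k) has_vector_derivative
     (\<i> * of_real (- angsym k) * V t k + (\<i> * of_real (Bs k)) * fprod (z t) (z t) k)) (at t within {0..T})"
proof -
  let ?P = "fprod (z t) (z t) k"
  have d: "((\<lambda>t. z t k) has_vector_derivative zt t k) (at t within {0..T})"
    "((\<lambda>t. zt t k) has_vector_derivative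
       (- ((of_int k)^4 + (of_int k)^2) * z t k - (of_int k)^2 * ?P)) (at t within {0..T})"
    using bs t unfolding bouss_solution_def by blast+
  have "((\<lambda>t. U t k) has_vector_derivative
     (\<i> * of_real (angsym k) * U t k + (- \<i> * of_real (Bs k)) * ?P)) (at t within {0..T}) \<and>
    ((\<lambda>t. V t k) has_vector_derivative
     (\<i> * of_real (- angsym k) * V t k + (\<i> * of_real (Bs k)) * ?P)) (at t within {0..T})"
  proof (cases "k = 0")
    case True
    then show ?thesis by (simp add: Uc_def Vc_def Bs_def)
  next
    case False
    define w where "w = complex_of_real (angsym k)"
    have w: "w \<noteq> 0" using angsym_pos[OF False] by (simp add: w_def)
    have w2: "(of_int k)^4 + (of_int k)^2 = w * w"
    proof -
      have "angsym k * angsym k = (real_of_int k)^4 + (real_of_int k)^2"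
        by (simp add: angsym_def)
      then have "w * w = of_real ((real_of_int k)^4 + (real_of_int k)^2)"
        unfolding w_def of_real_mult[symmetric] by simp
      then show ?thesis by simp
    qed
    have B: "complex_of_real (Bs k) = - ((of_int k)^2 / w)" by (simp add: Bs_def w_def)
    have "((\<lambda>t. z t k - \<i> / w * zt t k) has_vector_derivative
        (zt t k - \<i> / w * (- ((of_int k)^4 + (of_int k)^2) * z t k - (of_int k)^2 * ?P))) (at t within {0..T})"
      by (intro has_vector_derivative_diff has_vector_derivative_mult_right d)
    moreover have "zt t k - \<i> / w * (- ((of_int k)^4 + (of_int k)^2) * z t k - (of_int k)^2 * ?P)
       = \<i> * w * (z t k - \<i> / w * zt t k) + (- \<i> * of_real (Bs k)) * ?P"
      unfolding w2 B using w by (simp add: field_simps)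
    moreover have "((\<lambda>t. z t k + \<i> / w * zt t k) has_vector_derivative
        (zt t k + \<i> / w * (- ((of_int k)^4 + (of_int k)^2) * z t k - (of_int k)^2 * ?P))) (at t within {0..T})"
      by (intro has_vector_derivative_add has_vector_derivative_mult_right d)
    moreover have "zt t k + \<i> / w * (- ((of_int k)^4 + (of_int k)^2) * z t k - (of_int k)^2 * ?P)
       = \<i> * (- w) * (z t k + \<i> / w * zt t k) + (\<i> * of_real (Bs k)) * ?P"
      unfolding w2 B using w by (simp add: field_simps)
    ultimately show ?thesis using False by (simp add: Uc_def Vc_def w_def)
  qed
  then show "((\<lambda>t. U t k) has_vector_derivative
     (\<i> * of_real (angsym k) * U t k + (- \<i> * of_real (Bs k)) * ?P)) (at t within {0..T})"
    "((\<lambda>t. V t k) has_vector_derivative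
     (\<i> * of_real (- angsym k) * V t k + (\<i> * of_real (Bs k)) * ?P)) (at t within {0..T})"
    by blast+
qed

lemma fprod_r:
  assumes "Hb r f A" "Hb r g B"
  shows "Hb r (fprod f g) (Ks * 4 * A * B)"
  unfolding fprod_eq_bil by (rule ks_op[OF _ _ assms]) (use ks_ge in auto)

lemma P_r: "t \<in> {0..T} \<Longrightarrow> Hb r (fprod (z t) (z t)) KP"
  using fprod_r[OF Hb_lower[OF zH rs] Hb_lower[OF zH rs]] by (simp add: KP_def mult_ac)

lemma UV_drift:
  assumes t: "0 \<le> t" "0 \<le> \<tau>" "t + \<tau> \<le> T"
  shows "Hb r (\<lambda>k. U (t + \<tau>) k - cis (\<tau> * (real_of_int k)^2) * U t k) (\<tau> * (KP + 3 * M))"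
    and "Hb r (\<lambda>k. V (t + \<tau>) k - cis (- (\<tau> * (real_of_int k)^2)) * V t k) (\<tau> * (KP + 3 * M))"
proof -
  have tT: "t \<in> {0..T}" using t by auto
  have w: "\<bar>angsym k - (real_of_int k)^2\<bar> \<le> 1" "\<bar>- angsym k - (- ((real_of_int k)^2))\<bar> \<le> 1" for k
    using angsym_diff[of k] by auto
  show "Hb r (\<lambda>k. U (t + \<tau>) k - cis (\<tau> * (real_of_int k)^2) * U t k) (\<tau> * (KP + 3 * M))"
    by (rule drift[OF UV_deriv(1) _ P_r UV_r(1)[OF tT] w(1) t]) (use norm_Bs in \<open>auto simp: norm_mult\<close>)
  have "Hb r (\<lambda>k. V (t + \<tau>) k - cis (\<tau> * (- ((real_of_int k)^2))) * V t k) (\<tau> * (KP + 3 * M))"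
    by (rule drift[OF UV_deriv(2) _ P_r UV_r(2)[OF tT] w(2) t]) (use norm_Bs in \<open>auto simp: norm_mult\<close>)
  then show "Hb r (\<lambda>k. V (t + \<tau>) k - cis (- (\<tau> * (real_of_int k)^2)) * V t k) (\<tau> * (KP + 3 * M))"
    by simp
qed

lemma mean_bound: "t \<in> {0..T} \<Longrightarrow> cmod (a * of_real t + b) \<le> Cc"
proof -
  assume t: "t \<in> {0..T}"
  have "cmod (a * of_real t + b) \<le> cmod a * t + cmod b"
    using norm_triangle_ineq[of "a * of_real t" b] t by (simp add: norm_mult)
  also have "\<dots> \<le> M * T + M" using t aM bM M0 by (intro add_mono mult_mono) auto
  finally show ?thesis by (simp add: Cc_def algebra_simps)
qed

text \<open>The step is read as a function of its length \<open>\<sigma>\<close>. Its difference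
  \<open>D\<close> from the exact solution, both untwisted, vanishes at \<open>\<sigma> = 0\<close>,
  and the derivative \<open>R\<close> of \<open>D\<close> is of size \<open>\<sigma>\<close> because
  every replacement made by the scheme costs one power of \<open>\<sigma>\<close>.\<close>

lemma local_error:
  assumes t: "0 \<le> t" "0 \<le> \<tau>" "t + \<tau> \<le> T"
  shows "Hb r (\<lambda>k. U (t + \<tau>) k - Psi2 (a * of_real t + b) \<tau> (U t) (V t) k) (\<tau> * (\<tau> * CL))"
proof -
  define f where "f = U t"
  define g where "g = V t"
  define c where "c = a * of_real t + b"
  have tT: "t \<in> {0..T}" using t by auto
  have f: "Hb r f (3 * M)" and g: "Hb r g (3 * M)" and gs: "Hb s g (3 * M)"
    using UV_r[OF tT] UV_s[OF tT] by (auto simp: f_def g_def)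
  have c: "cmod c \<le> Cc" unfolding c_def by (rule mean_bound[OF tT])
  define NL' where "NL' = (\<lambda>\<sigma> k. bil (dA \<sigma>) f f k + 2 * bil (dB \<sigma>) f g k + bil (dC \<sigma>) g g k)"
  define P where "P = (\<lambda>\<sigma>. fprod (z (t + \<sigma>)) (z (t + \<sigma>)))"
  define D where "D = (\<lambda>\<sigma> k. cis (- (\<sigma> * angsym k)) * U (t + \<sigma>) k
      - (f k - (\<i>/4 * of_real (Bs k)) * NL \<sigma> f g k
         - (\<i> * c * of_real (Bs k)) * (of_real \<sigma> * f k + Eint \<sigma> (2 * (real_of_int k)^2) * g k)))"
  define R where "R = (\<lambda>\<sigma> k. (- \<i> * of_real (Bs k)) * (cis (- (\<sigma> * angsym k)) * P \<sigma> k
      - NL' \<sigma> k / 4 - c * (f k + cis (- (\<sigma> * (2 * (real_of_int k)^2))) * g k)))"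
  have der: "((\<lambda>\<sigma>. D \<sigma> k) has_vector_derivative R \<sigma> k) (at \<sigma> within {0..\<tau>})" if \<sigma>: "\<sigma> \<in> {0..\<tau>}" for \<sigma> k
  proof -
    have "t + \<sigma> \<in> {0..T}" using t \<sigma> by auto
    note U' = twisted_deriv[OF UV_deriv(1)[OF this] t(1,3)]
    have i: "((\<lambda>t. of_real t) has_vector_derivative (1::complex)) (at \<sigma> within {0..\<tau>})"
      using Eint_deriv[of 0 \<sigma> "{0..\<tau>}"] by simp
    have "((\<lambda>\<sigma>. D \<sigma> k) has_vector_derivative (cis (- (\<sigma> * angsym k)) * ((- \<i> * of_real (Bs k)) * fprod (z (t + \<sigma>)) (z (t + \<sigma>)) k)
      - (0 - (\<i>/4 * of_real (Bs k)) * NL' \<sigma> k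
         - (\<i> * c * of_real (Bs k)) * (1 * f k + cis (- (\<sigma> * (2 * (real_of_int k)^2))) * g k)))) (at \<sigma> within {0..\<tau>})"
      unfolding D_def NL'_def
      by (intro has_vector_derivative_diff has_vector_derivative_add has_vector_derivative_mult_right
          has_vector_derivative_mult_left has_vector_derivative_const U' NL_deriv[OF f g \<sigma>] Eint_deriv i)
    then show ?thesis unfolding R_def P_def by (simp add: algebra_simps)
  qed
  have Rb: "Hb r (R \<sigma>) (\<tau> * CL)" if \<sigma>: "\<sigma> \<in> {0..\<tau>}" for \<sigma>
  proof -
    have s0: "0 \<le> \<sigma>" "\<sigma> \<le> \<tau>" and ts: "t + \<sigma> \<le> T" "t + \<sigma> \<in> {0..T}" using \<sigma> t by auto
    define x where "x = (\<lambda>k. (U (t + \<sigma>) k + V (t + \<sigma>) k) / 2)"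
    define y where "y = (\<lambda>k. (cis (\<sigma> * (real_of_int k)^2) * f k + cis (- (\<sigma> * (real_of_int k)^2)) * g k) / 2)"
    define c' where "c' = a * of_real (t + \<sigma>) + b"
    let ?e = "\<lambda>k. cis (- (\<sigma> * (real_of_int k)^2))"
    have x: "Hb r x (3 * M)"
    proof -
      have "Hb r (\<lambda>k. (1/2) * (U (t + \<sigma>) k + V (t + \<sigma>) k)) (1/2 * (3 * M + 3 * M))"
        by (intro Hb_scale Hb_add UV_r ts) auto
      then show ?thesis by (simp add: x_def)
    qed
    have y: "Hb r y (3 * M)"
    proof -
      have "Hb r (\<lambda>k. (1/2) * (cis (\<sigma> * (real_of_int k)^2) * f k + ?e k * g k)) (1/2 * (1 * (3 * M) + 1 * (3 * M)))"
        by (intro Hb_scale Hb_add f g) auto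
      then show ?thesis by (simp add: y_def)
    qed
    have xy: "Hb r (\<lambda>k. x k - y k) (\<sigma> * (KP + 3 * M))"
    proof -
      have "Hb r (\<lambda>k. (1/2) * ((U (t + \<sigma>) k - cis (\<sigma> * (real_of_int k)^2) * U t k) + (V (t + \<sigma>) k - ?e k * V t k)))
        (1/2 * (\<sigma> * (KP + 3 * M) + \<sigma> * (KP + 3 * M)))"
        by (intro Hb_scale Hb_add UV_drift t s0 ts) auto
      then show ?thesis
        by (rule Hb_mono[OF Hb_cong]) (auto simp: x_def y_def f_def g_def field_simps)
    qed
    define T1 where "T1 = (\<lambda>k. (cis (- (\<sigma> * angsym k)) - ?e k) * P \<sigma> k)"
    define T2 where "T2 = (\<lambda>k. ?e k * (bil (\<lambda>_ _. 1) x x k - bil (\<lambda>_ _. 1) y y k))"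
    define T3 where "T3 = (\<lambda>k. (1/4) * bil (\<lambda>j l. dT \<sigma> j l - dC \<sigma> j l) g g k)"
    define T4 where "T4 = (\<lambda>k. (?e k * (2 * (c' - c))) * x k)"
    define T5 where "T5 = (\<lambda>k. (?e k * (2 * c)) * (x k - y k))"
    have T1: "Hb r T1 (\<sigma> * KP)" unfolding T1_def
    proof (rule Hb_scale[OF _ _ s0(1)])
      show "Hb r (P \<sigma>) KP" unfolding P_def by (rule P_r[OF ts(2)])
      fix k
      have "cmod (cis (- (\<sigma> * angsym k)) - ?e k) \<le> \<sigma> * \<bar>angsym k - (real_of_int k)^2\<bar>"
        using norm_cis_diff[of "- (\<sigma> * angsym k)" "- (\<sigma> * (real_of_int k)^2)"] s0
        by (simp add: right_diff_distrib[symmetric] abs_mult abs_minus_commute)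
      also have "\<dots> \<le> \<sigma> * 1" using angsym_diff[of k] s0 by (intro mult_left_mono) auto
      finally show "cmod (cis (- (\<sigma> * angsym k)) - ?e k) \<le> \<sigma>" by simp
    qed
    have T2: "Hb r T2 (1 * (Ks * 4 * (3 * M) * (\<sigma> * (KP + 3 * M) + \<sigma> * (KP + 3 * M))))" unfolding T2_def
      by (intro Hb_scale bil_difference[OF _ _ x y x y xy xy]) (use ks_ge in auto)
    have T3: "Hb r T3 (1/4 * (Ke * (128 * \<sigma>) * (3 * M) * (3 * M)))" unfolding T3_def
    proof (intro Hb_scale ke_op[OF _ _ gs gs])
      show "cmod (dT \<sigma> j l - dC \<sigma> j l) \<le> 128 * \<sigma> * ke j l" for j l
        using dC_minus_dT[OF s0(1), of j l] by (simp add: norm_minus_commute)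
    qed (use s0 in auto)
    have T4: "Hb r T4 ((2 * (M * \<sigma>)) * (3 * M))" unfolding T4_def
    proof (rule Hb_scale[OF x])
      have "c' - c = a * of_real \<sigma>" by (simp add: c'_def c_def algebra_simps)
      then have "cmod (c' - c) \<le> M * \<sigma>" using aM s0 by (simp add: norm_mult mult_right_mono)
      then show "cmod (?e k * (2 * (c' - c))) \<le> 2 * (M * \<sigma>)" for k
        by (simp add: norm_mult del: right_diff_distrib_numeral)
    qed (use M0 s0 in auto)
    have T5: "Hb r T5 ((2 * Cc) * (\<sigma> * (KP + 3 * M)))" unfolding T5_def
      by (rule Hb_scale[OF xy]) (use c Cc0 in \<open>auto simp: norm_mult\<close>)
    have eq: "(- \<i> * of_real (Bs k)) * (T1 k + T2 k + T3 k + T4 k + T5 k) = R \<sigma> k" for k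
    proof (cases "k = 0")
      case True
      then show ?thesis by (simp add: R_def Bs_def)
    next
      case k: False
      have zx: "z (t + \<sigma>) j = x j + fconst c' j" for j
        using mean0[OF ts(2)] by (auto simp: x_def Uc_def Vc_def fconst_def c'_def)
      have Pk: "P \<sigma> k = bil (\<lambda>_ _. 1) x x k + 2 * c' * x k"
        unfolding P_def using fprod_const_split[OF x Hb_lower[OF zH[OF ts(2)] rs] zx k]
        by (simp add: fprod_eq_bil)
      have yk: "?e k * bil (\<lambda>_ _. 1) y y k = (bil (dA \<sigma>) f f k + 2 * bil (dB \<sigma>) f g k + bil (dT \<sigma>) g g k) / 4"
        by (rule square_expand[OF f g k]) (simp add: y_def)
      have T3k: "T3 k = (bil (dT \<sigma>) g g k - bil (dC \<sigma>) g g k) / 4"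
        unfolding T3_def
        by (simp add: bil_diff[OF summ_ks[OF g g norm_dT] summ_ks[OF g g norm_dC]])
      have lin: "?e k * (2 * y k) = f k + cis (- (\<sigma> * (2 * (real_of_int k)^2))) * g k"
      proof -
        have "?e k * (2 * y k) = (?e k * cis (\<sigma> * (real_of_int k)^2)) * f k + (?e k * ?e k) * g k"
          by (simp add: y_def algebra_simps)
        then show ?thesis by (simp add: cis_mult mult.left_commute)
      qed
      have "T1 k + T2 k + T3 k + T4 k + T5 k
        = cis (- (\<sigma> * angsym k)) * P \<sigma> k - ?e k * bil (\<lambda>_ _. 1) y y k + T3 k - c * (?e k * (2 * y k))"
        unfolding T1_def T2_def T4_def T5_def Pk by (simp add: algebra_simps)
      also have "\<dots> = cis (- (\<sigma> * angsym k)) * P \<sigma> k - NL' \<sigma> k / 4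
         - c * (f k + cis (- (\<sigma> * (2 * (real_of_int k)^2))) * g k)"
        unfolding yk T3k lin NL'_def by (simp add: field_simps)
      finally show ?thesis unfolding R_def by simp
    qed
    have "Hb r (\<lambda>k. (- \<i> * of_real (Bs k)) * (T1 k + T2 k + T3 k + T4 k + T5 k))
      (1 * (\<sigma> * KP + 1 * (Ks * 4 * (3 * M) * (\<sigma> * (KP + 3 * M) + \<sigma> * (KP + 3 * M)))
        + 1/4 * (Ke * (128 * \<sigma>) * (3 * M) * (3 * M)) + (2 * (M * \<sigma>)) * (3 * M) + (2 * Cc) * (\<sigma> * (KP + 3 * M))))"
      by (intro Hb_scale Hb_add T1 T2 T3 T4 T5) (use norm_Bs in \<open>auto simp: norm_mult\<close>)
    then have "Hb r (R \<sigma>) (\<sigma> * CL)"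
      unfolding eq by (rule Hb_mono) (simp add: CL_def algebra_simps)
    then show ?thesis by (rule Hb_mono) (use s0 CL0 in \<open>auto intro: mult_right_mono\<close>)
  qed
  have "Hb r (\<lambda>k. D \<tau> k - D 0 k) (\<tau> * (\<tau> * CL))"
    by (rule Hb_mvt[OF t(2) der Rb])
  then have "Hb r (\<lambda>k. cis (\<tau> * angsym k) * (D \<tau> k - D 0 k)) (1 * (\<tau> * (\<tau> * CL)))"
    by (rule Hb_scale) auto
  moreover have "cis (\<tau> * angsym k) * (D \<tau> k - D 0 k) = U (t + \<tau>) k - Psi2 c \<tau> f g k" for k
  proof -
    have D0: "D 0 k = 0" by (simp add: D_def NL_0 f_def)
    have "cis (\<tau> * angsym k) * cis (- (\<tau> * angsym k)) = 1" by (simp add: cis_mult)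
    then have "cis (\<tau> * angsym k) * (cis (- (\<tau> * angsym k)) * X) = X" for X by (simp add: mult.assoc[symmetric])
    then show ?thesis unfolding D0 unfolding D_def Psi2_def by (simp add: right_diff_distrib)
  qed
  ultimately show ?thesis by (simp add: c_def f_def g_def)
qed

text \<open>\<open>E <= 1\<close> places \<open>u\<close> in the ball on which \<open>K1\<close> is
  a Lipschitz constant. The numerical counterpart of \<open>V\<close> is \<open>fconj u\<close>; its
  error is a separate hypothesis because \<open>V\<close> is not known to be the conjugate of
  \<open>U\<close>.\<close>

lemma error_step:
  assumes t: "0 \<le> t" "0 \<le> \<tau>" "t + \<tau> \<le> T"
    and u: "u 0 = 0" "Hb r (\<lambda>k. U t k - u k) E" "Hb r (\<lambda>k. V t k - fconj u k) E" "E \<le> 1"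
  shows "Hb r (\<lambda>k. U (t + \<tau>) k - Psi1 a b \<tau> t u k)
     (E + \<tau> * (K1 * (E + E)) + \<tau> * (\<tau> * CL))"
proof -
  have tT: "t \<in> {0..T}" using t by auto
  have U: "Hb r (U t) (3 * M + 1)" and V: "Hb r (V t) (3 * M + 1)"
    using Hb_mono[OF UV_r(1)[OF tT]] Hb_mono[OF UV_r(2)[OF tT]] by auto
  have uH: "Hb r u (3 * M + 1)"
    by (rule Hb_mono[OF Hb_cong[OF Hb_diff[OF UV_r(1)[OF tT] u(2)]]]) (use u(4) in auto)
  have st: "Hb r (\<lambda>k. Psi2 (a * of_real t + b) \<tau> (U t) (V t) k - Psi2 (a * of_real t + b) \<tau> u (fconj u) k)
     (E + \<tau> * (K1 * (E + E)))"
    unfolding K1_def by (rule Psi2_stable[OF t(2) mean_bound[OF tT] U uH V Hb_fconj[OF uH] u(2,3)])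
  show ?thesis unfolding Psi1_eq_Psi2[OF r1 uH u(1) t(2)]
    by (rule Hb_cong[OF Hb_mono[OF Hb_add[OF st local_error[OF t]]]]) auto
qed

end

section \<open>Global error\<close>

lemma fconj_fconj [simp]: "fconj (fconj f) = f"
  by (simp add: fconj_def)

lemma fconj_0 [simp]: "fconj f 0 = cnj (f 0)"
  by (simp add: fconj_def)

lemma angsym_minus [simp]: "angsym (- k) = angsym k"
  by (simp add: angsym_def)

text \<open>Conjugating the solution exchanges \<open>U\<close> and \<open>V\<close> up to
  conjugation. The error of \<open>V\<close> against \<open>fconj u\<close> thus becomes an error of
  \<open>U\<close>, for the conjugate solution, against \<open>u\<close> itself.\<close>

lemma Uc_fconj: "Uc (fconj z) (fconj zt) = fconj (Vc z zt)"
  by (rule ext) (simp add: Uc_def Vc_def fconj_def)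

lemma Vc_fconj: "Vc (fconj z) (fconj zt) = fconj (Uc z zt)"
  by (rule ext) (simp add: Uc_def Vc_def fconj_def)

lemma fprod_fconj: "fprod (fconj f) (fconj g) k = cnj (fprod f g (- k))"
  unfolding fprod_def infsum_cnj[symmetric]
  by (rule infsum_reindex_bij_witness[of _ uminus uminus]) (auto simp: fconj_def)

lemma bouss_solution_fconj:
  assumes "bouss_solution T z zt"
  shows "bouss_solution T (\<lambda>t. fconj (z t)) (\<lambda>t. fconj (zt t))"
  unfolding bouss_solution_def
proof (intro allI ballI conjI)
  fix k t assume t: "t \<in> {0..T}"
  have d: "((\<lambda>s. z s (- k)) has_vector_derivative zt t (- k)) (at t within {0..T})"
    "((\<lambda>s. zt s (- k)) has_vector_derivative
      (- ((of_int (- k))^4 + (of_int (- k))^2) * z t (- k) - (of_int (- k))^2 * fprod (z t) (z t) (- k))) (at t within {0..T})"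
    using assms t unfolding bouss_solution_def by blast+
  note c = bounded_linear.has_vector_derivative[OF bounded_linear_cnj]
  show "((\<lambda>s. fconj (z s) k) has_vector_derivative fconj (zt t) k) (at t within {0..T})"
    unfolding fconj_def by (rule c[OF d(1)])
  show "((\<lambda>s. fconj (zt s) k) has_vector_derivative
      (- ((of_int k)^4 + (of_int k)^2) * fconj (z t) k - (of_int k)^2 * fprod (fconj (z t)) (fconj (z t)) k))
      (at t within {0..T})"
    using c[OF d(2)] unfolding fprod_fconj by (simp add: fconj_def)
qed

text \<open>At \<open>k = 0\<close> the equation reads \<open>z'' = 0\<close>.\<close>

lemma bouss_mean:
  assumes "bouss_solution T z zt" "0 < T" "t \<in> {0..T}"
  shows "zt t 0 = zt 0 0" "z t 0 = zt 0 0 * of_real t + z 0 0"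
proof -
  have T: "0 \<in> {0..T}" using assms(2) by simp
  have d: "((\<lambda>s. z s 0) has_vector_derivative zt t 0) (at t within {0..T})"
    "((\<lambda>s. zt s 0) has_vector_derivative 0) (at t within {0..T})" if "t \<in> {0..T}" for t
  proof -
    have "((\<lambda>s. zt s 0) has_vector_derivative
      (- ((of_int 0)^4 + (of_int 0)^2) * z t 0 - (of_int 0)^2 * fprod (z t) (z t) 0)) (at t within {0..T})"
      using assms(1) that unfolding bouss_solution_def by blast
    then show "((\<lambda>s. zt s 0) has_vector_derivative 0) (at t within {0..T})" by simp
    show "((\<lambda>s. z s 0) has_vector_derivative zt t 0) (at t within {0..T})"
      using assms(1) that unfolding bouss_solution_def by blast
  qed
  have zt: "zt t 0 = zt 0 0" if t: "t \<in> {0..T}" for t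
  proof -
    obtain c where "\<And>x. x \<in> {0..T} \<Longrightarrow> zt x 0 = c"
      by (rule has_vector_derivative_zero_constant[OF _ d(2)]) auto
    then show ?thesis using t T by simp
  qed
  show "zt t 0 = zt 0 0" by (rule zt[OF assms(3)])
  have "((\<lambda>s. z s 0 - zt 0 0 * of_real s) has_vector_derivative 0) (at t within {0..T})"
    if t: "t \<in> {0..T}" for t
  proof -
    have "((\<lambda>s. of_real s) has_vector_derivative (1::complex)) (at t within {0..T})"
      using Eint_deriv[of 0 t "{0..T}"] by simp
    from has_vector_derivative_diff[OF d(1)[OF t] has_vector_derivative_mult_right[OF this, of "zt 0 0"]]
    show ?thesis unfolding zt[OF t] by simp
  qed
  then obtain c where c: "\<And>x. x \<in> {0..T} \<Longrightarrow> z x 0 - zt 0 0 * of_real x = c"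
    by - (rule has_vector_derivative_zero_constant[of "{0..T}" "\<lambda>s. z s 0 - zt 0 0 * of_real s"], auto)
  show "z t 0 = zt 0 0 * of_real t + z 0 0"
    using c[OF assms(3)] c[OF T] by (simp add: algebra_simps)
qed

lemma u_init_eq: "u_init phi0 psi0 = Uc phi0 psi0"
  by (rule ext) (simp add: u_init_def Uc_def mean_def fsub_def smul_def anginv_def fmult_def fconst_def)

lemma Psi1_zero: "f 0 = 0 \<Longrightarrow> Psi1 a b t tn f 0 = 0"
  by (simp add: Psi1_def fsub_def smul_def Btau_at Bs_def Eang_cis fmult_def)

lemma useq_zero: "useq phi0 psi0 \<tau> n 0 = 0"
  by (induction n) (simp_all add: u_init_eq Uc_def Psi1_zero)

section \<open>Discrete Gronwall argument and return to z\<close>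

context bounds
begin

text \<open>An explicit supersolution of the recursion
  \<open>E (n + 1) = (1 + 2 * K1 * \<tau>) * E n + CL * \<tau>^2\<close> with
  \<open>E 0 = 0\<close>. The factor 2 stands for the two errors, of \<open>U\<close> and of
  \<open>V\<close>.\<close>

definition En :: "real \<Rightarrow> nat \<Rightarrow> real" where
  "En \<tau> n = CL * \<tau>^2 * real n * exp (2 * K1 * \<tau> * real n)"

lemma En_le: "0 < \<tau> \<Longrightarrow> real n * \<tau> \<le> T \<Longrightarrow> En \<tau> n \<le> CE * \<tau>"
proof -
  assume \<tau>: "0 < \<tau>" and n: "real n * \<tau> \<le> T"
  have "En \<tau> n = (CL * \<tau>) * ((real n * \<tau>) * exp (2 * K1 * (real n * \<tau>)))"
    by (simp add: En_def power2_eq_square mult_ac)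
  also have "\<dots> \<le> (CL * \<tau>) * (T * exp (2 * K1 * T))"
    using n \<tau> CL0 K10 T0 by (intro mult_left_mono mult_mono) (auto intro: mult_left_mono)
  finally show ?thesis by (simp add: CE_def mult_ac)
qed

text \<open>Rests on \<open>1 + x <= exp x\<close> with \<open>x = 2 * K1 * \<tau>\<close>.\<close>

lemma En_Suc:
  assumes "0 < \<tau>"
  shows "En \<tau> n + \<tau> * (K1 * (En \<tau> n + En \<tau> n)) + \<tau> * (\<tau> * CL) \<le> En \<tau> (Suc n)"
proof -
  define x where "x = 2 * K1 * \<tau>"
  define e where "e = exp (x * real n)"
  have x: "0 \<le> x" using K10 assms by (simp add: x_def)
  have e: "1 \<le> e" using x by (simp add: e_def)
  have ex: "exp (x * real (Suc n)) = exp x * e" by (simp add: e_def exp_add[symmetric] algebra_simps)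
  have "1 + x \<le> exp x" by (rule exp_ge_add_one_self)
  then have 1: "(1 + x) * e \<le> exp x * e" using e by (intro mult_right_mono) auto
  have "1 * 1 \<le> exp x * e" using e x by (intro mult_mono) auto
  then have "CL * \<tau>^2 * (real n * ((1 + x) * e) + 1) \<le> CL * \<tau>^2 * (real n * (exp x * e) + exp x * e)"
    using CL0 1 by (intro mult_left_mono add_mono) auto
  also have "\<dots> = En \<tau> (Suc n)"
    unfolding En_def x_def[symmetric] ex by (simp add: algebra_simps)
  also have "CL * \<tau>^2 * (real n * ((1 + x) * e) + 1)
     = En \<tau> n + \<tau> * (K1 * (En \<tau> n + En \<tau> n)) + \<tau> * (\<tau> * CL)"
    unfolding En_def x_def[symmetric] e_def[symmetric] by (simp add: x_def algebra_simps power2_eq_square)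
  finally show ?thesis .
qed

text \<open>The induction runs over both errors at once, since a step for either uses both. The
  second is \<open>error_step\<close> for the conjugate solution; as the initial data are real, the
  same numerical sequence starts at both solutions.\<close>

lemma global_error:
  assumes S: "solution r s Ks Ke T M a b z zt"
    and S': "solution r s Ks Ke T M a b (\<lambda>t. fconj (z t)) (\<lambda>t. fconj (zt t))"
    and rv: "fconj (z 0) = z 0" "fconj (zt 0) = zt 0" and ab: "a = zt 0 0" "b = z 0 0"
    and \<tau>: "0 < \<tau>" "CE * \<tau> \<le> 1" and n: "real n * \<tau> \<le> T"
  shows "Hb r (\<lambda>k. Uc (z (real n * \<tau>)) (zt (real n * \<tau>)) k - useq (z 0) (zt 0) \<tau> n k) (En \<tau> n)"
    and "Hb r (\<lambda>k. Vc (z (real n * \<tau>)) (zt (real n * \<tau>)) k - fconj (useq (z 0) (zt 0) \<tau> n) k) (En \<tau> n)"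
proof -
  interpret S: solution r s Ks Ke T M a b z zt by (rule S)
  interpret S': solution r s Ks Ke T M a b "\<lambda>t. fconj (z t)" "\<lambda>t. fconj (zt t)" by (rule S')
  define u where "u = useq (z 0) (zt 0) \<tau>"
  have u0: "u n 0 = 0" for n by (simp add: u_def useq_zero)
  have cj: "Hb r (\<lambda>k. fconj f k - g k) E \<Longrightarrow> Hb r (\<lambda>k. f k - fconj g k) E" for f g E
    using Hb_fconj[of r "\<lambda>k. fconj f k - g k" E] by (simp add: fconj_def)
  have z: "Hb r (\<lambda>k. f k - f k) 0" for f :: fs by (simp add: Hb_def L2_set_def)
  have "Hb r (\<lambda>k. Uc (z (real n * \<tau>)) (zt (real n * \<tau>)) k - u n k) (En \<tau> n) \<and>
    Hb r (\<lambda>k. fconj (Vc (z (real n * \<tau>)) (zt (real n * \<tau>))) k - u n k) (En \<tau> n)"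
    using n
  proof (induction n)
    case 0
    then show ?case
      using z[of "Uc (z 0) (zt 0)"] Uc_fconj[of "z 0" "zt 0"] rv by (simp add: u_def u_init_eq En_def)
  next
    case (Suc n)
    define t where "t = real n * \<tau>"
    have t: "0 \<le> t" "0 \<le> \<tau>" "t + \<tau> \<le> T" using \<tau> Suc.prems by (auto simp: t_def algebra_simps)
    have st: "real (Suc n) * \<tau> = t + \<tau>" by (simp add: t_def algebra_simps)
    have nT: "real n * \<tau> \<le> T" using t by (simp add: t_def)
    from Suc.IH[OF nT] have U: "Hb r (\<lambda>k. Uc (z t) (zt t) k - u n k) (En \<tau> n)"
      and V: "Hb r (\<lambda>k. fconj (Vc (z t) (zt t)) k - u n k) (En \<tau> n)" by (auto simp: t_def)
    \<comment> \<open>The bootstrap: the bound already proved keeps the numerical solution close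
      enough for \<open>error_step\<close>.\<close>
    have E1: "En \<tau> n \<le> 1" using En_le[OF \<tau>(1) nT] \<tau>(2) by linarith
    have us: "u (Suc n) = Psi1 a b \<tau> t (u n)" by (simp add: u_def ab mean_def t_def)
    have 1: "Hb r (\<lambda>k. Uc (z (t + \<tau>)) (zt (t + \<tau>)) k - Psi1 a b \<tau> t (u n) k)
       (En \<tau> n + \<tau> * (K1 * (En \<tau> n + En \<tau> n)) + \<tau> * (\<tau> * CL))"
      by (rule S.error_step[OF t u0 U cj[OF V] E1])
    have 2: "Hb r (\<lambda>k. fconj (Vc (z (t + \<tau>)) (zt (t + \<tau>))) k - Psi1 a b \<tau> t (u n) k)
       (En \<tau> n + \<tau> * (K1 * (En \<tau> n + En \<tau> n)) + \<tau> * (\<tau> * CL))"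
      using S'.error_step[OF t, of "u n" "En \<tau> n"] u0 V cj[of "fconj (Uc (z t) (zt t))" "u n" "En \<tau> n"] U E1
      by (simp add: Uc_fconj Vc_fconj)
    show ?case unfolding st us using Hb_mono[OF 1 En_Suc[OF \<tau>(1)]] Hb_mono[OF 2 En_Suc[OF \<tau>(1)]] by blast
  qed
  then show "Hb r (\<lambda>k. Uc (z (real n * \<tau>)) (zt (real n * \<tau>)) k - useq (z 0) (zt 0) \<tau> n k) (En \<tau> n)"
    and "Hb r (\<lambda>k. Vc (z (real n * \<tau>)) (zt (real n * \<tau>)) k - fconj (useq (z 0) (zt 0) \<tau> n) k) (En \<tau> n)"
    using cj by (auto simp: u_def)
qed

text \<open>\<open>z\<close> is recovered from \<open>(U + V) / 2\<close> and \<open>zt\<close> from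
  \<open>U - V\<close> multiplied by \<open>angsym\<close>; the bound
  \<open>angsym k <= (J k)^2\<close> costs two derivatives, hence the index \<open>r - 2\<close>.
  The scheme reproduces both means exactly.\<close>

lemma scheme_error:
  assumes S: "solution r s Ks Ke T M a b z zt"
    and S': "solution r s Ks Ke T M a b (\<lambda>t. fconj (z t)) (\<lambda>t. fconj (zt t))"
    and rv: "fconj (z 0) = z 0" "fconj (zt 0) = zt 0" and ab: "a = zt 0 0" "b = z 0 0"
    and \<tau>: "0 < \<tau>" "CE * \<tau> \<le> 1" and n: "real n * \<tau> \<le> T"
  shows "Hb r (fsub (z (real n * \<tau>)) (zn (z 0) (zt 0) \<tau> n)) (CE * \<tau>)"
    and "Hb (r - 2) (fsub (zt (real n * \<tau>)) (ztn (z 0) (zt 0) \<tau> n)) (CE * \<tau>)"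
proof -
  interpret S: solution r s Ks Ke T M a b z zt by (rule S)
  define t where "t = real n * \<tau>"
  have t: "t \<in> {0..T}" using n \<tau> by (simp add: t_def)
  define u where "u = useq (z 0) (zt 0) \<tau> n"
  define e1 where "e1 = (\<lambda>k. Uc (z t) (zt t) k - u k)"
  define e2 where "e2 = (\<lambda>k. Vc (z t) (zt t) k - fconj u k)"
  have e: "Hb r e1 (CE * \<tau>)" "Hb r e2 (CE * \<tau>)"
    using Hb_mono[OF global_error(1)[OF S S' rv ab \<tau> n] En_le[OF \<tau>(1) n]]
      Hb_mono[OF global_error(2)[OF S S' rv ab \<tau> n] En_le[OF \<tau>(1) n]]
    by (simp_all add: e1_def e2_def u_def t_def)
  have m: "z t 0 = zt 0 0 * of_real t + z 0 0" "zt t 0 = zt 0 0"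
    using bouss_mean[OF S.bs T0 t] by auto
  have u0: "u 0 = 0" by (simp add: u_def useq_zero)
  have tt: "of_nat n * complex_of_real \<tau> = of_real t" by (simp add: t_def)
  have z1: "fsub (z t) (zn (z 0) (zt 0) \<tau> n) k = (1/2) * (e1 k + e2 k)" for k
    using u0 by (simp add: fsub_def zn_def u_def[symmetric] fadd_def smul_def fconst_def mean_def
        tt m e1_def e2_def Uc_def Vc_def field_simps)
  have "Hb r (\<lambda>k. (1/2) * (e1 k + e2 k)) (1/2 * (CE * \<tau> + CE * \<tau>))"
    by (intro Hb_scale Hb_add e) auto
  then show "Hb r (fsub (z (real n * \<tau>)) (zn (z 0) (zt 0) \<tau> n)) (CE * \<tau>)"
    unfolding t_def[symmetric] by (rule Hb_mono[OF Hb_cong]) (auto simp: z1)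
  have z2: "fsub (zt t) (ztn (z 0) (zt 0) \<tau> n) k = (\<i>/2 * of_real (angsym k)) * (e1 k - e2 k)" for k
  proof (cases "k = 0")
    case True
    then show ?thesis by (simp add: fsub_def ztn_def Let_def fadd_def smul_def fconst_def mean_def m ang_def fmult_def angsym_def)
  next
    case False
    then have "complex_of_real (angsym k) \<noteq> 0" using angsym_pos[OF False] by simp
    then show ?thesis using False
      by (simp add: fsub_def ztn_def fadd_def smul_def fconst_def ang_def fmult_def u_def[symmetric]
          e1_def e2_def Uc_def Vc_def field_simps)
  qed
  have "Hb (r - 2) (fsub (zt t) (ztn (z 0) (zt 0) \<tau> n)) (1/2 * (CE * \<tau> + CE * \<tau>))"
  proof (rule Hb_mult[OF Hb_diff[OF e]])
    fix k
    have "angsym k \<le> (J k)^2" using angsym_diff[of k] by (simp add: J_sq)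
    moreover have "0 \<le> angsym k" by (simp add: angsym_def)
    ultimately have "J k powr (r - 2) * cmod (fsub (zt t) (ztn (z 0) (zt 0) \<tau> n) k)
        \<le> J k powr (r - 2) * (1/2 * (J k)^2 * cmod (e1 k - e2 k))"
      unfolding z2 by (intro mult_left_mono) (auto simp: norm_mult norm_divide intro: mult_right_mono)
    also have "\<dots> = 1/2 * (J k powr r * cmod (e1 k - e2 k))" by (simp add: powr_diff)
    finally show "J k powr (r - 2) * cmod (fsub (zt t) (ztn (z 0) (zt 0) \<tau> n) k)
        \<le> 1/2 * (J k powr r * cmod (e1 k - e2 k))" .
  qed simp
  then show "Hb (r - 2) (fsub (zt (real n * \<tau>)) (ztn (z 0) (zt 0) \<tau> n)) (CE * \<tau>)"
    unfolding t_def[symmetric] by (rule Hb_mono) simp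
qed

end

text \<open>\<open>pbase\<close> lies on or above the line \<open>5/4 - r/2\<close> and meets it at
  \<open>r = 7/6\<close> and from \<open>r = 3/2\<close> on. For \<open>3/2 < r < 5/2\<close> no
  \<open>\<epsilon>\<close> is added, so the endpoint case of \<open>ke_bounded\<close> is
  needed.\<close>

lemma pexp_ge: "0 < \<epsilon> \<Longrightarrow> 1 \<le> r \<Longrightarrow> r < 5/2 \<Longrightarrow> 5/4 + r/2 \<le> r + pexp r \<epsilon>"
  unfolding pexp_def pbase_def pplus_def by (auto split: if_splits)

text \<open>At \<open>r = 5/2\<close> it is the added \<open>\<epsilon>\<close> that lifts the
  exponent above \<open>5/2\<close>.\<close>

lemma pexp_ge_large: "0 < \<epsilon> \<Longrightarrow> 5/2 \<le> r \<Longrightarrow> r \<le> r + pexp r \<epsilon> \<and> 5/2 < r + pexp r \<epsilon>"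
  unfolding pexp_def pbase_def pplus_def by auto

theorem theorem1:
  fixes r T :: real
  assumes "r \<ge> 1" and "T > 0"
  shows "\<exists>\<epsilon>0>0. \<forall>\<epsilon>. 0 < \<epsilon> \<and> \<epsilon> < \<epsilon>0 \<longrightarrow>
    (\<forall>M::real. \<exists>\<tau>0>0. \<exists>C>0.
      \<forall>phi0 psi0 :: fs. \<forall>z zt :: real \<Rightarrow> fs.
        real_valued phi0 \<and> real_valued psi0 \<and>
        bouss_solution T z zt \<and> z 0 = phi0 \<and> zt 0 = psi0 \<and>
        cont_H (r + pexp r \<epsilon>) T z \<and> cont_H (r + pexp r \<epsilon> - 2) T zt \<and>
        (\<forall>t\<in>{0..T}. hnorm (r + pexp r \<epsilon>) (z t) \<le> M \<and>
                     hnorm (r + pexp r \<epsilon> - 2) (zt t) \<le> M)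
        \<longrightarrow>
        (\<forall>\<tau>::real. \<forall>n::nat. 0 < \<tau> \<and> \<tau> \<le> \<tau>0 \<and> real n * \<tau> \<le> T \<longrightarrow>
           in_H r (fsub (z (real n * \<tau>)) (zn phi0 psi0 \<tau> n)) \<and>
           in_H (r - 2) (fsub (zt (real n * \<tau>)) (ztn phi0 psi0 \<tau> n)) \<and>
           hnorm r (fsub (z (real n * \<tau>)) (zn phi0 psi0 \<tau> n))
           + hnorm (r - 2) (fsub (zt (real n * \<tau>)) (ztn phi0 psi0 \<tau> n)) \<le> C * \<tau>))"
proof (rule exI[of _ 1], intro conjI allI impI)
  fix \<epsilon> M0 :: real
  assume \<epsilon>: "0 < \<epsilon> \<and> \<epsilon> < 1"
  define s' where "s' = r + pexp r \<epsilon>"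
  \<comment> \<open>The regularity at which the kernel estimate is applied: exactly the endpoint if
    \<open>r < 5/2\<close>, where \<open>s'\<close> may be larger, and all of \<open>s'\<close>
    otherwise.\<close>
  define s where "s = (if r < 5/2 then 5/4 + r/2 else s')"
  have s: "(5/2 < s \<and> r \<le> s) \<or> (r < 5/2 \<and> s = 5/4 + r/2)" "r \<le> s" "s \<le> s'"
    using pexp_ge[of \<epsilon> r] pexp_ge_large[of \<epsilon> r] \<epsilon> assms by (auto simp: s_def s'_def)
  obtain Ks where Ks: "0 \<le> Ks" "\<forall>q A f g a b. (\<forall>j l. cmod (q j l) \<le> A * ks j l) \<longrightarrow> 0 \<le> A \<longrightarrow> Hb r f a \<longrightarrow> Hb r g b \<longrightarrow>
     Hb r (bil q f g) (Ks * A * a * b) \<and> (\<forall>k. (\<lambda>j. cmod (q j (k - j) * (f j * g (k - j)))) summable_on UNIV)"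
    using ks_bounded[OF assms(1)] by blast
  obtain Ke where Ke: "0 \<le> Ke" "\<forall>q A f g a b. (\<forall>j l. cmod (q j l) \<le> A * ke j l) \<longrightarrow> 0 \<le> A \<longrightarrow> Hb s f a \<longrightarrow> Hb s g b \<longrightarrow>
     Hb r (bil q f g) (Ke * A * a * b)"
    using ke_bounded[OF assms(1) s(1)] by blast
  \<comment> \<open>\<open>M0\<close> is arbitrary in the statement and may be negative.\<close>
  define M where "M = max M0 0"
  interpret bounds r s Ks Ke T M
  proof unfold_locales
    show "1 \<le> r" "r \<le> s" "0 < T" by (fact assms s)+
    show "0 \<le> Ks" "0 \<le> Ke" by (fact Ks(1) Ke(1))+
    show "0 \<le> M" by (simp add: M_def)
  qed (use Ks(2) Ke(2) in blast)+
  show "\<exists>\<tau>0>0. \<exists>C>0.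
      \<forall>phi0 psi0 :: fs. \<forall>z zt :: real \<Rightarrow> fs.
        real_valued phi0 \<and> real_valued psi0 \<and>
        bouss_solution T z zt \<and> z 0 = phi0 \<and> zt 0 = psi0 \<and>
        cont_H (r + pexp r \<epsilon>) T z \<and> cont_H (r + pexp r \<epsilon> - 2) T zt \<and>
        (\<forall>t\<in>{0..T}. hnorm (r + pexp r \<epsilon>) (z t) \<le> M0 \<and>
                     hnorm (r + pexp r \<epsilon> - 2) (zt t) \<le> M0)
        \<longrightarrow>
        (\<forall>\<tau>::real. \<forall>n::nat. 0 < \<tau> \<and> \<tau> \<le> \<tau>0 \<and> real n * \<tau> \<le> T \<longrightarrow>
           in_H r (fsub (z (real n * \<tau>)) (zn phi0 psi0 \<tau> n)) \<and>
           in_H (r - 2) (fsub (zt (real n * \<tau>)) (ztn phi0 psi0 \<tau> n)) \<and>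
           hnorm r (fsub (z (real n * \<tau>)) (zn phi0 psi0 \<tau> n))
           + hnorm (r - 2) (fsub (zt (real n * \<tau>)) (ztn phi0 psi0 \<tau> n)) \<le> C * \<tau>)"
    unfolding s'_def[symmetric]
  \<comment> \<open>Chosen to give \<open>CE * \<tau> <= 1\<close>; the summand 1 guards against
    \<open>CE = 0\<close>.\<close>
  proof (rule exI[of _ "1 / (CE + 1)"], rule conjI, goal_cases)
    case 1
    then show ?case using CE0 by simp
  next
    case 2
    show ?case
    \<comment> \<open>Each of the two errors is at most \<open>CE * \<tau>\<close>; the summand 1
      makes the constant positive.\<close>
    proof (rule exI[of _ "2 * CE + 1"], intro conjI[of "0 < 2 * CE + 1"] allI impI, goal_cases)
      case 1
      then show ?case using CE0 by simp
    next
      case (2 phi0 psi0 z zt \<tau> n)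
      then have rv: "fconj phi0 = phi0" "fconj psi0 = psi0" and bs: "bouss_solution T z zt"
        and z0: "z 0 = phi0" "zt 0 = psi0"
        and c: "cont_H s' T z" "cont_H (s' - 2) T zt"
        and b: "\<And>t. t \<in> {0..T} \<Longrightarrow> hnorm s' (z t) \<le> M0" "\<And>t. t \<in> {0..T} \<Longrightarrow> hnorm (s' - 2) (zt t) \<le> M0"
        and \<tau>: "0 < \<tau>" "\<tau> \<le> 1 / (CE + 1)" and n: "real n * \<tau> \<le> T"
        by (auto simp: real_valued_def)
      have zH: "Hb s (z t) M" "Hb (s - 2) (zt t) M" if "t \<in> {0..T}" for t
      proof -
        have "Hb s' (z t) M" "Hb (s' - 2) (zt t) M"
          using c b[OF that] that by (auto simp: cont_H_def M_def intro!: hnorm_imp_Hb)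
        then show "Hb s (z t) M" "Hb (s - 2) (zt t) M" using s(3) Hb_lower by auto
      qed
      have T: "0 \<in> {0..T}" using assms by simp
      have J0: "J 0 = 1" by (simp add: J_def)
      have ab: "cmod (zt 0 0) \<le> M" "cmod (z 0 0) \<le> M"
        using Hb_coeff[OF zH(1)[OF T], of 0] Hb_coeff[OF zH(2)[OF T], of 0] by (auto simp: J0)
      have real: "cnj (zt 0 0) = zt 0 0" "cnj (z 0 0) = z 0 0"
        using rv z0 by (metis fconj_0)+
      have S: "solution r s Ks Ke T M (zt 0 0) (z 0 0) z zt"
      proof unfold_locales
        fix t assume t: "t \<in> {0..T}"
        show "z t 0 = zt 0 0 * of_real t + z 0 0" by (rule bouss_mean(2)[OF bs assms(2) t])
      qed (fact bs zH ab)+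
      have S': "solution r s Ks Ke T M (zt 0 0) (z 0 0) (\<lambda>t. fconj (z t)) (\<lambda>t. fconj (zt t))"
      proof unfold_locales
        fix t assume t: "t \<in> {0..T}"
        show "Hb s (fconj (z t)) M" "Hb (s - 2) (fconj (zt t)) M" by (intro Hb_fconj zH t)+
        have "cnj (z t 0) = cnj (zt 0 0) * of_real t + cnj (z 0 0)"
          unfolding bouss_mean(2)[OF bs assms(2) t] by simp
        then show "fconj (z t) 0 = zt 0 0 * of_real t + z 0 0" by (simp add: real)
      qed (fact bouss_solution_fconj[OF bs] ab)+
      have "(CE + 1) * \<tau> \<le> 1" using \<tau>(2) CE0 by (simp add: field_simps)
      then have CE\<tau>: "CE * \<tau> \<le> 1" using \<tau>(1) by (simp add: algebra_simps)
      note E = scheme_error[OF S S' _ _ refl refl \<tau>(1) CE\<tau> n, unfolded z0, OF rv]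
      have "CE * \<tau> + CE * \<tau> \<le> (2 * CE + 1) * \<tau>" using \<tau>(1) by (simp add: algebra_simps)
      then show ?case
        using Hb_imp_hnorm[OF E(1)] Hb_imp_hnorm[OF E(2)] by linarith
    qed
  qed
qed simp

end
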